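(* Let $G=\mathrm{SL}_3(\mathbb{C})$ and let $a,b,c,d,e,f$ be non-negative integers such that the irreducible $G$-representation $V(e,f)$ occurs in the decomposition of $V(a,b)\otimes V(c,d)$. Put $$s=\frac{(a+c-e)+2(b+d-f)}{3},\qquad t=\frac{(a+c-e)-(b+d-f)}{3}.$$ Let $J$ be the set of all integers $j$ satisfying the inequalities (1a) $0\le j\le s+t\le c+d$; (1b) $0\le s-j\le d$; (2a) $s+t-j\le a$; (2b) $j\le b$; (2d) $j\le b+t$; (3b) $j\le c-t$; (3c) $j\le c$. Then a basis of the complex vector space $\mathrm{Hom}_G\bigl(V(a,b)\otimes V(c,d),\,V(e,f)\bigr)$ is given by the restrictions to $V(a,b)\otimes V(c,d)$ of the maps $$\pi_{e,f}\circ\vartheta^{t}\circ\beta^{j}\circ\alpha^{s-j},\qquad j\in J,$$ if $t\ge 0$, and by the restrictions to $V(a,b)\otimes V(c,d)$ of the maps $$\pi_{e,f}\circ\omega^{-t}\circ\beta^{j}\circ\alpha^{s+t-j},\qquad j\in J,$$ if $t\le 0$.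
   Context: $G=\mathrm{SL}_3(\mathbb{C})$. $V(a,b)$ denotes the irreducible $G$-module whose highest weight has numerical labels $a,b$ ($a,b$ non-negative integers). Put $S^a:=\mathrm{Sym}^a(\mathbb{C}^3)$ and $D^b:=\mathrm{Sym}^b((\mathbb{C}^3)^\vee)$ (zero for negative exponents), with $e_1,e_2,e_3$ and $x_1,x_2,x_3$ dual bases of $\mathbb{C}^3$ and $(\mathbb{C}^3)^\vee$; elements of $S^a$, $D^b$ are viewed as homogeneous polynomials in the $e_i$, resp. $x_i$. $V(a,b)$ is realized concretely as the kernel of $$\Delta=\sum_{i=1}^3\frac{\partial}{\partial e_i}\otimes\frac{\partial}{\partial x_i}: S^a\otimes D^b\to S^{a-1}\otimes D^{b-1},$$ so that $V(a,b)\otimes V(c,d)\subset (S^a\otimes D^b)\otimes(S^c\otimes D^d)$. $\pi_{e,f}:S^e\otimes D^f\to V(e,f)$ denotes the $G$-equivariant projection onto the subspace $V(e,f)$. The elementary maps (defined for all values of the exponents, denoted by the same letters) are: $\alpha:(S^a\otimes D^b)\otimes(S^c\otimes D^d)\to(S^{a-1}\otimes D^b)\otimes(S^c\otimes D^{d-1})$, $\ \alpha=\sum_{i=1}^3\frac{\partial}{\partial e_i}\otimes\mathrm{id}\otimes\mathrm{id}\otimes\frac{\partial}{\partial x_i}$; $\beta:(S^a\otimes D^b)\otimes(S^c\otimes D^d)\to(S^{a}\otimes D^{b-1})\otimes(S^{c-1}\otimes D^{d})$, $\ \beta=\sum_{i=1}^3\mathrm{id}\otimes\frac{\partial}{\partial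 x_i}\otimes\frac{\partial}{\partial e_i}\otimes\mathrm{id}$; $\vartheta:(S^a\otimes S^c)\otimes D^{n}\to(S^{a-1}\otimes S^{c-1})\otimes D^{n+1}$, $\ \vartheta=\sum_{\sigma\in\mathfrak{S}_3}\mathrm{sign}(\sigma)\,\frac{\partial}{\partial e_{\sigma(1)}}\otimes\frac{\partial}{\partial e_{\sigma(2)}}\otimes x_{\sigma(3)}$; $\omega:S^{n}\otimes(D^b\otimes D^d)\to S^{n+1}\otimes(D^{b-1}\otimes D^{d-1})$, $\ \omega=\sum_{\sigma\in\mathfrak{S}_3}\mathrm{sign}(\sigma)\,e_{\sigma(1)}\otimes\frac{\partial}{\partial x_{\sigma(2)}}\otimes\frac{\partial}{\partial x_{\sigma(3)}}$, where $\mathrm{sign}(\sigma)\in\{\pm1\}$ is the sign of the permutation, and $x_{\sigma(3)}$, $e_{\sigma(1)}$ act by multiplication. Convention: in the compositions, the obvious multiplication maps are suppressed from the notation. For $t\ge0$: after $\beta^j\circ\alpha^{s-j}$, which lands in $(S^{a-s+j}\otimes D^{b-j})\otimes(S^{c-j}\otimes D^{d-s+j})$, one multiplies the two $D$-factors to land in $S^{a-s+j}\otimes S^{c-j}\otimes D^{b+d-s}$, applies $\vartheta^t$, then multiplies the two $S$-factors to land in $S^{a+c-s-2t}\otimes D^{b+d-s+t}=S^e\otimes D^f$, and applies $\pi_{e,f}$. For $t\le0$: after $\beta^j\circ\alpha^{s+t-j}$ one multiplies the two $S$-factors, applies $\omega^{-t}$, then multiplies the two $D$-factors to land in $S^e\otimes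 D^f$, and applies $\pi_{e,f}$. *)

theory Defs
  imports
    "HOL-Analysis.Analysis"
    "HOL-Combinatorics.Permutations"
    "HOL-Library.Poly_Mapping"
    "HOL-Library.Function_Algebras"
begin

section \<open>Polynomials\<close>

text \<open>
  Tensor products of polynomial spaces are realised as spaces of polynomials in disjoint sets of
  variables. A polynomial in the variables \<open>e\<^sub>i\<close> (\<open>E1\<close>), \<open>x\<^sub>i\<close> (\<open>X1\<close>), homogeneous of degree
  \<open>a\<close> and \<open>b\<close>, is an element of \<open>S\<^sup>a \<otimes> D\<^sup>b\<close>; the second tensor factor
  \<open>S\<^sup>c \<otimes> D\<^sup>d\<close> uses separate copies of the variables (\<open>E2\<close>, \<open>X2\<close>).
\<close>

datatype slot = E1 | X1 | E2 | X2

type_synonym var = "slot \<times> 3"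
type_synonym mpoly = "(var \<Rightarrow>\<^sub>0 nat) \<Rightarrow>\<^sub>0 complex"

definition Cst :: "complex \<Rightarrow> mpoly"
  where "Cst c = Poly_Mapping.single 0 c"

definition Var :: "var \<Rightarrow> mpoly"
  where "Var v = Poly_Mapping.single (Poly_Mapping.single v 1) 1"

definition pscale :: "complex \<Rightarrow> mpoly \<Rightarrow> mpoly"
  where "pscale c p = Cst c * p"

definition pderiv_var :: "var \<Rightarrow> mpoly \<Rightarrow> mpoly"
  where "pderiv_var v p =
    (\<Sum>m\<in>Poly_Mapping.keys p.
       Poly_Mapping.single (m - Poly_Mapping.single v 1)
         (of_nat (Poly_Mapping.lookup m v) * Poly_Mapping.lookup p m))"

definition subst :: "(var \<Rightarrow> mpoly) \<Rightarrow> mpoly \<Rightarrow> mpoly"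
  where "subst \<sigma> p =
    (\<Sum>m\<in>Poly_Mapping.keys p.
       Cst (Poly_Mapping.lookup p m)
         * (\<Prod>v\<in>Poly_Mapping.keys m. \<sigma> v ^ Poly_Mapping.lookup m v))"

definition rename :: "(slot \<Rightarrow> slot) \<Rightarrow> mpoly \<Rightarrow> mpoly"
  where "rename \<rho> = subst (\<lambda>(k, i). Var (\<rho> k, i))"

definition slot_degree :: "slot \<Rightarrow> (var \<Rightarrow>\<^sub>0 nat) \<Rightarrow> nat"
  where "slot_degree k m = (\<Sum>i\<in>UNIV. Poly_Mapping.lookup m (k, i))"

global_interpretation P: vector_space pscale
proof
  fix a b :: complex and p q :: mpoly
  show "pscale a (p + q) = pscale a p + pscale a q"
    by (simp add: pscale_def distrib_left)
  show "pscale (a + b) p = pscale a p + pscale b p"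
    by (simp add: pscale_def Cst_def single_add distrib_right)
  show "pscale a (pscale b p) = pscale (a * b) p"
    by (simp add: pscale_def Cst_def mult_single flip: mult.assoc)
  show "pscale 1 p = p"
    by (simp add: pscale_def Cst_def)
qed

section \<open>The group action and spaces of equivariant maps\<close>

definition SL3 :: "(complex^3^3) set"
  where "SL3 = {g. det g = 1}"

text \<open>
  \<open>g\<close> sends \<open>e\<^sub>i\<close> to \<open>\<Sum>\<^sub>j g\<^sub>j\<^sub>i e\<^sub>j\<close> and \<open>x\<^sub>i\<close> to \<open>x\<^sub>i \<circ> g\<inverse> = \<Sum>\<^sub>j (g\<inverse>)\<^sub>i\<^sub>j x\<^sub>j\<close>.
\<close>

definition act :: "complex^3^3 \<Rightarrow> mpoly \<Rightarrow> mpoly"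
  where "act g = subst (\<lambda>(k, i).
    if k = E1 \<or> k = E2 then \<Sum>j\<in>UNIV. pscale (g $ j $ i) (Var (k, j))
    else \<Sum>j\<in>UNIV. pscale (matrix_inv g $ i $ j) (Var (k, j)))"

definition G_submodule :: "mpoly set \<Rightarrow> bool"
  where "G_submodule M \<longleftrightarrow> P.subspace M \<and> (\<forall>g\<in>SL3. \<forall>p\<in>M. act g p \<in> M)"

text \<open>
  Maps with domain a subspace \<open>M\<close> are represented by total functions vanishing outside \<open>M\<close>, so
  that they form a vector space under the pointwise operations.
\<close>

definition restrict_to :: "mpoly set \<Rightarrow> (mpoly \<Rightarrow> mpoly) \<Rightarrow> mpoly \<Rightarrow> mpoly"
  where "restrict_to M \<phi> = (\<lambda>p. if p \<in> M then \<phi> p else 0)"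

definition Hom_G :: "mpoly set \<Rightarrow> mpoly set \<Rightarrow> (mpoly \<Rightarrow> mpoly) set"
  where "Hom_G M N = {\<phi>.
    (\<forall>p\<in>M. \<phi> p \<in> N) \<and>
    (\<forall>p\<in>M. \<forall>q\<in>M. \<phi> (p + q) = \<phi> p + \<phi> q) \<and>
    (\<forall>c. \<forall>p\<in>M. \<phi> (pscale c p) = pscale c (\<phi> p)) \<and>
    (\<forall>g\<in>SL3. \<forall>p\<in>M. \<phi> (act g p) = act g (\<phi> p)) \<and>
    (\<forall>p. p \<notin> M \<longrightarrow> \<phi> p = 0)}"

definition fscale :: "complex \<Rightarrow> (mpoly \<Rightarrow> mpoly) \<Rightarrow> mpoly \<Rightarrow> mpoly"
  where "fscale c \<phi> = (\<lambda>p. pscale c (\<phi> p))"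

global_interpretation F: vector_space fscale
  by standard
    (simp_all add: fscale_def fun_eq_iff P.scale_right_distrib P.scale_left_distrib)

definition is_basis :: "int set \<Rightarrow> (int \<Rightarrow> mpoly \<Rightarrow> mpoly) \<Rightarrow> (mpoly \<Rightarrow> mpoly) set \<Rightarrow> bool"
  where "is_basis J \<phi> H \<longleftrightarrow> inj_on \<phi> J \<and> F.independent (\<phi> ` J) \<and> F.span (\<phi> ` J) = H"

definition G_isomorphic :: "mpoly set \<Rightarrow> mpoly set \<Rightarrow> bool"
  where "G_isomorphic M N \<longleftrightarrow> (\<exists>\<phi>\<in>Hom_G M N. bij_betw \<phi> M N)"

text \<open>\<open>M\<close> is isomorphic to a direct summand of \<open>N\<close>.\<close>

definition occurs_in :: "mpoly set \<Rightarrow> mpoly set \<Rightarrow> bool"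
  where "occurs_in M N \<longleftrightarrow>
    (\<exists>W W'. G_submodule W \<and> G_submodule W' \<and> W \<inter> W' = {0} \<and>
       N = {p + q | p q. p \<in> W \<and> q \<in> W'} \<and> G_isomorphic M W)"

section \<open>The modules\<close>

definition SD :: "nat \<Rightarrow> nat \<Rightarrow> mpoly set"
  where "SD a b = {p. \<forall>m\<in>Poly_Mapping.keys p.
    slot_degree E1 m = a \<and> slot_degree X1 m = b \<and> slot_degree E2 m = 0 \<and> slot_degree X2 m = 0}"

definition Delta :: "mpoly \<Rightarrow> mpoly"
  where "Delta p = (\<Sum>i\<in>UNIV. pderiv_var (E1, i) (pderiv_var (X1, i) p))"

definition V :: "nat \<Rightarrow> nat \<Rightarrow> mpoly set"
  where "V a b = {p \<in> SD a b. Delta p = 0}"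

definition second_copy :: "mpoly \<Rightarrow> mpoly"
  where "second_copy = rename (\<lambda>k. if k = E1 then E2 else if k = X1 then X2 else k)"

definition tensor :: "mpoly set \<Rightarrow> mpoly set \<Rightarrow> mpoly set"
  where "tensor M N = P.span {p * second_copy q | p q. p \<in> M \<and> q \<in> N}"

text \<open>The equivariant projection of \<open>S\<^sup>e \<otimes> D\<^sup>f\<close> onto \<open>V(e,f)\<close>; it is unique because \<open>V(e,f)\<close>
  has multiplicity one in \<open>S\<^sup>e \<otimes> D\<^sup>f\<close>.\<close>

definition proj :: "nat \<Rightarrow> nat \<Rightarrow> mpoly \<Rightarrow> mpoly"
  where "proj e f = (THE \<phi>. \<phi> \<in> Hom_G (SD e f) (V e f) \<and> (\<forall>p\<in>V e f. \<phi> p = p))"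

section \<open>The elementary maps\<close>

definition alpha :: "mpoly \<Rightarrow> mpoly"
  where "alpha p = (\<Sum>i\<in>UNIV. pderiv_var (E1, i) (pderiv_var (X2, i) p))"

definition beta :: "mpoly \<Rightarrow> mpoly"
  where "beta p = (\<Sum>i\<in>UNIV. pderiv_var (X1, i) (pderiv_var (E2, i) p))"

text \<open>\<open>theta\<close> and \<open>omega\<close> put the single factor \<open>D\<^sup>n\<close>, resp. \<open>S\<^sup>n\<close>, of their source and target
  into slot \<open>X1\<close>, resp. \<open>E1\<close>.\<close>

definition theta :: "mpoly \<Rightarrow> mpoly"
  where "theta p = (\<Sum>\<sigma> | \<sigma> permutes (UNIV :: 3 set).
    pscale (of_int (sign \<sigma>))
      (Var (X1, \<sigma> 3) * pderiv_var (E1, \<sigma> 1) (pderiv_var (E2, \<sigma> 2) p)))"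

definition omega :: "mpoly \<Rightarrow> mpoly"
  where "omega p = (\<Sum>\<sigma> | \<sigma> permutes (UNIV :: 3 set).
    pscale (of_int (sign \<sigma>))
      (Var (E1, \<sigma> 1) * pderiv_var (X1, \<sigma> 2) (pderiv_var (X2, \<sigma> 3) p)))"

text \<open>The multiplication maps \<open>S\<^sup>m \<otimes> S\<^sup>n \<rightarrow> S\<^sup>m\<^sup>+\<^sup>n\<close> and \<open>D\<^sup>m \<otimes> D\<^sup>n \<rightarrow> D\<^sup>m\<^sup>+\<^sup>n\<close> identify the two
  copies of the variables.\<close>

definition mult_S :: "mpoly \<Rightarrow> mpoly"
  where "mult_S = rename (\<lambda>k. if k = E2 then E1 else k)"

definition mult_D :: "mpoly \<Rightarrow> mpoly"
  where "mult_D = rename (\<lambda>k. if k = X2 then X1 else k)"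

end

theory Submission
  imports Defs "HOL-Computational_Algebra.Polynomial"
begin

text \<open>
  A vector \<open>v\<close> and a covector \<open>\<xi>\<close> with \<open>\<langle>v, \<xi>\<rangle> = 0\<close> form a flag; the products \<open>v\<^sup>a \<xi>\<^sup>b\<close> over all
  flags span \<open>V(a,b)\<close>, and an element of \<open>V(e,f)\<close> is determined by its values on flags. Hence an
  equivariant map \<open>\<psi>\<close> is the same as the invariant function
  \<open>F(v\<^sub>1,\<xi>\<^sub>1,v\<^sub>2,\<xi>\<^sub>2,v\<^sub>3,\<xi>\<^sub>3) = \<psi>(v\<^sub>1\<^sup>a \<xi>\<^sub>1\<^sup>b \<otimes> v\<^sub>2\<^sup>c \<xi>\<^sub>2\<^sup>d)(\<xi>\<^sub>3,v\<^sub>3)\<close> on triples of flags. Moving \<open>v\<^sub>1,v\<^sub>2,v\<^sub>3\<close> to the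
  standard basis leaves the six pairings \<open>\<langle>v\<^sub>i, \<xi>\<^sub>j\<rangle>\<close>, \<open>i \<noteq> j\<close>, as coordinates, and the torus weights
  force every monomial of \<open>F\<close> in these to be determined by its exponent \<open>j\<close> at \<open>\<langle>v\<^sub>2, \<xi>\<^sub>1\<rangle>\<close>; the
  other five exponents are non-negative exactly when \<open>j \<in> J\<close>. For \<open>t \<ge> 0\<close> the map with index \<open>j\<close>
  gives a nonzero multiple of the \<open>j\<close>-th monomial times \<open>det(v\<^sub>1,v\<^sub>2,v\<^sub>3)\<^sup>t\<close>, which yields both
  spanning and independence. The case \<open>t \<le> 0\<close> is the same argument with vectors and covectors
  exchanged.
\<close>

section \<open>Evaluation and substitution\<close>

text \<open>A triple of flags can be moved to the standard basis only if
  \<open>ip v3 (crs v1 v2)\<close> is nonzero. Instead of a density argument, general position is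
  built into the spanning and vanishing statements, whose parameter \<open>n\<close> is chosen from
  the vectors already fixed. As the group consists of matrices of determinant one, homogeneity in
  \<open>v1\<close> has to absorb the remaining scalar. The projection is specified only by its
  characterising property, so it must be constructed, as a polynomial in \<open>qq\<close> and
  \<open>Delta\<close>, and shown to be unique; uniqueness reuses the same count of invariant
  monomials, in a case where there are none. Occurrence of V(e,f) acts through the centre of
  \<open>SL3\<close>: the central characters of both sides agree, and this makes s and t
  integers.\<close>

lemma UNIV_slot: "(UNIV :: slot set) = {E1, X1, E2, X2}"
  using slot.exhaust by auto

lemma finite_UNIV_slot [simp]: "finite (UNIV :: slot set)"
  by (simp add: UNIV_slot)

lemma finite_UNIV_var [simp]: "finite (UNIV :: var set)"
  by (simp add: finite_Prod_UNIV)

lemma finite_var_set [simp]: "finite (A :: var set)"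
  by (rule finite_subset[OF subset_UNIV finite_UNIV_var])

lemma mpoly_sum_single: "p = (\<Sum>m\<in>Poly_Mapping.keys p. Poly_Mapping.single m (Poly_Mapping.lookup p m))"
  by (rule poly_mapping_eqI)
    (simp add: lookup_sum lookup_single when_def not_in_keys_iff_lookup_eq_zero sum.delta)

text \<open>Generic in the key type, so that it serves for polynomials as well as for their exponent
  vectors.\<close>

lemma single_induct [case_names zero single add]:
  fixes p :: "'a \<Rightarrow>\<^sub>0 'b::comm_monoid_add"
  assumes "Q 0" and single: "\<And>m c. Q (Poly_Mapping.single m c)"
    and add: "\<And>p q. Q p \<Longrightarrow> Q q \<Longrightarrow> Q (p + q)"
  shows "Q p"
proof -
  have "Q (\<Sum>m\<in>S. Poly_Mapping.single m (Poly_Mapping.lookup p m))" if "finite S" for S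
    using that by induction (use assms in auto)
  moreover have "p = (\<Sum>m\<in>Poly_Mapping.keys p. Poly_Mapping.single m (Poly_Mapping.lookup p m))"
    by (rule poly_mapping_eqI)
      (simp add: lookup_sum lookup_single when_def not_in_keys_iff_lookup_eq_zero sum.delta)
  ultimately show ?thesis
    by (metis finite_keys)
qed

lemma Cst_simps: "Cst 0 = 0" "Cst 1 = 1" "Cst (x + y) = Cst x + Cst y" "Cst (x * y) = Cst x * Cst y"
  "Cst (- x) = - Cst x" "Cst (x - y) = Cst x - Cst y"
  by (simp_all add: Cst_def single_add mult_single single_uminus single_diff)

lemma Cst_power: "Cst (x ^ n) = Cst x ^ n"
  by (induction n) (simp_all add: Cst_simps)

lemma Cst_of_nat: "Cst (of_nat n) = of_nat n"
  by (simp add: Cst_def)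

lemma Var_power: "Var v ^ n = Poly_Mapping.single (Poly_Mapping.single v n) 1"
  by (induction n) (simp_all add: Var_def mult_single flip: single_add)

text \<open>Constants and variables generate the polynomial ring, so identities between ring
  homomorphisms or derivations need checking only there.\<close>

lemma mpoly_induct [case_names Cst Var add mult]:
  assumes Cst: "\<And>c. Q (Cst c)" and Var: "\<And>v. Q (Var v)"
    and add: "\<And>p q. Q p \<Longrightarrow> Q q \<Longrightarrow> Q (p + q)" and mult: "\<And>p q. Q p \<Longrightarrow> Q q \<Longrightarrow> Q (p * q)"
  shows "Q p"
proof (induction p rule: single_induct)
  case zero
  show ?case using Cst[of 0] by (simp add: Cst_simps)
next
  case (single m c)
  have pow: "Q (Var v ^ n)" for v n
    by (induction n) (use Cst[of 1] mult Var in \<open>auto simp: Cst_simps\<close>)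
  have "Q (Poly_Mapping.single m 1)"
  proof (induction m rule: single_induct)
    case zero
    show ?case using Cst[of 1] by (simp add: Cst_def)
  next
    case (single v n)
    show ?case using pow[of v n] by (simp add: Var_power)
  next
    case (add m m')
    then show ?case using mult[OF add] by (simp add: mult_single)
  qed
  from mult[OF Cst[of c] this] show ?case
    by (simp add: Cst_def mult_single)
qed (use add in auto)

text \<open>Substitution into an arbitrary commutative ring, with \<open>h\<close> carrying the
  coefficients. Its instances are \<open>subst\<close> (polynomials), \<open>ev\<close> (complex
  numbers) and restriction to a line (univariate polynomials), so the homomorphism laws are proved
  once.\<close>

definition psub :: "(complex \<Rightarrow> 'r) \<Rightarrow> (var \<Rightarrow> 'r) \<Rightarrow> mpoly \<Rightarrow> 'r::comm_ring_1"
  where "psub h \<sigma> p =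
    (\<Sum>m\<in>Poly_Mapping.keys p.
       h (Poly_Mapping.lookup p m) * (\<Prod>v\<in>Poly_Mapping.keys m. \<sigma> v ^ Poly_Mapping.lookup m v))"

locale coeff_hom =
  fixes h :: "complex \<Rightarrow> 'r::comm_ring_1"
  assumes h_add: "h (x + y) = h x + h y" and h_mult: "h (x * y) = h x * h y" and h_1: "h 1 = 1"
begin

lemma h_0: "h 0 = 0"
  using h_add[of 0 0] by simp

text \<open>Letting the product run over all of the finitely many variables turns addition of
  exponents into multiplication of monomials without tracking supports.\<close>

lemma mono_prod: "(\<Prod>v\<in>Poly_Mapping.keys m. \<sigma> v ^ Poly_Mapping.lookup m v)
    = (\<Prod>v\<in>UNIV. (\<sigma> v :: 'r) ^ Poly_Mapping.lookup m v)" for m :: "var \<Rightarrow>\<^sub>0 nat"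
  by (rule prod.mono_neutral_left) (auto simp: in_keys_iff)

lemma psub_superset:
  assumes "finite S" "Poly_Mapping.keys p \<subseteq> S"
  shows "psub h \<sigma> p = (\<Sum>m\<in>S. h (Poly_Mapping.lookup p m) * (\<Prod>v\<in>UNIV. \<sigma> v ^ Poly_Mapping.lookup m v))"
  unfolding psub_def mono_prod
  by (rule sum.mono_neutral_left) (use assms in \<open>auto simp: in_keys_iff h_0\<close>)

lemma psub_add: "psub h \<sigma> (p + q) = psub h \<sigma> p + psub h \<sigma> q"
  using Poly_Mapping.keys_add[of p q]
  by (simp add: psub_superset[of "Poly_Mapping.keys p \<union> Poly_Mapping.keys q"] lookup_add h_add
      distrib_right sum.distrib)

lemma psub_0: "psub h \<sigma> 0 = 0"
  by (simp add: psub_def)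

lemma psub_single: "psub h \<sigma> (Poly_Mapping.single m c) = h c * (\<Prod>v\<in>UNIV. \<sigma> v ^ Poly_Mapping.lookup m v)"
  by (subst psub_superset[of "{m}"]) auto

lemma psub_mult: "psub h \<sigma> (p * q) = psub h \<sigma> p * psub h \<sigma> q"
proof (induction p rule: single_induct)
  case (single m c)
  show ?case
    by (induction q rule: single_induct)
      (simp_all add: psub_0 mult_single psub_single psub_add distrib_left distrib_right lookup_add
        power_add prod.distrib h_mult mult_ac)
qed (simp_all add: psub_0 psub_add distrib_right)

lemma psub_Cst: "psub h \<sigma> (Cst c) = h c"
  by (simp add: Cst_def psub_single)

lemma psub_1: "psub h \<sigma> 1 = 1"
  using psub_Cst[of \<sigma> 1] by (simp add: Cst_simps h_1)

lemma psub_Var: "psub h \<sigma> (Var v) = \<sigma> v"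
  by (simp add: Var_def psub_single h_1 lookup_single when_def if_distrib[of "\<lambda>n. _ ^ n"] cong: if_cong)

lemma psub_uminus: "psub h \<sigma> (- p) = - psub h \<sigma> p"
  using psub_add[of \<sigma> p "- p"] by (simp add: psub_0 eq_neg_iff_add_eq_0 add.commute)

lemma psub_diff: "psub h \<sigma> (p - q) = psub h \<sigma> p - psub h \<sigma> q"
  using psub_add[of \<sigma> p "- q"] by (simp add: psub_uminus)

lemma psub_power: "psub h \<sigma> (p ^ n) = psub h \<sigma> p ^ n"
  by (induction n) (simp_all add: psub_1 psub_mult)

lemma psub_sum: "psub h \<sigma> (\<Sum>i\<in>A. g i) = (\<Sum>i\<in>A. psub h \<sigma> (g i))"
  by (induction A rule: infinite_finite_induct) (simp_all add: psub_0 psub_add)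

lemma psub_prod: "psub h \<sigma> (\<Prod>i\<in>A. g i) = (\<Prod>i\<in>A. psub h \<sigma> (g i))"
  by (induction A rule: infinite_finite_induct) (simp_all add: psub_1 psub_mult)

lemma psub_pscale: "psub h \<sigma> (pscale c p) = h c * psub h \<sigma> p"
  by (simp add: pscale_def psub_mult psub_Cst)

lemmas psub_simps = psub_add psub_0 psub_mult psub_Cst psub_1 psub_Var psub_uminus psub_diff
  psub_power psub_sum psub_prod psub_pscale

end

definition ev :: "(var \<Rightarrow> complex) \<Rightarrow> mpoly \<Rightarrow> complex"
  where "ev = psub (\<lambda>c. c)"

interpretation hom_Cst: coeff_hom Cst
  by standard (simp_all add: Cst_simps)

interpretation hom_id: coeff_hom "\<lambda>c. c"
  by standard simp_all

interpretation hom_poly: coeff_hom "\<lambda>c. [:c:]"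
  by standard (simp_all add: mult_ac)

lemma subst_eq_psub: "subst = psub Cst"
  by (simp add: fun_eq_iff subst_def psub_def)

lemmas ev_simps [simp] = hom_id.psub_simps[folded ev_def]
lemmas subst_simps [simp] = hom_Cst.psub_simps[folded subst_eq_psub, folded pscale_def]

lemma ev_subst: "ev x (subst \<sigma> p) = ev (\<lambda>v. ev x (\<sigma> v)) p"
  by (induction p rule: mpoly_induct) simp_all

section \<open>Derivatives\<close>

lemma pderiv_var_superset:
  assumes "finite S" "Poly_Mapping.keys p \<subseteq> S"
  shows "pderiv_var v p = (\<Sum>m\<in>S. Poly_Mapping.single (m - Poly_Mapping.single v 1)
         (of_nat (Poly_Mapping.lookup m v) * Poly_Mapping.lookup p m))"
  unfolding pderiv_var_def
  by (rule sum.mono_neutral_left) (use assms in \<open>auto simp: in_keys_iff\<close>)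

lemma pderiv_var_add [simp]: "pderiv_var v (p + q) = pderiv_var v p + pderiv_var v q"
  using Poly_Mapping.keys_add[of p q]
  by (simp add: pderiv_var_superset[of "Poly_Mapping.keys p \<union> Poly_Mapping.keys q"] lookup_add
      distrib_left single_add sum.distrib)

lemma pderiv_var_0 [simp]: "pderiv_var v 0 = 0"
  by (simp add: pderiv_var_def)

lemma pderiv_var_single: "pderiv_var v (Poly_Mapping.single m c)
    = Poly_Mapping.single (m - Poly_Mapping.single v 1) (of_nat (Poly_Mapping.lookup m v) * c)"
  by (subst pderiv_var_superset[of "{m}"]) auto

lemma pderiv_var_Cst [simp]: "pderiv_var v (Cst c) = 0"
  by (simp add: Cst_def pderiv_var_single)

lemma pderiv_var_1 [simp]: "pderiv_var v 1 = 0"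
  using pderiv_var_Cst[of v 1] by (simp add: Cst_simps)

lemma pderiv_var_Var [simp]: "pderiv_var v (Var w) = (if v = w then 1 else 0)"
  by (simp add: Var_def pderiv_var_single lookup_single when_def)

text \<open>Exponents are naturals, so lowering one commutes with adding exponents only if it is
  positive; in the Leibniz rule the other case carries the coefficient 0.\<close>

lemma single_diff_add:
  assumes "Poly_Mapping.lookup m v \<noteq> 0"
  shows "m + m' - Poly_Mapping.single v 1 = (m - Poly_Mapping.single v 1) + (m' :: 'a \<Rightarrow>\<^sub>0 nat)"
  by (rule poly_mapping_eqI) (use assms in \<open>auto simp: lookup_add lookup_minus lookup_single when_def\<close>)

lemma pderiv_var_mult [simp]:
  "pderiv_var v (p * q) = pderiv_var v p * q + p * pderiv_var v q"
proof (induction p rule: single_induct)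
  case (single m c)
  show ?case
  proof (induction q rule: single_induct)
    case (single m' c')
    have *: "Poly_Mapping.single (m + m' - Poly_Mapping.single v 1) (of_nat (Poly_Mapping.lookup m v) * c * c')
      = Poly_Mapping.single (m - Poly_Mapping.single v 1 + m') (of_nat (Poly_Mapping.lookup m v) * c * c')"
      by (cases "Poly_Mapping.lookup m v = 0") (simp_all add: single_diff_add del: One_nat_def)
    have **: "Poly_Mapping.single (m + m' - Poly_Mapping.single v 1) (of_nat (Poly_Mapping.lookup m' v) * c * c')
      = Poly_Mapping.single (m + (m' - Poly_Mapping.single v 1)) (of_nat (Poly_Mapping.lookup m' v) * c * c')"
      using single_diff_add[of m' v m]
      by (cases "Poly_Mapping.lookup m' v = 0") (simp_all add: add.commute del: One_nat_def)
    show ?case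
      using * ** by (simp add: mult_single pderiv_var_single lookup_add distrib_left distrib_right
        single_add mult_ac add_ac del: One_nat_def)
  qed (simp_all add: distrib_left)
qed (simp_all add: distrib_right)

lemma pderiv_var_uminus [simp]: "pderiv_var v (- p) = - pderiv_var v p"
  using pderiv_var_add[of v p "- p"] by (simp del: pderiv_var_add add: eq_neg_iff_add_eq_0 add.commute)

lemma pderiv_var_diff [simp]: "pderiv_var v (p - q) = pderiv_var v p - pderiv_var v q"
  using pderiv_var_add[of v p "- q"] by (simp del: pderiv_var_add)

lemma pderiv_var_of_nat [simp]: "pderiv_var v (of_nat n) = 0"
  using pderiv_var_Cst[of v "of_nat n"] by (simp only: Cst_of_nat)

lemma pderiv_var_sum [simp]: "pderiv_var v (\<Sum>i\<in>A. g i) = (\<Sum>i\<in>A. pderiv_var v (g i))"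
  by (induction A rule: infinite_finite_induct) simp_all

lemma pderiv_var_power: "pderiv_var v (p ^ n) = of_nat n * p ^ (n - 1) * pderiv_var v p"
proof (induction n)
  case (Suc n)
  then show ?case
    by (cases n) (simp_all add: algebra_simps)
qed simp

lemma pderiv_var_commute: "pderiv_var v (pderiv_var w p) = pderiv_var w (pderiv_var v p)"
  by (induction p rule: mpoly_induct) (simp_all add: algebra_simps)

section \<open>Multihomogeneous polynomials\<close>

definition hmg :: "(slot \<Rightarrow> nat) \<Rightarrow> mpoly set"
  where "hmg \<delta> = {p. \<forall>m\<in>Poly_Mapping.keys p. \<forall>k. slot_degree k m = \<delta> k}"

definition unit_dg :: "slot \<Rightarrow> slot \<Rightarrow> nat"
  where "unit_dg k s = (if s = k then 1 else 0)"

definition dg :: "slot \<Rightarrow> slot \<Rightarrow> nat \<Rightarrow> nat \<Rightarrow> slot \<Rightarrow> nat"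
  where "dg k l a b s = (if s = k then a else if s = l then b else 0)"

lemma slot_degree_add: "slot_degree k (m + m') = slot_degree k m + slot_degree k m'"
  by (simp add: slot_degree_def lookup_add sum.distrib)

lemma subspace_hmg: "P.subspace (hmg \<delta>)"
proof (rule P.subspaceI)
  fix x y assume "x \<in> hmg \<delta>" "y \<in> hmg \<delta>"
  then show "x + y \<in> hmg \<delta>"
    using Poly_Mapping.keys_add[of x y] by (auto simp: hmg_def)
next
  fix c x assume "x \<in> hmg \<delta>"
  then show "pscale c x \<in> hmg \<delta>"
    using keys_mult[of "Cst c" x] by (auto simp: hmg_def pscale_def Cst_def split: if_splits)
qed (simp add: hmg_def)

lemma hmg_mult:
  assumes "p \<in> hmg \<delta>" "q \<in> hmg \<delta>'"
  shows "p * q \<in> hmg (\<lambda>s. \<delta> s + \<delta>' s)"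
  using assms keys_mult[of p q] by (fastforce simp: hmg_def slot_degree_add)

lemma hmg_Cst: "Cst c \<in> hmg (\<lambda>_. 0)"
  by (auto simp: hmg_def Cst_def slot_degree_def split: if_splits)

lemma hmg_1: "1 \<in> hmg (\<lambda>_. 0)"
  using hmg_Cst[of 1] by (simp add: Cst_simps)

lemma hmg_Var: "Var (k, i) \<in> hmg (unit_dg k)"
  by (auto simp: hmg_def Var_def slot_degree_def lookup_single when_def unit_dg_def)

lemma hmg_power: "p \<in> hmg \<delta> \<Longrightarrow> p ^ n \<in> hmg (\<lambda>s. n * \<delta> s)"
  by (induction n) (use hmg_1 hmg_mult in auto)

lemma hmg_pscale: "p \<in> hmg \<delta> \<Longrightarrow> pscale c p \<in> hmg \<delta>"
  using subspace_hmg by (rule P.subspace_scale)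

lemma hmg_sum: "(\<And>i. i \<in> A \<Longrightarrow> g i \<in> hmg \<delta>) \<Longrightarrow> (\<Sum>i\<in>A. g i) \<in> hmg \<delta>"
  using subspace_hmg by (rule P.subspace_sum)

lemma hmg_Cst_mult: "p \<in> hmg \<delta> \<Longrightarrow> Cst c * p \<in> hmg \<delta>"
  using hmg_pscale by (simp add: pscale_def)

lemma hmg_prod: "(\<And>i. i \<in> A \<Longrightarrow> g i \<in> hmg (\<delta> i)) \<Longrightarrow> (\<Prod>i\<in>A. g i) \<in> hmg (\<lambda>s. \<Sum>i\<in>A. \<delta> i s)"
  by (induction A rule: infinite_finite_induct) (use hmg_1 hmg_mult in auto)

text \<open>For \<open>\<delta> k = 0\<close> the truncated degree is harmless, since the derivative
  is then zero.\<close>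

lemma hmg_pderiv:
  assumes "p \<in> hmg \<delta>"
  shows "pderiv_var (k, i) p \<in> hmg (\<delta>(k := \<delta> k - 1))"
  unfolding pderiv_var_def
proof (rule hmg_sum)
  fix m assume "m \<in> Poly_Mapping.keys p"
  then have "slot_degree s m = \<delta> s" for s
    using assms by (auto simp: hmg_def)
  moreover have "slot_degree s (m - Poly_Mapping.single (k, i) 1)
      = (if s = k then slot_degree s m - 1 else slot_degree s m)"
    if "Poly_Mapping.lookup m (k, i) > 0" for s
  proof -
    have "m = (m - Poly_Mapping.single (k, i) 1) + Poly_Mapping.single (k, i) 1"
      by (rule poly_mapping_eqI) (use that in \<open>auto simp: lookup_add lookup_minus lookup_single when_def\<close>)
    then have "slot_degree s m
        = slot_degree s (m - Poly_Mapping.single (k, i) 1) + slot_degree s (Poly_Mapping.single (k, i) 1)"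
      by (metis slot_degree_add)
    then show ?thesis
      by (auto simp: slot_degree_def lookup_single when_def)
  qed
  ultimately show "Poly_Mapping.single (m - Poly_Mapping.single (k, i) 1)
      (of_nat (Poly_Mapping.lookup m (k, i)) * Poly_Mapping.lookup p m) \<in> hmg (\<delta>(k := \<delta> k - 1))"
    by (cases "Poly_Mapping.lookup m (k, i) = 0") (auto simp: hmg_def simp del: One_nat_def)
qed

lemma hmg_pderiv_0:
  assumes "p \<in> hmg \<delta>" "\<delta> k = 0"
  shows "pderiv_var (k, i) p = 0"
  unfolding pderiv_var_def
proof (rule sum.neutral, rule ballI)
  fix m assume "m \<in> Poly_Mapping.keys p"
  then have "slot_degree k m = 0"
    using assms by (auto simp: hmg_def)
  then have "Poly_Mapping.lookup m (k, i) = 0"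
    by (simp add: slot_degree_def)
  then show "Poly_Mapping.single (m - Poly_Mapping.single (k, i) 1)
      (of_nat (Poly_Mapping.lookup m (k, i)) * Poly_Mapping.lookup p m) = 0"
    by simp
qed

text \<open>Recovers a polynomial from its first partials, which drives the degree inductions and
  fixes the scalars in the commutation formulas.\<close>

lemma euler:
  assumes "p \<in> hmg \<delta>"
  shows "(\<Sum>i\<in>UNIV. Var (k, i) * pderiv_var (k, i) p) = of_nat (\<delta> k) * p"
proof -
  have *: "Var v * pderiv_var v (Poly_Mapping.single m c)
      = of_nat (Poly_Mapping.lookup m v) * Poly_Mapping.single m c" for v m c
  proof (cases "Poly_Mapping.lookup m v = 0")
    case False
    then have "Poly_Mapping.single v 1 + (m - Poly_Mapping.single v 1) = m"
      by (intro poly_mapping_eqI) (auto simp: lookup_add lookup_minus lookup_single when_def)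
    then show ?thesis
      by (simp add: pderiv_var_single Var_def mult_single Cst_of_nat[symmetric] Cst_def
          del: single_of_nat)
  qed (simp add: pderiv_var_single)
  have "(\<Sum>i\<in>UNIV. Var (k, i) * pderiv_var (k, i) (\<Sum>m\<in>Poly_Mapping.keys p. Poly_Mapping.single m (Poly_Mapping.lookup p m)))
     = (\<Sum>m\<in>Poly_Mapping.keys p. \<Sum>i\<in>UNIV. of_nat (Poly_Mapping.lookup m (k, i)) * Poly_Mapping.single m (Poly_Mapping.lookup p m))"
    by (simp add: sum_distrib_left * ) (rule sum.swap)
  also have "\<dots> = (\<Sum>m\<in>Poly_Mapping.keys p. of_nat (\<delta> k) * Poly_Mapping.single m (Poly_Mapping.lookup p m))"
    using assms by (intro sum.cong refl) (auto simp: hmg_def slot_degree_def simp flip: sum_distrib_right of_nat_sum)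
  finally show ?thesis
    using mpoly_sum_single[of p] by (simp flip: sum_distrib_left)
qed

lemma hmg_subst:
  assumes p: "p \<in> hmg \<delta>" and \<sigma>: "\<And>k i. \<sigma> (k, i) \<in> hmg (unit_dg k)"
  shows "subst \<sigma> p \<in> hmg \<delta>"
  unfolding subst_def
proof (intro hmg_sum hmg_Cst_mult)
  fix m assume m: "m \<in> Poly_Mapping.keys p"
  have "(\<Prod>v\<in>UNIV. \<sigma> v ^ Poly_Mapping.lookup m v)
      \<in> hmg (\<lambda>s. \<Sum>v\<in>UNIV. Poly_Mapping.lookup m v * unit_dg (fst v) s)"
  proof (rule hmg_prod)
    fix v :: var
    show "\<sigma> v ^ Poly_Mapping.lookup m v \<in> hmg (\<lambda>s. Poly_Mapping.lookup m v * unit_dg (fst v) s)"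
      using hmg_power[OF \<sigma>[of "fst v" "snd v"]] by simp
  qed
  moreover have "(\<Sum>v\<in>UNIV. Poly_Mapping.lookup m v * unit_dg (fst v) s) = \<delta> s" for s
  proof -
    have "(\<Sum>v\<in>UNIV. Poly_Mapping.lookup m v * unit_dg (fst v) s)
        = (\<Sum>k\<in>UNIV. \<Sum>i\<in>UNIV. Poly_Mapping.lookup m (k, i) * unit_dg k s)"
      by (simp add: sum.cartesian_product flip: UNIV_Times_UNIV) (simp add: case_prod_beta)
    also have "\<dots> = (\<Sum>k\<in>UNIV. if k = s then slot_degree k m else 0)"
      by (intro sum.cong refl) (auto simp: unit_dg_def slot_degree_def)
    also have "\<dots> = \<delta> s"
      using m p by (auto simp: sum.delta hmg_def)
    finally show ?thesis .
  qed
  ultimately show "(\<Prod>v\<in>Poly_Mapping.keys m. \<sigma> v ^ Poly_Mapping.lookup m v) \<in> hmg \<delta>"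
    by (simp add: hom_Cst.mono_prod)
qed

lemma hmg_const:
  assumes "p \<in> hmg (\<lambda>_. 0)"
  shows "\<exists>c. p = Cst c"
proof -
  have "m = 0" if "m \<in> Poly_Mapping.keys p" for m
  proof (rule poly_mapping_eqI)
    fix v :: var
    obtain k i where v: "v = (k, i)" by force
    have "slot_degree k m = 0" using assms that by (auto simp: hmg_def)
    then show "Poly_Mapping.lookup m v = Poly_Mapping.lookup 0 v"
      by (simp add: slot_degree_def v)
  qed
  then have "Poly_Mapping.keys p \<subseteq> {0}" by blast
  then have "p = Cst (Poly_Mapping.lookup p 0)"
    by (intro poly_mapping_eqI) (auto simp: Cst_def lookup_single when_def in_keys_iff)
  then show ?thesis ..
qed

lemma SD_eq: "SD a b = hmg (dg E1 X1 a b)"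
proof -
  have "(\<forall>k. slot_degree k m = dg E1 X1 a b k) \<longleftrightarrow>
    slot_degree E1 m = a \<and> slot_degree X1 m = b \<and> slot_degree E2 m = 0 \<and> slot_degree X2 m = 0" for m
    by (auto simp: dg_def) (metis slot.exhaust)
  then show ?thesis
    by (simp add: SD_def hmg_def)
qed

section \<open>Powers of linear forms and contractions\<close>

definition L :: "slot \<Rightarrow> complex^3 \<Rightarrow> mpoly"
  where "L k v = (\<Sum>i\<in>UNIV. Cst (v $ i) * Var (k, i))"

text \<open>Bilinear pairing of a vector with a covector, without complex conjugation.\<close>

definition ip :: "complex^3 \<Rightarrow> complex^3 \<Rightarrow> complex"
  where "ip v w = (\<Sum>i\<in>UNIV. v $ i * w $ i)"

definition crs :: "complex^3 \<Rightarrow> complex^3 \<Rightarrow> complex^3"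
  where "crs v w = vector [v$2 * w$3 - v$3 * w$2, v$3 * w$1 - v$1 * w$3, v$1 * w$2 - v$2 * w$1]"

definition contr :: "slot \<Rightarrow> slot \<Rightarrow> mpoly \<Rightarrow> mpoly"
  where "contr k l p = (\<Sum>i\<in>UNIV. pderiv_var (k, i) (pderiv_var (l, i) p))"

text \<open>Polynomials in an \<open>E\<close> slot are functions of a covector, those in an
  \<open>X\<close> slot functions of a vector; so \<open>pt E1 X1 w v\<close> evaluates at the
  covector \<open>w\<close> and the vector \<open>v\<close>.\<close>

definition pt :: "slot \<Rightarrow> slot \<Rightarrow> complex^3 \<Rightarrow> complex^3 \<Rightarrow> var \<Rightarrow> complex"
  where "pt k l v w = (\<lambda>(s, i). if s = k then v $ i else if s = l then w $ i else 0)"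

lemma ip_simps: "ip (v + w) z = ip v z + ip w z" "ip (u *s v) z = u * ip v z" "ip 0 z = 0"
  "ip z (v + w) = ip z v + ip z w" "ip z (u *s v) = u * ip z v" "ip z 0 = 0"
  by (simp_all add: ip_def sum_3 algebra_simps)

lemma ip_axis: "ip (axis i 1) v = v $ i" "ip v (axis i 1) = v $ i"
  by (simp_all add: ip_def axis_def if_distrib if_distribR cong: if_cong)

lemma L_add: "L k (v + w) = L k v + L k w"
  by (simp add: L_def Cst_simps distrib_right sum.distrib)

lemma L_scale: "L k (u *s v) = Cst u * L k v"
  by (simp add: L_def Cst_simps sum_distrib_left mult.assoc)

lemma L_axis: "L k (axis i 1) = Var (k, i)"
  by (simp add: L_def axis_def if_distrib[of Cst] if_distrib[of "\<lambda>x. x * _"] Cst_simps cong: if_cong)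

lemma hmg_L: "L k v \<in> hmg (unit_dg k)"
  by (simp add: L_def hmg_sum hmg_Cst_mult hmg_Var)

lemma hmg_L_power: "L k v ^ n \<in> hmg (\<lambda>s. n * unit_dg k s)"
  by (intro hmg_power hmg_L)

lemma pderiv_L: "pderiv_var (s, i) (L k v) = (if s = k then Cst (v $ i) else 0)"
  by (simp add: L_def if_distrib cong: if_cong)

lemma pderiv_L_power:
  "pderiv_var (s, i) (L k v ^ n) = (if s = k then of_nat n * Cst (v $ i) * L k v ^ (n - 1) else 0)"
  by (simp add: pderiv_var_power pderiv_L)

lemma ev_L: "ev x (L k v) = (\<Sum>i\<in>UNIV. v $ i * x (k, i))"
  by (simp add: L_def)

lemma ev_L_pt: "ev (pt k l w z) (L k v) = ip v w" "k \<noteq> l \<Longrightarrow> ev (pt k l w z) (L l v) = ip v z"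
  by (simp_all add: ev_L pt_def ip_def)

lemma contr_add: "contr k l (p + q) = contr k l p + contr k l q"
  by (simp add: contr_def sum.distrib)

lemma contr_Cst_mult: "contr k l (Cst c * p) = Cst c * contr k l p"
  by (simp add: contr_def sum_distrib_left)

lemma contr_commute: "contr k l p = contr l k p"
  by (simp add: contr_def pderiv_var_commute)

text \<open>\<open>R\<close> collects the factors that the contraction does not touch, so that one
  formula covers \<open>Delta\<close>, \<open>alpha\<close> and \<open>beta\<close>.\<close>

lemma contr_powers:
  assumes "k \<noteq> l" "\<And>i. pderiv_var (k, i) R = 0" "\<And>i. pderiv_var (l, i) R = 0"
  shows "contr k l (L k v ^ a * L l w ^ b * R)
    = Cst (of_nat a * of_nat b * ip v w) * (L k v ^ (a - 1) * L l w ^ (b - 1) * R)"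
proof -
  have "pderiv_var (k, i) (pderiv_var (l, i) (L k v ^ a * L l w ^ b * R))
    = Cst (of_nat a * of_nat b) * Cst (v $ i * w $ i) * (L k v ^ (a - 1) * L l w ^ (b - 1) * R)" for i
    using assms by (simp add: pderiv_L_power Cst_simps Cst_of_nat mult_ac)
  moreover have "Cst (ip v w) = (\<Sum>i\<in>UNIV. Cst (v $ i * w $ i))"
    by (simp add: ip_def sum_3 Cst_simps)
  ultimately show ?thesis
    by (simp add: contr_def Cst_simps(4)[of _ "ip v w"] sum_distrib_left sum_distrib_right)
qed

text \<open>V(a,b) with a free choice of slots: exchanging \<open>k\<close> and \<open>l\<close>
  exchanges vectors and covectors, so that both signs of \<open>t\<close> share one
  argument.\<close>

definition harm :: "slot \<Rightarrow> slot \<Rightarrow> nat \<Rightarrow> nat \<Rightarrow> mpoly set"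
  where "harm k l a b = {p \<in> hmg (dg k l a b). contr k l p = 0}"

lemma Delta_eq: "Delta = contr E1 X1" and alpha_eq: "alpha = contr E1 X2" and beta_eq: "beta = contr X1 E2"
  by (simp_all add: fun_eq_iff Delta_def alpha_def beta_def contr_def)

lemma dg_commute: "k \<noteq> l \<Longrightarrow> dg k l a b = dg l k b a"
  by (auto simp: dg_def)

lemma V_eq: "V a b = harm E1 X1 a b"
  by (simp add: V_def harm_def SD_eq Delta_eq)

lemma harm_commute: "k \<noteq> l \<Longrightarrow> harm k l a b = harm l k b a"
  by (simp add: harm_def dg_commute contr_commute)

lemma V_eq': "V a b = harm X1 E1 b a"
  by (simp add: V_eq harm_commute)

lemma subspace_harm: "P.subspace (harm k l a b)"
  using subspace_hmg[of "dg k l a b"]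
  by (auto simp: P.subspace_def harm_def contr_add contr_Cst_mult pscale_def) (simp add: contr_def)

lemma powers_hmg: "k \<noteq> l \<Longrightarrow> L k v ^ a * L l w ^ b \<in> hmg (dg k l a b)"
  using hmg_mult[OF hmg_L_power[of k v a] hmg_L_power[of l w b]]
  by (rule back_subst[of "\<lambda>d. _ \<in> hmg d"]) (auto simp: unit_dg_def dg_def)

lemma powers_harm: "k \<noteq> l \<Longrightarrow> ip v w = 0 \<Longrightarrow> L k v ^ a * L l w ^ b \<in> harm k l a b"
  using contr_powers[of k l 1 v a w b] by (simp add: harm_def powers_hmg Cst_simps)

section \<open>Harmonic polynomials and the cone\<close>

lemma L_diff: "L k (v - w) = L k v - L k w"
  by (simp add: L_def Cst_simps left_diff_distrib sum_subtractf)

lemma ip_diff: "ip (v - w) z = ip v z - ip w z" "ip z (v - w) = ip z v - ip z w"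
  by (simp_all add: ip_def sum_3 algebra_simps)

section \<open>Derivatives along lines in general position\<close>

lemma infinite_affine_nonzero:
  assumes "z \<noteq> (0::complex)"
  shows "infinite {u. z + u * w \<noteq> 0}"
proof -
  have "{u. z + u * w = 0} \<subseteq> {- z / w}"
  proof
    fix u assume "u \<in> {u. z + u * w = 0}"
    then have u: "u * w = - z" by (simp add: eq_neg_iff_add_eq_0 add.commute)
    with assms have "w \<noteq> 0" by auto
    with u show "u \<in> {- z / w}" by (metis insertI1 nonzero_mult_div_cancel_right)
  qed
  then have "finite {u. z + u * w = 0}"
    by (rule finite_subset) simp
  moreover have "UNIV = {u. z + u * w = 0} \<union> {u. z + u * w \<noteq> 0}" by auto
  ultimately show ?thesis
    using infinite_UNIV_char_0[where ?'a = complex] by (metis finite_Un)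
qed

text \<open>Divided differences of a curve in a subspace stay in the subspace: synthetic division at
  a parameter \<open>u0\<close> yields the quotient of \<open>Q(u) - Q(u0)\<close> by
  \<open>u - u0\<close>, which has smaller degree and from which the coefficients of
  \<open>Q\<close> are recovered.\<close>

lemma curve_coeffs_in_subspace:
  assumes "P.subspace S" "infinite U" "\<And>u. u \<in> U \<Longrightarrow> poly Q (Cst u) \<in> S"
  shows "coeff Q i \<in> S"
  using assms(2,3)
proof (induction "degree Q" arbitrary: Q U i)
  case 0
  then obtain c where Q: "Q = [:c:]" by (metis degree_eq_zeroE)
  from "0.prems"(1) obtain u where "u \<in> U" by (metis finite.emptyI ex_in_conv)
  with "0.prems"(2) Q have "c \<in> S" by auto
  then show ?case
    using Q P.subspace_0[OF assms(1)] by (cases i) auto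
next
  case (Suc n)
  from Suc.prems(1) obtain u0 where u0: "u0 \<in> U" by (metis finite.emptyI ex_in_conv)
  define R where "R = synthetic_div Q (Cst u0)"
  have eq: "Q = [:- Cst u0, 1:] * R + [:poly Q (Cst u0):]"
    by (simp only: R_def synthetic_div_correct')
  have "poly R (Cst u) \<in> S" if "u \<in> U - {u0}" for u
  proof -
    have "poly Q (Cst u) = Cst (u - u0) * poly R (Cst u) + poly Q (Cst u0)"
      by (subst eq) (simp add: Cst_simps algebra_simps)
    then have "pscale (u - u0) (poly R (Cst u)) = poly Q (Cst u) - poly Q (Cst u0)"
      by (simp add: pscale_def)
    also have "\<dots> \<in> S"
      using that u0 Suc.prems(2) by (intro P.subspace_diff[OF assms(1)]) auto
    finally have "pscale (inverse (u - u0)) (pscale (u - u0) (poly R (Cst u))) \<in> S"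
      by (rule P.subspace_scale[OF assms(1)])
    then show ?thesis using that by simp
  qed
  moreover have "n = degree R"
    using Suc.hyps(2) by (simp add: R_def degree_synthetic_div)
  moreover have "infinite (U - {u0})" using Suc.prems(1) by simp
  ultimately have R: "coeff R j \<in> S" for j
    using Suc.hyps(1) by blast
  have "coeff Q i = (case i of 0 \<Rightarrow> poly Q (Cst u0) | Suc j \<Rightarrow> coeff R j) - pscale u0 (coeff R i)"
    by (subst eq) (simp add: coeff_pCons pscale_def split: nat.split)
  also have "\<dots> \<in> S"
    using R Suc.prems(2)[OF u0]
    by (intro P.subspace_diff P.subspace_scale assms(1)) (auto split: nat.split)
  finally show ?case .
qed

lemma coeff_linear_power: "coeff ([:x, y:] ^ n) 0 = x ^ n"
  "coeff ([:x, y:] ^ n) 1 = of_nat n * x ^ (n - 1) * (y :: 'a::comm_ring_1)"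
proof -
  show *: "coeff ([:x, y:] ^ n) 0 = x ^ n" for n
    by (induction n) (simp_all add: mult_pCons_left)
  show "coeff ([:x, y:] ^ n) 1 = of_nat n * x ^ (n - 1) * y"
  proof (induction n)
    case (Suc n)
    then show ?case
      by (cases n) (simp_all add: * algebra_simps)
  qed simp
qed

text \<open>The linear coefficient in \<open>u\<close> of the curve
  \<open>L k (v + u *s w) ^ n * R\<close> is \<open>n\<close> times the claimed element;
  \<open>U\<close> may omit the parameter 0.\<close>

lemma power_derivative_in_subspace:
  assumes S: "P.subspace S" and "infinite U" and "\<And>u. u \<in> U \<Longrightarrow> L k (v + u *s w) ^ n * R \<in> S" and "n > 0"
  shows "L k w * L k v ^ (n - 1) * R \<in> S"
proof -
  define Q where "Q = [:R:] * [:L k v, L k w:] ^ n"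
  have "poly Q (Cst u) = L k (v + u *s w) ^ n * R" for u
    by (simp add: Q_def poly_power L_add L_scale mult_ac)
  then have "pscale (inverse (of_nat n)) (coeff Q 1) \<in> S"
    by (intro P.subspace_scale[OF S] curve_coeffs_in_subspace[OF S assms(2)]) (use assms in simp)
  moreover have "coeff Q 1 = pscale (of_nat n) (L k w * L k v ^ (n - 1) * R)"
    unfolding Q_def using coeff_linear_power(2)[of "L k v" "L k w" n]
    by (simp add: pscale_def Cst_of_nat mult_ac)
  ultimately show ?thesis using \<open>n > 0\<close> by simp
qed

text \<open>
  The operators \<open>x\<^sub>i \<partial>/\<partial>e\<^sub>j - x\<^sub>j \<partial>/\<partial>e\<^sub>i\<close> are tangent to the cone \<open>\<Sum> e\<^sub>i x\<^sub>i = 0\<close> and commute with \<open>\<Delta>\<close>, so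
  they map \<open>V(a,b)\<close> to \<open>V(a-1,b+1)\<close>. That the Casimir sum built from them acts on \<open>V(a,b)\<close> by a
  nonzero scalar for \<open>a > 0\<close> drives the inductions on \<open>a\<close> in \<open>harm_span\<close> and \<open>harm_eq_0\<close>. The
  condition \<open>\<langle>v, n\<rangle> \<noteq> 0\<close> there restricts to flags in general position.
\<close>

definition rot :: "slot \<Rightarrow> slot \<Rightarrow> 3 \<Rightarrow> 3 \<Rightarrow> mpoly \<Rightarrow> mpoly"
  where "rot k l i j p = Var (l, i) * pderiv_var (k, j) p - Var (l, j) * pderiv_var (k, i) p"

lemma rot_add: "rot k l i j (p + q) = rot k l i j p + rot k l i j q"
  by (simp add: rot_def algebra_simps)

lemma rot_pscale: "rot k l i j (pscale c p) = pscale c (rot k l i j p)"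
  by (simp add: rot_def pscale_def algebra_simps)

lemma rot_0: "rot k l i j 0 = 0"
  by (simp add: rot_def)

text \<open>Differentiating the multipliers \<open>Var (l, i)\<close> and \<open>Var (l, j)\<close>
  creates two mixed second derivatives, which cancel.\<close>

lemma contr_rot:
  assumes "k \<noteq> l"
  shows "contr k l (rot k l i j p) = rot k l i j (contr k l p)"
proof -
  have c: "pderiv_var (k, r) (pderiv_var (l, r) (pderiv_var (k, j) p))
    = pderiv_var (k, j) (pderiv_var (k, r) (pderiv_var (l, r) p))" for r j
    by (simp only: pderiv_var_commute[of "(l, r)" "(k, j)"] pderiv_var_commute[of "(k, r)" "(k, j)"])
  have eq: "pderiv_var (k, r) (pderiv_var (l, r) (rot k l i j p))
    = (if r = i then pderiv_var (k, i) (pderiv_var (k, j) p) else 0)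
    - (if r = j then pderiv_var (k, j) (pderiv_var (k, i) p) else 0)
    + rot k l i j (pderiv_var (k, r) (pderiv_var (l, r) p))" for r
    using assms by (auto simp add: rot_def c)
  show ?thesis
    unfolding contr_def eq
    by (simp add: sum.distrib sum_subtractf pderiv_var_commute[of "(k, j)" "(k, i)"])
      (simp add: rot_def sum_distrib_left sum_subtractf)
qed

lemma rot_harm:
  assumes "k \<noteq> l" "p \<in> harm k l (Suc a) b"
  shows "rot k l i j p \<in> harm k l a (Suc b)"
proof -
  have p: "p \<in> hmg (dg k l (Suc a) b)" "contr k l p = 0"
    using assms by (auto simp: harm_def)
  have "Var (l, i) * pderiv_var (k, j) p \<in> hmg (dg k l a (Suc b))" for i j
    using hmg_mult[OF hmg_Var[of l i] hmg_pderiv[OF p(1), of k j]] assms(1)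
    by (elim back_subst[of "\<lambda>d. _ \<in> hmg d"]) (auto simp: unit_dg_def dg_def)
  then have "rot k l i j p \<in> hmg (dg k l a (Suc b))"
    unfolding rot_def by (intro P.subspace_diff subspace_hmg)
  then show ?thesis
    using p assms(1) by (simp add: harm_def contr_rot rot_0)
qed

text \<open>Expanding gives four times the Euler operator of slot \<open>k\<close>, twice a term
  that acts on \<open>p\<close> as \<open>a * b\<close>, and a multiple of the contraction of
  \<open>p\<close>, which is 0. Hence the scalar \<open>4 * a + 2 * a * b\<close>.\<close>

lemma rot_casimir:
  assumes kl: "k \<noteq> l" and p: "p \<in> harm k l a b"
  shows "(\<Sum>i\<in>UNIV. \<Sum>j\<in>UNIV. rot l k j i (rot k l i j p)) = pscale (of_nat (2 * a * (b + 2))) p"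
proof -
  have hp: "p \<in> hmg (dg k l a b)" "contr k l p = 0"
    using p by (auto simp: harm_def)
  define A where "A i j = pderiv_var (l, i) (pderiv_var (k, j) p)" for i j
  have e1: "(\<Sum>i\<in>UNIV. Var (k, i) * pderiv_var (k, i) p) = of_nat a * p"
    using euler[OF hp(1), of k] by (simp add: dg_def)
  have e2: "(\<Sum>i\<in>UNIV. Var (l, i) * A i j) = of_nat b * pderiv_var (k, j) p" for j
    using euler[OF hmg_pderiv[OF hp(1), of k j], of l] kl by (simp add: dg_def A_def)
  have tr: "(\<Sum>i\<in>UNIV. A i i) = 0"
    using hp(2) by (simp add: A_def contr_def pderiv_var_commute[of "(k, _)"])
  have "(\<Sum>i\<in>UNIV. \<Sum>j\<in>UNIV. rot l k j i (rot k l i j p))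
      = 4 * (\<Sum>i\<in>UNIV. Var (k, i) * pderiv_var (k, i) p)
      + 2 * (\<Sum>j\<in>UNIV. Var (k, j) * (\<Sum>i\<in>UNIV. Var (l, i) * A i j))
      - 2 * (\<Sum>i\<in>UNIV. Var (k, i) * Var (l, i)) * (\<Sum>i\<in>UNIV. A i i)"
    unfolding rot_def A_def sum_3 using kl by (simp add: algebra_simps)
  also have "\<dots> = 4 * (of_nat a * p) + 2 * (of_nat b * (of_nat a * p))"
  proof -
    have "(\<Sum>j\<in>UNIV. Var (k, j) * (of_nat b * pderiv_var (k, j) p)) = of_nat b * (of_nat a * p)"
      by (subst e1[symmetric]) (simp add: sum_distrib_left mult_ac)
    then show ?thesis by (simp only: e1 e2 tr mult_zero_right diff_zero)
  qed
  also have "\<dots> = of_nat (2 * a * (b + 2)) * p"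
    by (simp add: algebra_simps)
  finally show ?thesis
    by (simp only: pscale_def Cst_of_nat)
qed

text \<open>The direction \<open>w $ i *s axis j 1 - w $ j *s axis i 1\<close> pairs to 0 with
  \<open>w\<close>. On a flag the result is therefore, up to a factor, a derivative of
  \<open>L k v ^ Suc a * L l w ^ (b - 1)\<close> along flags.\<close>

lemma rot_powers:
  assumes "k \<noteq> l"
  shows "rot l k j i (L k v ^ a * L l w ^ b)
    = pscale (of_nat b) (L k (w $ i *s axis j 1 - w $ j *s axis i 1) * L k v ^ a * L l w ^ (b - 1))"
proof -
  have "L k (w $ i *s axis j 1 - w $ j *s axis i 1) = Cst (w $ i) * Var (k, j) - Cst (w $ j) * Var (k, i)"
    by (simp add: L_diff L_scale L_axis)
  note * = this
  show ?thesis
    unfolding * using assms by (simp add: rot_def pderiv_L_power pscale_def Cst_of_nat algebra_simps)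
qed

section \<open>Products of powers on flags span the harmonic polynomials\<close>

lemma ex_crs_nonzero:
  assumes "n \<noteq> 0"
  shows "\<exists>w. crs w n \<noteq> 0"
proof -
  have "n $ 1 \<noteq> 0 \<or> n $ 2 \<noteq> 0 \<or> n $ 3 \<noteq> 0"
    using assms by (auto simp: vec_eq_iff forall_3)
  then have "crs (axis 1 1) n \<noteq> 0 \<or> crs (axis 2 1) n \<noteq> 0"
    by (auto simp: vec_eq_iff forall_3 crs_def axis_def)
  then show ?thesis by blast
qed

text \<open>A variable times a \<open>b\<close>-th power is, up to a scalar, the derivative of a
  power of degree \<open>Suc b\<close> along a coordinate axis, and Euler's relation rebuilds a
  polynomial from its partials. The condition \<open>crs w n \<noteq> 0\<close> keeps
  \<open>w\<close> independent of \<open>n\<close>; along a line it fails for at most one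
  parameter.\<close>

lemma span_powers_single:
  assumes n: "n \<noteq> 0"
  shows "hmg (\<lambda>s. b * unit_dg l s) \<subseteq> P.span {L l w ^ b | w. crs w n \<noteq> 0}"
proof (induction b)
  case 0
  from ex_crs_nonzero[OF n] have one: "1 \<in> P.span {L l w ^ 0 | w. crs w n \<noteq> 0}"
    by (intro P.span_base) auto
  show ?case
  proof
    fix p assume "p \<in> hmg (\<lambda>s. 0 * unit_dg l s)"
    then obtain c where "p = Cst c" using hmg_const by auto
    then have "p = pscale c 1" by (simp add: pscale_def)
    then show "p \<in> P.span {L l w ^ 0 | w. crs w n \<noteq> 0}"
      using P.span_scale[OF one] by simp
  qed
next
  case (Suc b)
  let ?S = "P.span {L l w ^ Suc b | w. crs w n \<noteq> 0}"
  have step: "Var (l, i) * q \<in> ?S" if "q \<in> P.span {L l w ^ b | w. crs w n \<noteq> 0}" for q i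
    using that
  proof (induction rule: P.span_induct_alt)
    case base
    then show ?case by (simp add: P.span_zero)
  next
    case (step c x y)
    then obtain w where x: "x = L l w ^ b" and w: "crs w n \<noteq> 0" by auto
    then obtain r where r: "crs w n $ r \<noteq> 0" by (auto simp: vec_eq_iff)
    have "crs (w + u *s axis i 1) n $ r = crs w n $ r + u * crs (axis i 1) n $ r" for u
      using exhaust_3[of r] by (auto simp: crs_def algebra_simps)
    then have "crs (w + u *s axis i 1) n \<noteq> 0" if "crs w n $ r + u * crs (axis i 1) n $ r \<noteq> 0" for u
      using that by (metis zero_index)
    then have "L l (axis i 1) * L l w ^ (Suc b - 1) * 1 \<in> ?S"
      by (intro power_derivative_in_subspace[OF P.subspace_span infinite_affine_nonzero[OF r]])
        (auto intro!: P.span_base)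
    then have "Var (l, i) * x \<in> ?S" by (simp add: L_axis x)
    then have "pscale c (Var (l, i) * x) + Var (l, i) * y \<in> ?S"
      using step by (intro P.span_add P.span_scale)
    moreover have "Var (l, i) * (pscale c x + y) = pscale c (Var (l, i) * x) + Var (l, i) * y"
      by (simp add: pscale_def algebra_simps)
    ultimately show ?case by simp
  qed
  show ?case
  proof
    fix p assume p: "p \<in> hmg (\<lambda>s. Suc b * unit_dg l s)"
    have "pderiv_var (l, i) p \<in> hmg (\<lambda>s. b * unit_dg l s)" for i
      using hmg_pderiv[OF p, of l i]
      by (elim back_subst[of "\<lambda>d. _ \<in> hmg d"]) (auto simp: unit_dg_def)
    then have "(\<Sum>i\<in>UNIV. Var (l, i) * pderiv_var (l, i) p) \<in> ?S"
      using Suc.IH step by (intro P.span_sum) blast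
    then have "pscale (of_nat (Suc b)) p \<in> ?S"
      using euler[OF p, of l] by (simp add: pscale_def unit_dg_def Cst_of_nat del: of_nat_Suc)
    then have "pscale (inverse (of_nat (Suc b))) (pscale (of_nat (Suc b)) p) \<in> ?S"
      by (rule P.span_scale)
    then show "p \<in> ?S" by (simp del: of_nat_Suc)
  qed
qed

lemma ex_perp:
  assumes "crs w n \<noteq> 0"
  shows "\<exists>v. ip v w = 0 \<and> ip v n \<noteq> 0"
proof -
  obtain r where r: "crs w n $ r \<noteq> 0" using assms by (auto simp: vec_eq_iff)
  \<comment> \<open>A cross product with \<open>w\<close> is perpendicular to \<open>w\<close>, and
    pairing this one with \<open>n\<close> is a triple product that picks out coordinate
    \<open>r\<close> of \<open>crs w n\<close>.\<close>
  let ?v = "crs (axis r 1) w"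
  have "ip ?v w = 0"
    by (simp add: ip_def crs_def sum_3 algebra_simps)
  moreover have "ip ?v n = crs w n $ r"
    using exhaust_3[of r] by (auto simp: ip_def crs_def sum_3 axis_def algebra_simps)
  ultimately show ?thesis using r by metis
qed

text \<open>\<open>rot k l\<close> lowers the degree in slot \<open>k\<close>, so the induction
  hypothesis expresses the image by powers on flags. The opposite \<open>rot l k\<close> sends these
  to derivatives along the flags \<open>(v + u *s h, w)\<close>, which lie in the span, and the
  Casimir identity returns a nonzero multiple of the original polynomial.\<close>

lemma harm_span:
  assumes kl: "k \<noteq> l" and n: "n \<noteq> 0"
  shows "harm k l a b \<subseteq> P.span {L k v ^ a * L l w ^ b | v w. ip v w = 0 \<and> ip v n \<noteq> 0}"
proof (induction a arbitrary: b)
  case 0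
  have "harm k l 0 b \<subseteq> hmg (\<lambda>s. b * unit_dg l s)"
    using kl by (auto simp: harm_def elim!: back_subst[of "\<lambda>d. _ \<in> hmg d"]) (auto simp: dg_def unit_dg_def)
  also have "\<dots> \<subseteq> P.span {L l w ^ b | w. crs w n \<noteq> 0}"
    by (rule span_powers_single[OF n])
  also have "\<dots> \<subseteq> P.span {L k v ^ 0 * L l w ^ b | v w. ip v w = 0 \<and> ip v n \<noteq> 0}"
  proof (intro P.span_mono subsetI)
    fix p assume "p \<in> {L l w ^ b | w. crs w n \<noteq> 0}"
    then obtain w where "p = L l w ^ b" "crs w n \<noteq> 0" by blast
    then show "p \<in> {L k v ^ 0 * L l w ^ b | v w. ip v w = 0 \<and> ip v n \<noteq> 0}"
      using ex_perp[of w n] by auto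
  qed
  finally show ?case .
next
  case (Suc a)
  let ?S = "P.span {L k v ^ Suc a * L l w ^ b | v w. ip v w = 0 \<and> ip v n \<noteq> 0}"
  have step: "rot l k j i q \<in> ?S"
    if "q \<in> P.span {L k v ^ a * L l w ^ Suc b | v w. ip v w = 0 \<and> ip v n \<noteq> 0}" for q i j
    using that
  proof (induction rule: P.span_induct_alt)
    case base
    then show ?case by (simp add: rot_0 P.span_zero)
  next
    case (step c x y)
    then obtain v w where x: "x = L k v ^ a * L l w ^ Suc b" and vw: "ip v w = 0" "ip v n \<noteq> 0" by auto
    define h :: "complex^3" where "h = w $ i *s axis j 1 - w $ j *s axis i 1"
    have h: "ip h w = 0"
      by (simp add: h_def ip_diff ip_simps ip_axis)
    have "L k h * L k v ^ (Suc a - 1) * L l w ^ b \<in> ?S"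
      by (intro power_derivative_in_subspace[OF P.subspace_span infinite_affine_nonzero[OF vw(2), of "ip h n"]])
        (auto intro!: P.span_base exI simp: ip_simps vw h)
    then have "rot l k j i x \<in> ?S"
      unfolding x rot_powers[OF kl] h_def[symmetric] by (intro P.span_scale) simp
    then show ?case
      using step by (simp add: rot_add rot_pscale P.span_add P.span_scale)
  qed
  show ?case
  proof
    fix p assume p: "p \<in> harm k l (Suc a) b"
    have "rot l k j i (rot k l i j p) \<in> ?S" for i j
      using rot_harm[OF kl p, of i j] Suc.IH step by blast
    then have "pscale (of_nat (2 * Suc a * (b + 2))) p \<in> ?S"
      unfolding rot_casimir[OF kl p, symmetric] by (intro P.span_sum)
    then have "pscale (inverse (of_nat (2 * Suc a * (b + 2)))) (pscale (of_nat (2 * Suc a * (b + 2))) p) \<in> ?S"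
      by (rule P.span_scale)
    then show "p \<in> ?S" by (simp del: of_nat_Suc of_nat_mult of_nat_add)
  qed
qed

section \<open>A harmonic polynomial is determined by its values on flags\<close>

lemma ev_directional_derivative:
  assumes U: "infinite U" and ev0: "\<And>u. u \<in> U \<Longrightarrow> ev (\<lambda>v. x v + u * dx v) p = 0"
  shows "ev x p = 0" "(\<Sum>v\<in>UNIV. dx v * ev x (pderiv_var v p)) = 0"
proof -
  \<comment> \<open>\<open>Q p\<close> is the restriction of \<open>p\<close> to the line through
    \<open>x\<close> in direction \<open>dx\<close>. Its coefficients 0 and 1 are the value and the
    directional derivative at \<open>x\<close>, and infinitely many zeros force
    \<open>Q p = 0\<close>.\<close>
  define Q where "Q q = psub (\<lambda>c. [:c:]) (\<lambda>v. [:x v, dx v:]) q" for q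
  have ev: "poly (Q q) u = ev (\<lambda>v. x v + u * dx v) q" for q u
    by (induction q rule: mpoly_induct) (simp_all add: Q_def hom_poly.psub_simps mult.commute)
  have c0: "coeff (Q q) 0 = ev x q" for q
    using ev[of q 0] by (simp add: poly_0_coeff_0)
  have c1: "coeff (Q q) 1 = (\<Sum>v\<in>UNIV. dx v * ev x (pderiv_var v q))" for q
  proof (induction q rule: mpoly_induct)
    case (Var v)
    show ?case
      by (simp add: Q_def hom_poly.psub_simps if_distrib[of "ev x"] if_distrib[of "\<lambda>y. _ * y"] cong: if_cong)
  next
    case (mult p q)
    then show ?case
      using c0[of p] c0[of q]
      by (simp add: Q_def hom_poly.psub_simps coeff_mult sum.distrib sum_distrib_left sum_distrib_right algebra_simps)
  qed (simp_all add: Q_def hom_poly.psub_simps sum.distrib algebra_simps)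
  have "Q p = 0"
  proof (rule ccontr)
    assume "Q p \<noteq> 0"
    then have "finite {u. poly (Q p) u = 0}" by (rule poly_roots_finite)
    moreover have "U \<subseteq> {u. poly (Q p) u = 0}" using ev0 ev by auto
    ultimately show False using U finite_subset by blast
  qed
  then show "ev x p = 0" "(\<Sum>v\<in>UNIV. dx v * ev x (pderiv_var v p)) = 0"
    using c0[of p] c1[of p] by simp_all
qed

lemma sum_UNIV_var: "(\<Sum>v\<in>UNIV. g v) = (\<Sum>k\<in>UNIV. \<Sum>i\<in>UNIV. g (k, i))" for g :: "var \<Rightarrow> 'a::comm_monoid_add"
  by (simp add: sum.cartesian_product flip: UNIV_Times_UNIV)

lemma pt_add: "k \<noteq> l \<Longrightarrow> pt k l (v + u *s h) w = (\<lambda>x. pt k l v w x + u * pt k l h 0 x)"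
  "k \<noteq> l \<Longrightarrow> pt k l v (w + u *s h) = (\<lambda>x. pt k l v w x + u * pt k l 0 h x)"
  by (auto simp: pt_def fun_eq_iff)

lemma pt_derivative_1:
  assumes "k \<noteq> l"
  shows "(\<Sum>x\<in>UNIV. pt k l w 0 x * g x) = (\<Sum>i\<in>UNIV. w $ i * g (k, i))"
proof -
  have "(\<Sum>x\<in>UNIV. pt k l w 0 x * g x) = (\<Sum>s\<in>UNIV. if s = k then (\<Sum>i\<in>UNIV. w $ i * g (k, i)) else 0)"
    unfolding sum_UNIV_var
  proof (intro sum.cong refl)
    fix s
    show "(\<Sum>i\<in>UNIV. pt k l w 0 (s, i) * g (s, i)) = (if s = k then \<Sum>i\<in>UNIV. w $ i * g (k, i) else 0)"
      using assms by (cases "s = k"; cases "s = l") (simp_all add: pt_def)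
  qed
  then show ?thesis by simp
qed

lemma pt_derivative_2:
  assumes "k \<noteq> l"
  shows "(\<Sum>x\<in>UNIV. pt k l 0 w x * g x) = (\<Sum>i\<in>UNIV. w $ i * g (l, i))"
proof -
  have "(\<Sum>x\<in>UNIV. pt k l 0 w x * g x) = (\<Sum>s\<in>UNIV. if s = l then (\<Sum>i\<in>UNIV. w $ i * g (l, i)) else 0)"
    unfolding sum_UNIV_var
  proof (intro sum.cong refl)
    fix s
    show "(\<Sum>i\<in>UNIV. pt k l 0 w (s, i) * g (s, i)) = (if s = l then \<Sum>i\<in>UNIV. w $ i * g (l, i) else 0)"
      using assms by (cases "s = k"; cases "s = l") (simp_all add: pt_def)
  qed
  then show ?thesis by simp
qed

lemma eq_0_if_ev_0_single:
  assumes n: "n \<noteq> 0" and kl: "k \<noteq> l"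
    and "p \<in> hmg (\<lambda>s. b * unit_dg l s)" and "\<And>w. crs w n \<noteq> 0 \<Longrightarrow> ev (pt k l 0 w) p = 0"
  shows "p = 0"
  using assms(3,4)
proof (induction b arbitrary: p)
  case 0
  then obtain c where c: "p = Cst c" using hmg_const by auto
  have "c = 0" using "0.prems"(2) c ex_crs_nonzero[OF n] by auto
  then show ?case using c by (simp add: Cst_simps)
next
  case (Suc b)
  have "pderiv_var (l, i) p = 0" for i
  proof (rule Suc.IH)
    show "pderiv_var (l, i) p \<in> hmg (\<lambda>s. b * unit_dg l s)"
      using hmg_pderiv[OF Suc.prems(1), of l i]
      by (elim back_subst[of "\<lambda>d. _ \<in> hmg d"]) (auto simp: unit_dg_def)
  next
    fix w assume w: "crs w n \<noteq> 0"
    then obtain r where r: "crs w n $ r \<noteq> 0" by (auto simp: vec_eq_iff)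
    have "crs (w + u *s axis i 1) n $ r = crs w n $ r + u * crs (axis i 1) n $ r" for u
      using exhaust_3[of r] by (auto simp: crs_def algebra_simps)
    then have "crs (w + u *s axis i 1) n \<noteq> 0" if "crs w n $ r + u * crs (axis i 1) n $ r \<noteq> 0" for u
      using that by (metis zero_index)
    then have "(\<Sum>x\<in>UNIV. pt k l 0 (axis i 1) x * ev (pt k l 0 w) (pderiv_var x p)) = 0"
      using Suc.prems(2)
      by (intro ev_directional_derivative(2)[OF infinite_affine_nonzero[OF r, of "crs (axis i 1) n $ r"]])
        (auto simp flip: pt_add(2)[OF kl])
    then show "ev (pt k l 0 w) (pderiv_var (l, i) p) = 0"
      by (simp add: pt_derivative_2[OF kl] axis_def if_distrib[of "\<lambda>y. y * _"] cong: if_cong)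
  qed
  then have "of_nat (Suc b) * p = 0"
    using euler[OF Suc.prems(1), of l] by (simp add: unit_dg_def)
  then have "pscale (of_nat (Suc b)) p = 0" by (simp only: pscale_def Cst_of_nat)
  then show ?case by (simp del: of_nat_Suc)
qed

text \<open>Dual to the spanning argument: at a flag \<open>(v, w)\<close> the value of
  \<open>rot k l i j p\<close> is the derivative of \<open>p\<close> in the direction
  \<open>h\<close>, which is tangent to the flags, so it is 0 as well. By induction every
  \<open>rot k l i j p\<close> vanishes, and the Casimir identity gives
  \<open>p = 0\<close>.\<close>

lemma harm_eq_0:
  assumes kl: "k \<noteq> l" and n: "n \<noteq> 0"
    and "p \<in> harm k l a b" and "\<And>v w. ip v w = 0 \<Longrightarrow> ip v n \<noteq> 0 \<Longrightarrow> ev (pt k l v w) p = 0"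
  shows "p = 0"
  using assms(3,4)
proof (induction a arbitrary: b p)
  case 0
  have hom: "p \<in> hmg (\<lambda>s. b * unit_dg l s)"
    using kl 0(1) by (auto simp: harm_def elim!: back_subst[of "\<lambda>d. _ \<in> hmg d"]) (auto simp: dg_def unit_dg_def)
  \<comment> \<open>Without variables of slot \<open>k\<close> the value does not depend on
    \<open>v\<close>, so any \<open>v\<close> completing \<open>w\<close> to a flag in general
    position may be used.\<close>
  have indep: "ev (pt k l v w) q = ev (pt k l 0 w) q" if "\<forall>m\<in>Poly_Mapping.keys q. slot_degree k m = 0" for v w q
  proof -
    have "(\<Prod>x\<in>UNIV. pt k l v w x ^ Poly_Mapping.lookup m x) = (\<Prod>x\<in>UNIV. pt k l 0 w x ^ Poly_Mapping.lookup m x)"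
      if "slot_degree k m = 0" for m
      using that by (intro prod.cong refl) (auto simp: pt_def slot_degree_def)
    then show ?thesis
      using that by (auto simp: ev_def psub_def hom_id.mono_prod intro!: sum.cong)
  qed
  have "\<forall>m\<in>Poly_Mapping.keys p. slot_degree k m = 0"
    using 0(1) by (auto simp: harm_def hmg_def dg_def)
  then show ?case
    using eq_0_if_ev_0_single[OF n kl hom] "0.prems"(2) indep ex_perp by metis
next
  case (Suc a)
  have "rot k l i j p = 0" for i j
  proof (rule Suc.IH)
    show "rot k l i j p \<in> harm k l a (Suc b)" by (rule rot_harm[OF kl Suc.prems(1)])
  next
    fix v w assume vw: "ip v w = 0" "ip v n \<noteq> 0"
    define h :: "complex^3" where "h = w $ i *s axis j 1 - w $ j *s axis i 1"
    have h: "ip h w = 0"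
      by (simp add: h_def ip_diff ip_simps ip_axis)
    have "(\<Sum>x\<in>UNIV. pt k l h 0 x * ev (pt k l v w) (pderiv_var x p)) = 0"
      using Suc.prems(2)
      by (intro ev_directional_derivative(2)[OF infinite_affine_nonzero[OF vw(2), of "ip h n"]])
        (auto simp: ip_simps vw h simp flip: pt_add(1)[OF kl])
    then have "w $ i * ev (pt k l v w) (pderiv_var (k, j) p) - w $ j * ev (pt k l v w) (pderiv_var (k, i) p) = 0"
      by (simp add: pt_derivative_1[OF kl] h_def axis_def left_diff_distrib sum_subtractf
          if_distrib[of "\<lambda>y. y * _"] if_distrib[of "\<lambda>y. _ * y"] cong: if_cong)
    then show "ev (pt k l v w) (rot k l i j p) = 0"
      using kl by (simp add: rot_def) (simp add: pt_def)
  qed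
  then have "pscale (of_nat (2 * Suc a * (b + 2))) p = 0"
    using rot_casimir[OF kl Suc.prems(1)] by (simp add: rot_0)
  then show ?case by (simp del: of_nat_Suc of_nat_mult of_nat_add)
qed

section \<open>The group action\<close>

definition isE :: "slot \<Rightarrow> bool"
  where "isE k \<longleftrightarrow> k = E1 \<or> k = E2"

text \<open>The inverse transpose, that is, the action on covectors in dual coordinates.\<close>

definition dual :: "complex^3^3 \<Rightarrow> complex^3^3"
  where "dual g = transpose (matrix_inv g)"

definition slot_mat :: "complex^3^3 \<Rightarrow> slot \<Rightarrow> complex^3^3"
  where "slot_mat g k = (if isE k then g else dual g)"

lemma SL3_inverse:
  assumes "g \<in> SL3"
  shows "g ** matrix_inv g = mat 1" "matrix_inv g ** g = mat 1"
proof -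
  have "invertible g" using assms by (simp add: SL3_def invertible_det_nz)
  then have "\<exists>h. g ** h = mat 1 \<and> h ** g = mat 1" by (simp add: invertible_def)
  then have "g ** matrix_inv g = mat 1 \<and> matrix_inv g ** g = mat 1"
    unfolding matrix_inv_def by (rule someI_ex)
  then show "g ** matrix_inv g = mat 1" "matrix_inv g ** g = mat 1" by auto
qed

lemma matrix_inv_eqI:
  assumes "g ** h = mat 1" "h ** g = (mat 1 :: complex^3^3)"
  shows "matrix_inv g = h"
proof -
  have "g ** matrix_inv g = mat 1 \<and> matrix_inv g ** g = mat 1"
    unfolding matrix_inv_def by (rule someI[where x = h]) (use assms in auto)
  then have "matrix_inv g = matrix_inv g ** (g ** h)"
    using assms by simp
  also have "\<dots> = h"
    using \<open>g ** matrix_inv g = mat 1 \<and> _\<close> by (simp add: matrix_mul_assoc)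
  finally show ?thesis .
qed

lemma dual_eqs:
  assumes "g \<in> SL3"
  shows "transpose g ** dual g = mat 1" "dual g ** transpose g = mat 1"
    "transpose (dual g) ** g = mat 1" "g ** transpose (dual g) = mat 1"
  using SL3_inverse[OF assms]
  by (simp_all add: dual_def flip: matrix_transpose_mul)

lemma dual_SL3:
  assumes "g \<in> SL3"
  shows "dual g \<in> SL3" "dual (dual g) = g"
proof -
  have "det g * det (dual g) = 1"
    using arg_cong[OF dual_eqs(1)[OF assms], of det] by (simp add: det_mul det_transpose)
  then show "dual g \<in> SL3" using assms by (simp add: SL3_def)
  have "matrix_inv (dual g) = transpose g"
    using dual_eqs[OF assms] by (intro matrix_inv_eqI)
  then show "dual (dual g) = g"
    by (simp add: dual_def[of "dual g"])
qed

lemma ip_matrix: "ip (g *v v) w = ip v (transpose g *v w)"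
  by (simp add: ip_def matrix_vector_mult_def transpose_def sum_3 algebra_simps)

lemma ip_dual:
  assumes "g \<in> SL3"
  shows "ip (g *v v) (dual g *v w) = ip v w" "ip (dual g *v w) (g *v v) = ip w v"
  using dual_eqs[OF assms]
  by (simp_all add: ip_matrix matrix_vector_mul_assoc)

lemma act_Var: "act g (Var (k, i)) = L k (column i (slot_mat g k))"
  by (auto simp: act_def L_def slot_mat_def isE_def pscale_def column_def dual_def transpose_def)

lemma act_simps [simp]:
  "act g (p + q) = act g p + act g q" "act g 0 = 0" "act g (p * q) = act g p * act g q"
  "act g (Cst c) = Cst c" "act g 1 = 1" "act g (- p) = - act g p" "act g (p - q) = act g p - act g q"
  "act g (p ^ n) = act g p ^ n" "act g (\<Sum>i\<in>A. f i) = (\<Sum>i\<in>A. act g (f i))"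
  "act g (pscale c p) = pscale c (act g p)"
  by (simp_all add: act_def pscale_def)

lemma L_matrix: "L k ((A :: complex^3^3) *v v) = (\<Sum>i\<in>UNIV. Cst (v $ i) * L k (column i A))"
  by (simp add: L_def matrix_vector_mult_def column_def sum_3 Cst_simps algebra_simps)

lemma act_L: "act g (L k v) = L k (slot_mat g k *v v)"
  by (simp add: L_matrix) (simp add: L_def act_Var)

lemma hmg_act: "p \<in> hmg \<delta> \<Longrightarrow> act g p \<in> hmg \<delta>"
  unfolding act_def by (rule hmg_subst) (auto simp: hmg_sum hmg_pscale hmg_Var)

lemma pderiv_act: "pderiv_var (k, i) (act g p) = (\<Sum>j\<in>UNIV. Cst (slot_mat g k $ i $ j) * act g (pderiv_var (k, j) p))"
proof (induction p rule: mpoly_induct)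
  case (Var v)
  obtain s j where v: "v = (s, j)" by force
  show ?case
    by (auto simp: v act_Var pderiv_L column_def if_distrib[of "act g"] if_distrib[of "\<lambda>y. _ * y"] cong: if_cong)
next
  case (mult p q)
  then show ?case by (simp add: sum.distrib sum_distrib_left sum_distrib_right algebra_simps)
qed (simp_all add: sum.distrib algebra_simps)

lemma contr_act:
  assumes g: "g \<in> SL3" and kl: "isE k \<noteq> isE l"
  shows "contr k l (act g p) = act g (contr k l p)"
proof -
  have "transpose (slot_mat g k) ** slot_mat g l = mat 1"
    using kl dual_eqs[OF g] by (auto simp: slot_mat_def)
  then have ortho: "(\<Sum>i\<in>UNIV. slot_mat g k $ i $ j * slot_mat g l $ i $ j') = (if j = j' then 1 else 0)" for j j'
    by (simp add: vec_eq_iff matrix_matrix_mult_def transpose_def mat_def)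
  define A where "A j j' = act g (pderiv_var (k, j) (pderiv_var (l, j') p))" for j j'
  have "contr k l (act g p)
    = (\<Sum>i\<in>UNIV. \<Sum>j'\<in>UNIV. Cst (slot_mat g l $ i $ j') * (\<Sum>j\<in>UNIV. Cst (slot_mat g k $ i $ j) * A j j'))"
    by (simp add: contr_def pderiv_act A_def)
  also have "\<dots> = (\<Sum>j\<in>UNIV. \<Sum>j'\<in>UNIV. Cst (\<Sum>i\<in>UNIV. slot_mat g k $ i $ j * slot_mat g l $ i $ j') * A j j')"
    by (simp add: sum_3 Cst_simps algebra_simps)
  also have "\<dots> = (\<Sum>j\<in>UNIV. \<Sum>j'\<in>UNIV. if j = j' then A j j' else 0)"
    unfolding ortho by (intro sum.cong refl) (simp add: Cst_simps)
  also have "\<dots> = act g (contr k l p)"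
    by (simp add: contr_def A_def)
  finally show ?thesis .
qed

lemma ev_cong:
  assumes "\<And>m x. m \<in> Poly_Mapping.keys p \<Longrightarrow> x \<in> Poly_Mapping.keys m \<Longrightarrow> \<sigma> x = \<tau> x"
  shows "ev \<sigma> p = ev \<tau> p"
  unfolding ev_def psub_def by (intro sum.cong refl arg_cong2[where f = "(*)"] prod.cong) (simp_all add: assms)

text \<open>The variables of slot \<open>k\<close> are coordinate functions on the dual space, so
  the point in slot \<open>k\<close> moves by the matrix of slot \<open>l\<close>, and
  conversely.\<close>

lemma ev_act:
  assumes "isE k \<noteq> isE l" "g \<in> SL3" "p \<in> hmg (dg k l a b)"
  shows "ev (pt k l (slot_mat g l *v v) (slot_mat g k *v w)) (act g p) = ev (pt k l v w) p"
proof -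
  have kl: "k \<noteq> l" using assms by auto
  have slots: "Poly_Mapping.lookup m (s, i) = 0" if "m \<in> Poly_Mapping.keys p" "s \<noteq> k" "s \<noteq> l" for m s i
  proof -
    have "slot_degree s m = 0" using that assms(3) by (auto simp: hmg_def dg_def)
    then show ?thesis by (simp add: slot_degree_def)
  qed
  have ip1: "ip (slot_mat g k *v z) (slot_mat g l *v v) = ip z v"
    "ip (slot_mat g l *v z) (slot_mat g k *v v) = ip z v" for z v
    using assms(1) ip_dual[OF assms(2)] by (auto simp: slot_mat_def)
  have "ev (pt k l (slot_mat g l *v v) (slot_mat g k *v w)) (act g p)
    = ev (\<lambda>x. ev (pt k l (slot_mat g l *v v) (slot_mat g k *v w)) (act g (Var x))) p"
    by (simp add: act_def ev_subst)
  also have "\<dots> = ev (pt k l v w) p"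
  proof (rule ev_cong)
    fix m x assume m: "m \<in> Poly_Mapping.keys p" and x: "x \<in> Poly_Mapping.keys m"
    obtain s i where si: "x = (s, i)" by force
    have "s = k \<or> s = l" using slots[OF m, of s i] x si by (auto simp: in_keys_iff)
    moreover have "act g (Var (s, i)) = L s (slot_mat g s *v axis i 1)"
      using act_L[of g s "axis i 1"] by (simp add: L_axis)
    ultimately show "ev (pt k l (slot_mat g l *v v) (slot_mat g k *v w)) (act g (Var x)) = pt k l v w x"
      using kl by (auto simp: si ev_L_pt ip1 ip_axis) (simp_all add: pt_def)
  qed
  finally show ?thesis .
qed

text \<open>The cofactor identity: the transpose of \<open>g\<close> takes
  \<open>crs (g *v v) (g *v w)\<close> to \<open>det g *s crs v w\<close>. For determinant one,
  \<open>dual g\<close> inverts this.\<close>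

lemma crs_dual:
  assumes "g \<in> SL3"
  shows "dual g *v crs v w = crs (g *v v) (g *v w)"
proof -
  have "transpose g *v crs (g *v v) (g *v w) = det g *s crs v w"
    by (simp add: vec_eq_iff forall_3 transpose_def matrix_vector_mult_def crs_def sum_3 det_3 algebra_simps)
  then have "dual g *v (transpose g *v crs (g *v v) (g *v w)) = dual g *v crs v w"
    using assms by (simp add: SL3_def del: transpose_matrix_vector)
  then show ?thesis
    by (metis dual_eqs(2)[OF assms] matrix_vector_mul_assoc matrix_vector_mul_lid)
qed

section \<open>The projection\<close>

text \<open>The invariant that corresponds to the identity endomorphism; as a function it is the
  pairing, so its zeros are the flags.\<close>

definition qq :: mpoly
  where "qq = (\<Sum>i\<in>UNIV. Var (E1, i) * Var (X1, i))"

lemma act_qq: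
  assumes "g \<in> SL3"
  shows "act g qq = qq"
proof -
  have "g ** transpose (dual g) = mat 1" using dual_eqs[OF assms] by simp
  then have ortho: "(\<Sum>i\<in>UNIV. g $ j $ i * dual g $ j' $ i) = (if j = j' then 1 else 0)" for j j'
    by (simp add: vec_eq_iff matrix_matrix_mult_def transpose_def mat_def)
  have "act g qq = (\<Sum>j\<in>UNIV. \<Sum>j'\<in>UNIV. Cst (\<Sum>i\<in>UNIV. g $ j $ i * dual g $ j' $ i) * (Var (E1, j) * Var (X1, j')))"
    by (simp add: qq_def act_Var slot_mat_def isE_def L_def column_def)
      (simp add: sum_3 Cst_simps algebra_simps)
  also have "\<dots> = (\<Sum>j\<in>UNIV. \<Sum>j'\<in>UNIV. if j = j' then Var (E1, j) * Var (X1, j') else 0)"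
    unfolding ortho by (intro sum.cong refl) (simp add: Cst_simps)
  also have "\<dots> = qq" by (simp add: qq_def)
  finally show ?thesis .
qed

lemma ev_qq: "ev (pt E1 X1 v w) qq = ip v w"
  by (simp add: qq_def ip_def) (simp add: pt_def)

lemma hmg_qq_mult: "p \<in> hmg (dg E1 X1 a b) \<Longrightarrow> qq * p \<in> hmg (dg E1 X1 (Suc a) (Suc b))"
proof -
  assume p: "p \<in> hmg (dg E1 X1 a b)"
  have "Var (E1, i) * Var (X1, i) * p \<in> hmg (dg E1 X1 (Suc a) (Suc b))" for i
    using hmg_mult[OF hmg_mult[OF hmg_Var[of E1 i] hmg_Var[of X1 i]] p]
    by (elim back_subst[of "\<lambda>d. _ \<in> hmg d"]) (auto simp: unit_dg_def dg_def)
  then show ?thesis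
    by (simp add: qq_def sum_distrib_right hmg_sum)
qed

lemma hmg_qq_power_mult: "p \<in> hmg (dg E1 X1 a b) \<Longrightarrow> qq ^ n * p \<in> hmg (dg E1 X1 (a + n) (b + n))"
  by (induction n) (use hmg_qq_mult in \<open>auto simp: mult.assoc\<close>)

lemma hmg_Delta:
  assumes "p \<in> hmg (dg E1 X1 a b)"
  shows "Delta p \<in> hmg (dg E1 X1 (a - 1) (b - 1))"
  unfolding Delta_def
proof (rule hmg_sum)
  fix i :: 3
  show "pderiv_var (E1, i) (pderiv_var (X1, i) p) \<in> hmg (dg E1 X1 (a - 1) (b - 1))"
    using hmg_pderiv[OF hmg_pderiv[OF assms, of X1 i], of E1 i]
    by (elim back_subst[of "\<lambda>d. _ \<in> hmg d"]) (auto simp: dg_def)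
qed

lemma Delta_0:
  assumes "p \<in> hmg (dg E1 X1 a b)" "a = 0 \<or> b = 0"
  shows "Delta p = 0"
proof -
  have "pderiv_var (E1, i) (pderiv_var (X1, i) p) = 0" for i
    using assms(2) hmg_pderiv_0[OF assms(1), of E1 i] hmg_pderiv_0[OF assms(1), of X1 i]
      pderiv_var_commute[of "(E1, i)" "(X1, i)" p]
    by (auto simp: dg_def)
  then show ?thesis by (simp add: Delta_def)
qed

lemma Delta_simps: "Delta (p + q) = Delta p + Delta q" "Delta (Cst c * p) = Cst c * Delta p"
  "Delta 0 = 0" "Delta (\<Sum>i\<in>A. f i) = (\<Sum>i\<in>A. Delta (f i))"
proof -
  show *: "Delta (p + q) = Delta p + Delta q" "Delta (Cst c * p) = Cst c * Delta p" "Delta 0 = 0" for p q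
    by (simp_all add: Delta_eq contr_add contr_Cst_mult) (simp add: contr_def)
  show "Delta (\<Sum>i\<in>A. f i) = (\<Sum>i\<in>A. Delta (f i))"
    by (induction A rule: infinite_finite_induct) (simp_all add: * )
qed

lemma hmg_Delta_pow: "p \<in> hmg (dg E1 X1 a b) \<Longrightarrow> (Delta ^^ n) p \<in> hmg (dg E1 X1 (a - n) (b - n))"
proof (induction n)
  case (Suc n)
  then have "Delta ((Delta ^^ n) p) \<in> hmg (dg E1 X1 (a - n - 1) (b - n - 1))"
    by (intro hmg_Delta) auto
  then show ?case by simp
qed simp

lemma Delta_pow_simps: "(Delta ^^ n) (p + q) = (Delta ^^ n) p + (Delta ^^ n) q"
  "(Delta ^^ n) (Cst c * p) = Cst c * (Delta ^^ n) p" "(Delta ^^ n) 0 = 0"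
  by (induction n) (simp_all add: Delta_simps)

text \<open>The commutator of an \<open>sl2\<close> pair: the two Euler operators contribute
  \<open>a + b\<close>, the three coordinates contribute 3.\<close>

lemma Delta_qq:
  assumes "p \<in> hmg (dg E1 X1 a b)"
  shows "Delta (qq * p) = qq * Delta p + of_nat (a + b + 3) * p"
proof -
  have "Delta (qq * p) = qq * Delta p + (\<Sum>i\<in>UNIV. Var (E1, i) * pderiv_var (E1, i) p)
      + (\<Sum>i\<in>UNIV. Var (X1, i) * pderiv_var (X1, i) p) + 3 * p"
    by (simp add: Delta_def qq_def sum_3 algebra_simps)
  then show ?thesis
    using euler[OF assms, of E1] euler[OF assms, of X1] by (simp add: dg_def algebra_simps)
qed

lemma Delta_qq_power:
  assumes "p \<in> hmg (dg E1 X1 a b)"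
  shows "Delta (qq ^ n * p) = qq ^ n * Delta p + of_nat (n * (a + b + n + 2)) * (qq ^ (n - 1) * p)"
proof (induction n)
  case (Suc n)
  have "Delta (qq ^ Suc n * p) = qq * Delta (qq ^ n * p) + of_nat (a + n + (b + n) + 3) * (qq ^ n * p)"
    using Delta_qq[OF hmg_qq_power_mult[OF assms, of n]] by (simp add: mult.assoc)
  also have "\<dots> = qq ^ Suc n * Delta p + of_nat (Suc n * (a + b + Suc n + 2)) * (qq ^ n * p)"
    unfolding Suc.IH by (cases n) (simp_all add: algebra_simps)
  finally show ?case by simp
qed simp

text \<open>
  The coefficients make \<open>\<Delta>\<close> of \<open>\<Sum>\<^sub>n c\<^sub>n q\<^sup>n \<Delta>\<^sup>n p\<close> telescope by \<open>Delta_qq_power\<close>; \<open>d\<close> is the total degree of \<open>p\<close>.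
\<close>

fun pr_coeff :: "nat \<Rightarrow> nat \<Rightarrow> complex"
  where "pr_coeff d 0 = 1"
  | "pr_coeff d (Suc n) = - pr_coeff d n / of_nat (Suc n * (d + 1 - n))"

definition pr :: "nat \<Rightarrow> nat \<Rightarrow> mpoly \<Rightarrow> mpoly"
  where "pr e f p = (\<Sum>n\<le>min e f. Cst (pr_coeff (e + f) n) * (qq ^ n * (Delta ^^ n) p))"

lemma pr_add: "pr e f (p + q) = pr e f p + pr e f q"
  and pr_pscale: "pr e f (pscale c p) = pscale c (pr e f p)"
proof -
  show "pr e f (p + q) = pr e f p + pr e f q"
    by (simp add: pr_def Delta_pow_simps sum.distrib distrib_left)
  show "pr e f (pscale c p) = pscale c (pr e f p)"
    unfolding pr_def pscale_def Delta_pow_simps sum_distrib_left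
    by (intro sum.cong refl) (simp only: mult_ac)
qed

lemma pr_act: "g \<in> SL3 \<Longrightarrow> pr e f (act g p) = act g (pr e f p)"
proof -
  assume g: "g \<in> SL3"
  have "Delta (act g p) = act g (Delta p)" for p
    using contr_act[OF g, of E1 X1] by (simp add: Delta_eq isE_def)
  then have "(Delta ^^ n) (act g p) = act g ((Delta ^^ n) p)" for n
    by (induction n) simp_all
  then show ?thesis
    by (simp add: pr_def act_qq[OF g])
qed

text \<open>Only the summand with \<open>n = 0\<close> lacks a factor \<open>qq\<close>. The clause
  for \<open>e = 0 \<or> f = 0\<close> is stated because \<open>e - 1\<close> and
  \<open>f - 1\<close> are truncated, so that the degree of \<open>qq * r\<close> would otherwise
  come out wrong.\<close>

lemma pr_eq_add_multiple:
  assumes p: "p \<in> hmg (dg E1 X1 e f)"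
  obtains r where "pr e f p = p + qq * r" "r \<in> hmg (dg E1 X1 (e - 1) (f - 1))" "e = 0 \<or> f = 0 \<Longrightarrow> r = 0"
proof -
  define r where "r = (\<Sum>n<min e f. Cst (pr_coeff (e + f) (Suc n)) * (qq ^ n * (Delta ^^ Suc n) p))"
  define t where "t n = Cst (pr_coeff (e + f) n) * (qq ^ n * (Delta ^^ n) p)" for n
  have "pr e f p = (\<Sum>n<Suc (min e f). t n)"
    by (simp only: pr_def t_def lessThan_Suc_atMost)
  also have "\<dots> = t 0 + (\<Sum>n<min e f. t (Suc n))"
    by (rule sum.lessThan_Suc_shift)
  also have "(\<Sum>n<min e f. t (Suc n)) = qq * r"
    unfolding r_def t_def sum_distrib_left
    by (intro sum.cong refl) (simp only: power_Suc mult_ac)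
  also have "t 0 = p" by (simp add: t_def Cst_simps)
  finally have "pr e f p = p + qq * r" .
  moreover have "r \<in> hmg (dg E1 X1 (e - 1) (f - 1))"
    unfolding r_def
  proof (intro hmg_sum hmg_Cst_mult)
    fix n assume "n \<in> {..<min e f}"
    then have "e - Suc n + n = e - 1" "f - Suc n + n = f - 1" by auto
    then show "qq ^ n * (Delta ^^ Suc n) p \<in> hmg (dg E1 X1 (e - 1) (f - 1))"
      using hmg_qq_power_mult[OF hmg_Delta_pow[OF p, of "Suc n"], of n] by metis
  qed
  moreover have "r = 0" if "e = 0 \<or> f = 0" using that by (auto simp: r_def)
  ultimately show ?thesis using that by blast
qed

lemma pr_harm:
  assumes p: "p \<in> hmg (dg E1 X1 e f)"
  shows "pr e f p \<in> V e f"
proof -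
  obtain r where r: "pr e f p = p + qq * r" "r \<in> hmg (dg E1 X1 (e - 1) (f - 1))" "e = 0 \<or> f = 0 \<Longrightarrow> r = 0"
    using pr_eq_add_multiple[OF p] by blast
  have "qq * r \<in> hmg (dg E1 X1 e f)"
  proof (cases "e = 0 \<or> f = 0")
    case True
    then show ?thesis using r(3) P.subspace_0[OF subspace_hmg] by simp
  next
    case False
    then show ?thesis using hmg_qq_mult[OF r(2)] by simp
  qed
  then have hom: "pr e f p \<in> hmg (dg E1 X1 e f)"
    using r(1) p P.subspace_add[OF subspace_hmg] by metis
  define m where "m = min e f"
  let ?c = "\<lambda>n. Cst (pr_coeff (e + f) n)"
  let ?t = "\<lambda>n. qq ^ n * (Delta ^^ Suc n) p"
  \<comment> \<open>The smaller of the two degrees is used up after \<open>m\<close>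
    applications.\<close>
  have top: "(Delta ^^ Suc m) p = 0"
    using Delta_0[OF hmg_Delta_pow[OF p, of m]] by (auto simp: m_def min_def)
  have "Delta (?c n * (qq ^ n * (Delta ^^ n) p)) = ?c n * ?t n - (if n = 0 then 0 else ?c (n - 1) * ?t (n - 1))"
    if "n \<le> m" for n
  proof (cases n)
    case (Suc j)
    \<comment> \<open>\<open>(Delta ^^ n) p\<close> has degrees \<open>e - n\<close> and
      \<open>f - n\<close>; with \<open>n = Suc j\<close> the factor from
      \<open>Delta_qq_power\<close> becomes the denominator in \<open>pr_coeff\<close>.\<close>
    have deg: "e - n + (f - n) + n + 2 = e + f + 1 - j" using that Suc by (auto simp: m_def)
    have "Delta (?c n * (qq ^ n * (Delta ^^ n) p))
      = ?c n * (?t n + of_nat (n * (e + f + 1 - j)) * (qq ^ (n - 1) * (Delta ^^ n) p))"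
      using Delta_qq_power[OF hmg_Delta_pow[OF p, of n], of n] unfolding deg
      by (simp add: Delta_simps)
    also have "\<dots> = ?c n * ?t n + Cst (pr_coeff (e + f) n * of_nat (n * (e + f + 1 - j))) * (qq ^ (n - 1) * (Delta ^^ n) p)"
      by (simp only: Cst_simps Cst_of_nat distrib_left mult.assoc)
    also have "pr_coeff (e + f) n * of_nat (n * (e + f + 1 - j)) = - pr_coeff (e + f) j"
    proof -
      have "n * (e + f + 1 - j) \<noteq> 0" using that Suc by (auto simp: m_def)
      then have "(of_nat (n * (e + f + 1 - j)) :: complex) \<noteq> 0" by (simp only: of_nat_eq_0_iff not_False_eq_True)
      then show ?thesis unfolding Suc pr_coeff.simps by (simp only: times_divide_eq_left nonzero_mult_div_cancel_right not_False_eq_True)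
    qed
    finally show ?thesis by (simp add: Suc Cst_simps)
  qed (simp add: Delta_simps)
  then have "Delta (pr e f p) = (\<Sum>n\<le>m. ?c n * ?t n - (if n = 0 then 0 else ?c (n - 1) * ?t (n - 1)))"
    unfolding pr_def Delta_simps m_def by (intro sum.cong refl) auto
  also have "\<dots> = ?c m * ?t m"
    by (induction m) simp_all
  also have "\<dots> = 0" using top by simp
  finally show ?thesis
    using hom by (simp add: V_def SD_eq)
qed

lemma pr_ident: "p \<in> V e f \<Longrightarrow> pr e f p = p"
proof -
  assume "p \<in> V e f"
  then have D: "Delta p = 0" by (simp add: V_def)
  have z: "(Delta ^^ n) p = 0" if "n > 0" for n
    using that D by (cases n) (simp_all add: funpow_Suc_right Delta_pow_simps del: funpow.simps)
  have "pr e f p = (\<Sum>n\<le>min e f. if n = 0 then p else 0)"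
    unfolding pr_def by (intro sum.cong refl) (use z in \<open>auto simp: Cst_simps\<close>)
  then show ?thesis by simp
qed

section \<open>Generators of the tensor product\<close>

definition gen :: "slot \<Rightarrow> slot \<Rightarrow> slot \<Rightarrow> slot \<Rightarrow> nat \<Rightarrow> nat \<Rightarrow> nat \<Rightarrow> nat
    \<Rightarrow> complex^3 \<Rightarrow> complex^3 \<Rightarrow> complex^3 \<Rightarrow> complex^3 \<Rightarrow> mpoly"
  where "gen k1 l1 k2 l2 a b c d v1 w1 v2 w2 = L k1 v1 ^ a * L l1 w1 ^ b * (L k2 v2 ^ c * L l2 w2 ^ d)"

text \<open>The two labellings of the slots, interchanged by duality.\<close>

definition adm :: "slot \<Rightarrow> slot \<Rightarrow> slot \<Rightarrow> slot \<Rightarrow> bool"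
  where "adm k1 l1 k2 l2 \<longleftrightarrow> (k1, l1, k2, l2) \<in> {(E1, X1, E2, X2), (X1, E1, X2, E2)}"

lemma admD:
  assumes "adm k1 l1 k2 l2"
  shows "k1 \<noteq> l1" "isE k1 \<noteq> isE l1" "isE k2 = isE k1" "isE l2 = isE l1" "k1 = E1 \<or> k1 = X1" "l1 = E1 \<or> l1 = X1"
    "k2 \<noteq> l2" "k1 \<noteq> k2" "k1 \<noteq> l2" "l1 \<noteq> k2" "l1 \<noteq> l2"
  using assms by (auto simp: adm_def isE_def)

lemma second_copy_simps: "second_copy (p * q) = second_copy p * second_copy q"
  "second_copy (p + q) = second_copy p + second_copy q" "second_copy 0 = 0"
  "second_copy (pscale c p) = pscale c (second_copy p)" "second_copy (p ^ n) = second_copy p ^ n"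
  "second_copy (Cst c) = Cst c"
  by (simp_all add: second_copy_def rename_def pscale_def)

lemma second_copy_Var: "adm k1 l1 k2 l2 \<Longrightarrow> second_copy (Var (k1, i)) = Var (k2, i)"
  "adm k1 l1 k2 l2 \<Longrightarrow> second_copy (Var (l1, i)) = Var (l2, i)"
  by (auto simp: second_copy_def rename_def adm_def)

lemma second_copy_L: "adm k1 l1 k2 l2 \<Longrightarrow> second_copy (L k1 v) = L k2 v"
  "adm k1 l1 k2 l2 \<Longrightarrow> second_copy (L l1 v) = L l2 v"
  by (auto simp: L_def sum_3 second_copy_simps second_copy_Var)

lemma gen_in_tensor:
  assumes "adm k1 l1 k2 l2" "ip v1 w1 = 0" "ip v2 w2 = 0"
  shows "gen k1 l1 k2 l2 a b c d v1 w1 v2 w2 \<in> tensor (harm k1 l1 a b) (harm k1 l1 c d)"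
proof -
  have "gen k1 l1 k2 l2 a b c d v1 w1 v2 w2
    = (L k1 v1 ^ a * L l1 w1 ^ b) * second_copy (L k1 v2 ^ c * L l1 w2 ^ d)"
    by (simp add: gen_def second_copy_simps second_copy_L[OF assms(1)])
  then show ?thesis
    using powers_harm admD(1)[OF assms(1)] assms(2,3) unfolding tensor_def by (intro P.span_base) blast
qed

lemma tensor_mult_in: "p \<in> M \<Longrightarrow> q \<in> N \<Longrightarrow> p * second_copy q \<in> tensor M N"
  unfolding tensor_def by (intro P.span_base) auto

lemma subspace_tensor: "P.subspace (tensor M N)"
  by (simp add: tensor_def)

text \<open>Taking \<open>v2\<close> generic with respect to \<open>crs z v1\<close> makes
  \<open>v1\<close> and \<open>v2\<close> independent, because \<open>ip v2 (crs z v1)\<close>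
  equals \<open>ip z (crs v1 v2)\<close>. For the first factor the test covector
  \<open>axis 1 1\<close> serves to force \<open>v1 \<noteq> 0\<close>.\<close>

lemma tensor_span:
  assumes adm: "adm k1 l1 k2 l2"
  shows "tensor (harm k1 l1 a b) (harm k1 l1 c d)
    \<subseteq> P.span {gen k1 l1 k2 l2 a b c d v1 w1 v2 w2 | v1 w1 v2 w2. ip v1 w1 = 0 \<and> ip v2 w2 = 0 \<and> crs v1 v2 \<noteq> 0}"
    (is "_ \<subseteq> ?S")
proof -
  have kl: "k1 \<noteq> l1" using admD[OF adm] by simp
  have "p * second_copy q \<in> ?S" if p: "p \<in> harm k1 l1 a b" and q: "q \<in> harm k1 l1 c d" for p q
  proof -
    have "axis 1 1 \<noteq> (0 :: complex^3)" by (simp add: vec_eq_iff axis_def)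
    from harm_span[OF kl this] p
    have "p \<in> P.span {L k1 v ^ a * L l1 w ^ b | v w. ip v w = 0 \<and> ip v (axis 1 1) \<noteq> 0}" by blast
    then show ?thesis
    proof (induction rule: P.span_induct_alt)
      case base
      then show ?case by (simp add: P.span_zero)
    next
      case (step u x y)
      then obtain v1 w1 where x: "x = L k1 v1 ^ a * L l1 w1 ^ b" and v1: "ip v1 w1 = 0" "ip v1 (axis 1 1) \<noteq> 0"
        by auto
      then have "v1 \<noteq> 0" by (auto simp: ip_simps)
      then obtain z where z: "crs z v1 \<noteq> 0" using ex_crs_nonzero by blast
      have triple: "ip v2 (crs z v1) = ip z (crs v1 v2)" for v2
        by (simp add: ip_def crs_def sum_3 algebra_simps)
      have "q \<in> P.span {L k1 v ^ c * L l1 w ^ d | v w. ip v w = 0 \<and> ip v (crs z v1) \<noteq> 0}"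
        using harm_span[OF kl z] q by blast
      then have "x * second_copy q \<in> ?S"
      proof (induction rule: P.span_induct_alt)
        case base
        then show ?case by (simp add: P.span_zero second_copy_simps)
      next
        case (step u' x' y')
        then obtain v2 w2 where x': "x' = L k1 v2 ^ c * L l1 w2 ^ d" and v2: "ip v2 w2 = 0" "ip v2 (crs z v1) \<noteq> 0"
          by auto
        then have "crs v1 v2 \<noteq> 0" by (auto simp: triple ip_simps)
        moreover have "x * second_copy x' = gen k1 l1 k2 l2 a b c d v1 w1 v2 w2"
          by (simp add: x x' gen_def second_copy_simps second_copy_L[OF adm])
        ultimately have "x * second_copy x' \<in> ?S"
          using v1 v2 by (intro P.span_base) blast
        moreover have "x * second_copy (pscale u' x' + y') = pscale u' (x * second_copy x') + x * second_copy y'"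
          by (simp add: second_copy_simps pscale_def algebra_simps)
        ultimately show ?case using step by (simp add: P.span_add P.span_scale)
      qed
      moreover have "(pscale u x + y) * second_copy q = pscale u (x * second_copy q) + y * second_copy q"
        by (simp add: pscale_def algebra_simps)
      ultimately show ?case using step by (simp add: P.span_add P.span_scale)
    qed
  qed
  then have "{p * second_copy q | p q. p \<in> harm k1 l1 a b \<and> q \<in> harm k1 l1 c d} \<subseteq> ?S" by blast
  then show ?thesis
    unfolding tensor_def by (rule P.span_minimal) simp
qed

lemma act_gen:
  assumes "adm k1 l1 k2 l2"
  shows "act g (gen k1 l1 k2 l2 a b c d v1 w1 v2 w2)
    = gen k1 l1 k2 l2 a b c d (slot_mat g k1 *v v1) (slot_mat g l1 *v w1) (slot_mat g k1 *v v2) (slot_mat g l1 *v w2)"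
  using admD[OF assms] by (simp add: gen_def act_L slot_mat_def)

lemma ip_slot_mat:
  assumes "g \<in> SL3" "isE k \<noteq> isE l"
  shows "ip (slot_mat g k *v v) (slot_mat g l *v w) = ip v w"
  using assms ip_dual[OF assms(1)] by (auto simp: slot_mat_def)

lemma act_tensor:
  assumes adm: "adm k1 l1 k2 l2" and g: "g \<in> SL3" and p: "p \<in> tensor (harm k1 l1 a b) (harm k1 l1 c d)"
  shows "act g p \<in> tensor (harm k1 l1 a b) (harm k1 l1 c d)"
  using subsetD[OF tensor_span[OF adm] p]
proof (induction rule: P.span_induct_alt)
  case base
  show ?case by (simp add: P.subspace_0[OF subspace_tensor])
next
  case (step u x y)
  have "act g x \<in> tensor (harm k1 l1 a b) (harm k1 l1 c d)"
    using step(1) gen_in_tensor[OF adm] ip_slot_mat[OF g admD(2)[OF adm]] by (auto simp: act_gen[OF adm])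
  then show ?case
    using step by (simp add: P.subspace_add P.subspace_scale subspace_tensor)
qed

section \<open>Equivariant maps\<close>

lemma Hom_GD:
  assumes "\<phi> \<in> Hom_G M N"
  shows "p \<in> M \<Longrightarrow> \<phi> p \<in> N" "p \<in> M \<Longrightarrow> q \<in> M \<Longrightarrow> \<phi> (p + q) = \<phi> p + \<phi> q"
    "p \<in> M \<Longrightarrow> \<phi> (pscale c p) = pscale c (\<phi> p)" "g \<in> SL3 \<Longrightarrow> p \<in> M \<Longrightarrow> \<phi> (act g p) = act g (\<phi> p)"
    "p \<notin> M \<Longrightarrow> \<phi> p = 0"
  using assms by (auto simp: Hom_G_def)

lemma Hom_G_0:
  assumes "\<phi> \<in> Hom_G M N" "P.subspace M"
  shows "\<phi> 0 = 0"
  using Hom_GD(3)[OF assms(1) P.subspace_0[OF assms(2)], of 0] by simp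

lemma Hom_G_sum:
  assumes "\<phi> \<in> Hom_G M N" "P.subspace M" "\<And>i. i \<in> A \<Longrightarrow> x i \<in> M"
  shows "\<phi> (\<Sum>i\<in>A. pscale (c i) (x i)) = (\<Sum>i\<in>A. pscale (c i) (\<phi> (x i)))"
  using assms(3)
proof (induction A rule: infinite_finite_induct)
  case (insert i A)
  then have "(\<Sum>i\<in>A. pscale (c i) (x i)) \<in> M" "pscale (c i) (x i) \<in> M"
    using assms(2) by (auto intro!: P.subspace_sum P.subspace_scale)
  then show ?case using insert Hom_GD[OF assms(1)] by simp
qed (simp_all add: Hom_G_0[OF assms(1,2)])

lemma Hom_G_eq_0:
  assumes "\<phi> \<in> Hom_G M N" "P.subspace M" "M \<subseteq> P.span B" "B \<subseteq> M" "\<And>x. x \<in> B \<Longrightarrow> \<phi> x = 0"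
  shows "\<phi> p = 0"
proof (cases "p \<in> M")
  case True
  have "P.subspace {p \<in> M. \<phi> p = 0}"
    using Hom_G_0[OF assms(1,2)] Hom_GD[OF assms(1)] assms(2) by (auto simp: P.subspace_def)
  moreover have "B \<subseteq> {p \<in> M. \<phi> p = 0}" using assms(4,5) by auto
  ultimately have "P.span B \<subseteq> {p \<in> M. \<phi> p = 0}" by (rule P.span_minimal[rotated])
  then show ?thesis using True assms(3) by blast
qed (use Hom_GD(5)[OF assms(1)] in blast)

lemma subspace_Hom_G:
  assumes "P.subspace N"
  shows "F.subspace (Hom_G M N)"
  using assms by (auto simp: F.subspace_def Hom_G_def fscale_def P.subspace_def pscale_def algebra_simps)

section \<open>Invariant functions on triples of flags\<close>

lemma invariant_eq_0:
  fixes F :: "complex^3 \<Rightarrow> complex^3 \<Rightarrow> complex^3 \<Rightarrow> complex^3 \<Rightarrow> complex^3 \<Rightarrow> complex^3 \<Rightarrow> complex"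
  assumes inv: "\<And>g v1 w1 v2 w2 v3 w3. g \<in> SL3 \<Longrightarrow> ip v1 w1 = 0 \<Longrightarrow> ip v2 w2 = 0 \<Longrightarrow> ip v3 w3 = 0 \<Longrightarrow>
      F (g *v v1) (dual g *v w1) (g *v v2) (dual g *v w2) (g *v v3) (dual g *v w3) = F v1 w1 v2 w2 v3 w3"
    and hom: "\<And>u v1 w1 v2 w2 v3 w3. ip v1 w1 = 0 \<Longrightarrow> ip v2 w2 = 0 \<Longrightarrow> F (u *s v1) w1 v2 w2 v3 w3 = u ^ a * F v1 w1 v2 w2 v3 w3"
    and std: "\<And>w1 w2 w3. w1 $ 1 = 0 \<Longrightarrow> w2 $ 2 = 0 \<Longrightarrow> w3 $ 3 = 0 \<Longrightarrow> F (axis 1 1) w1 (axis 2 1) w2 (axis 3 1) w3 = 0"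
    and flags: "ip v1 w1 = 0" "ip v2 w2 = 0" "ip v3 w3 = 0" and det: "ip v3 (crs v1 v2) \<noteq> 0"
  shows "F v1 w1 v2 w2 v3 w3 = 0"
proof -
  define D where "D = ip v3 (crs v1 v2)"
  \<comment> \<open>Dividing \<open>v1\<close> by the determinant gives the matrix with columns
    \<open>u\<close>, \<open>v2\<close>, \<open>v3\<close> determinant one; \<open>hom\<close>
    restores the factor afterwards.\<close>
  define u where "u = inverse D *s v1"
  define g :: "complex^3^3" where "g = (\<chi> i j. (vector [u, v2, v3] :: complex^3^3) $ j $ i)"
  have D: "D \<noteq> 0" and v1: "v1 = D *s u"
    using det by (simp_all add: D_def u_def vec_eq_iff)
  have "det g = ip v3 (crs u v2)"
    by (simp add: g_def det_3 ip_def crs_def sum_3 algebra_simps)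
  also have "\<dots> = inverse D * ip v3 (crs v1 v2)"
    by (simp add: u_def ip_def crs_def sum_3 algebra_simps)
  finally have g: "g \<in> SL3" using D by (simp add: SL3_def D_def)
  have cols: "g *v axis 1 1 = u" "g *v axis 2 1 = v2" "g *v axis 3 1 = v3"
    by (simp_all add: g_def vec_eq_iff matrix_vector_mult_def axis_def forall_3 sum_3)
  have dual_transpose: "dual g *v (transpose g *v w) = w" for w
    by (metis dual_eqs(2)[OF g] matrix_vector_mul_assoc matrix_vector_mul_lid)
  have comp: "(transpose g *v w) $ i = ip (g *v axis i 1) w" for w i
    by (simp add: ip_matrix ip_axis del: transpose_matrix_vector)
  have u0: "ip u w1 = 0" using flags(1) by (simp add: u_def ip_simps)
  have "F u w1 v2 w2 v3 w3 = F (axis 1 1) (transpose g *v w1) (axis 2 1) (transpose g *v w2) (axis 3 1) (transpose g *v w3)"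
    using inv[OF g, of "axis 1 1" "transpose g *v w1" "axis 2 1" "transpose g *v w2" "axis 3 1" "transpose g *v w3"]
      u0 flags by (simp add: cols dual_transpose ip_axis comp del: transpose_matrix_vector)
  also have "\<dots> = 0"
    using u0 flags by (intro std) (simp_all add: cols comp del: transpose_matrix_vector)
  finally show ?thesis
    using hom[OF u0 flags(2), of D v3 w3] v1 by simp
qed

lemma pt_commute: "k \<noteq> l \<Longrightarrow> pt k l v w = pt l k w v"
  by (auto simp: pt_def fun_eq_iff)

text \<open>On a generator with \<open>crs v1 v2 \<noteq> 0\<close>, \<open>harm_eq_0\<close> allows
  testing \<open>\<psi> x\<close> only at third flags with
  \<open>ip v3 (crs v1 v2) \<noteq> 0\<close>, and these triples are the ones that can be moved to
  the standard basis.\<close>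

lemma Hom_G_eq_0_if_standard:
  assumes adm: "adm k1 l1 k2 l2"
    and \<psi>: "\<psi> \<in> Hom_G (tensor (harm k1 l1 a b) (harm k1 l1 c d)) (harm k1 l1 e f)"
    and std: "\<And>w1 w2 w3. w1 $ 1 = 0 \<Longrightarrow> w2 $ 2 = 0 \<Longrightarrow> w3 $ 3 = 0 \<Longrightarrow>
      ev (pt k1 l1 w3 (axis 3 1)) (\<psi> (gen k1 l1 k2 l2 a b c d (axis 1 1) w1 (axis 2 1) w2)) = 0"
  shows "\<psi> p = 0"
proof (rule Hom_G_eq_0[OF \<psi> subspace_tensor tensor_span[OF adm]])
  note kl = admD[OF adm]
  show "{gen k1 l1 k2 l2 a b c d v1 w1 v2 w2 |v1 w1 v2 w2. ip v1 w1 = 0 \<and> ip v2 w2 = 0 \<and> crs v1 v2 \<noteq> 0}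
    \<subseteq> tensor (harm k1 l1 a b) (harm k1 l1 c d)"
    using gen_in_tensor[OF adm] by auto
  define F where "F v1 w1 v2 w2 v3 w3 = ev (pt k1 l1 w3 v3) (\<psi> (gen k1 l1 k2 l2 a b c d v1 w1 v2 w2))"
    for v1 w1 v2 w2 v3 w3
  have inv: "F (g *v v1) (dual g *v w1) (g *v v2) (dual g *v w2) (g *v v3) (dual g *v w3) = F v1 w1 v2 w2 v3 w3"
    if g: "g \<in> SL3" and flags: "ip v1 w1 = 0" "ip v2 w2 = 0" for g v1 w1 v2 w2 v3 w3
  proof -
    \<comment> \<open>In the dual labelling slot \<open>k1\<close> transforms by the inverse
      transpose, so \<open>dual g\<close> is the group element that acts there as
      \<open>g\<close>.\<close>
    define h where "h = (if isE k1 then g else dual g)"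
    have h: "h \<in> SL3" "slot_mat h k1 = g" "slot_mat h l1 = dual g"
      using g kl dual_SL3[OF g] by (auto simp: h_def slot_mat_def)
    let ?G = "gen k1 l1 k2 l2 a b c d"
    have T: "?G v1 w1 v2 w2 \<in> tensor (harm k1 l1 a b) (harm k1 l1 c d)"
      by (rule gen_in_tensor[OF adm flags])
    have "?G (g *v v1) (dual g *v w1) (g *v v2) (dual g *v w2) = act h (?G v1 w1 v2 w2)"
      by (simp add: act_gen[OF adm] h)
    then have "F (g *v v1) (dual g *v w1) (g *v v2) (dual g *v w2) (g *v v3) (dual g *v w3)
      = ev (pt k1 l1 (slot_mat h l1 *v w3) (slot_mat h k1 *v v3)) (act h (\<psi> (?G v1 w1 v2 w2)))"
      using Hom_GD(4)[OF \<psi> h(1) T] by (simp add: F_def h)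
    also have "\<dots> = F v1 w1 v2 w2 v3 w3"
      unfolding F_def using Hom_GD(1)[OF \<psi> T] by (intro ev_act[OF kl(2) h(1), where a = e and b = f]) (simp add: harm_def)
    finally show ?thesis .
  qed
  have hom: "F (u *s v1) w1 v2 w2 v3 w3 = u ^ a * F v1 w1 v2 w2 v3 w3"
    if "ip v1 w1 = 0" "ip v2 w2 = 0" for u v1 w1 v2 w2 v3 w3
  proof -
    have "gen k1 l1 k2 l2 a b c d (u *s v1) w1 v2 w2 = pscale (u ^ a) (gen k1 l1 k2 l2 a b c d v1 w1 v2 w2)"
      by (simp add: gen_def L_scale power_mult_distrib pscale_def Cst_power mult_ac)
    then show ?thesis
      by (simp add: F_def Hom_GD(3)[OF \<psi> gen_in_tensor[OF adm that]])
  qed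
  fix x assume "x \<in> {gen k1 l1 k2 l2 a b c d v1 w1 v2 w2 |v1 w1 v2 w2. ip v1 w1 = 0 \<and> ip v2 w2 = 0 \<and> crs v1 v2 \<noteq> 0}"
  then obtain v1 w1 v2 w2 where x: "x = gen k1 l1 k2 l2 a b c d v1 w1 v2 w2"
    and flags: "ip v1 w1 = 0" "ip v2 w2 = 0" and n: "crs v1 v2 \<noteq> 0" by auto
  have "\<psi> x \<in> harm k1 l1 e f"
    unfolding x by (rule Hom_GD(1)[OF \<psi> gen_in_tensor[OF adm flags]])
  then have harm: "\<psi> x \<in> harm l1 k1 f e"
    using harm_commute[OF kl(1)] by auto
  show "\<psi> x = 0"
  proof (rule harm_eq_0[OF _ n harm])
    show "l1 \<noteq> k1" using kl by auto
  next
    fix v3 w3 assume v3: "ip v3 w3 = 0" "ip v3 (crs v1 v2) \<noteq> 0"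
    have "F v1 w1 v2 w2 v3 w3 = 0"
    proof (rule invariant_eq_0[of F a, OF _ _ _ flags v3])
      show "F (axis 1 1) w1 (axis 2 1) w2 (axis 3 1) w3 = 0"
        if "w1 $ 1 = 0" "w2 $ 2 = 0" "w3 $ 3 = 0" for w1 w2 w3
        unfolding F_def by (rule std[OF that])
    qed (rule inv hom; assumption)+
    then show "ev (pt l1 k1 v3 w3) (\<psi> x) = 0"
      using pt_commute[OF kl(1)] by (simp add: F_def x)
  qed
qed

section \<open>Torus weights\<close>

lemma prod_Var_power: "(\<Prod>v\<in>UNIV. Var v ^ Poly_Mapping.lookup m v) = Poly_Mapping.single m 1"
proof -
  have "(\<Prod>v\<in>A. Var v ^ Poly_Mapping.lookup m v)
      = Poly_Mapping.single (\<Sum>v\<in>A. Poly_Mapping.single v (Poly_Mapping.lookup m v)) 1" if "finite A" for A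
    using that by induction (simp_all add: Var_power mult_single)
  moreover have "(\<Sum>v\<in>UNIV. Poly_Mapping.single v (Poly_Mapping.lookup m v)) = m"
    by (rule poly_mapping_eqI) (simp add: lookup_sum lookup_single when_def)
  ultimately show ?thesis by simp
qed

lemma lookup_pscale: "Poly_Mapping.lookup (pscale c p) m = c * Poly_Mapping.lookup p m"
  by (induction p rule: single_induct)
    (simp_all add: pscale_def Cst_def mult_single lookup_single when_def lookup_add distrib_left)

lemma lookup_diagonal:
  "Poly_Mapping.lookup (subst (\<lambda>v. Cst (\<tau> v) * Var v) p) m
    = (\<Prod>v\<in>UNIV. \<tau> v ^ Poly_Mapping.lookup m v) * Poly_Mapping.lookup p m"
proof (induction p rule: single_induct)
  case (single m' c)
  have "subst (\<lambda>v. Cst (\<tau> v) * Var v) (Poly_Mapping.single m' c)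
      = pscale c ((\<Prod>v\<in>UNIV. Cst (\<tau> v ^ Poly_Mapping.lookup m' v)) * (\<Prod>v\<in>UNIV. Var v ^ Poly_Mapping.lookup m' v))"
    unfolding subst_eq_psub hom_Cst.psub_single pscale_def
    by (simp add: power_mult_distrib prod.distrib Cst_power)
  also have "(\<Prod>v\<in>UNIV. Cst (\<tau> v ^ Poly_Mapping.lookup m' v)) = Cst (\<Prod>v\<in>UNIV. \<tau> v ^ Poly_Mapping.lookup m' v)"
  proof -
    have "(\<Prod>v\<in>A. Cst (h v)) = Cst (\<Prod>v\<in>A. h v)" if "finite A" for A :: "var set" and h
      using that by induction (simp_all add: Cst_simps)
    then show ?thesis by simp
  qed
  finally show ?case
    by (simp add: prod_Var_power lookup_pscale lookup_single when_def flip: pscale_def)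
qed (simp_all add: lookup_add distrib_left)

text \<open>Torus elements whose entries are powers of 2 suffice, since distinct integer weights
  give distinct powers.\<close>

definition pw :: "int \<Rightarrow> complex"
  where "pw n = 2 powi n"

lemma pw_simps: "pw (m + n) = pw m * pw n" "pw m ^ j = pw (m * int j)" "pw 0 = 1" "pw m \<noteq> 0"
  by (simp_all add: pw_def power_int_add power_int_mult)

lemma pw_prod: "finite A \<Longrightarrow> (\<Prod>v\<in>A. pw (h v)) = pw (\<Sum>v\<in>A. h v)"
  by (induction A rule: finite_induct) (simp_all add: pw_simps)

lemma pw_inject: "pw m = pw n \<Longrightarrow> m = n"
proof -
  assume "pw m = pw n"
  then have "norm (pw m) = norm (pw n)" by simp
  then have "(2::real) powi m = 2 powi n" by (simp add: pw_def norm_power_int)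
  then show "m = n"
    by (metis linorder_neq_iff power_int_strict_increasing one_less_numeral_iff semiring_norm(76) order_less_irrefl)
qed

definition diag_wt :: "slot \<Rightarrow> slot \<Rightarrow> (3 \<Rightarrow> int) \<Rightarrow> var \<Rightarrow> int"
  where "diag_wt k1 k2 z = (\<lambda>(k, i). if k = k1 \<or> k = k2 then z i else - z i)"

lemma torus:
  assumes adm: "adm k1 l1 k2 l2" and z: "z 1 + z 2 + z 3 = 0"
  shows "\<exists>g\<in>SL3. \<forall>p. act g p = subst (\<lambda>v. Cst (pw (diag_wt k1 k2 z v)) * Var v) p"
proof -
  define y where "y i = (if isE k1 then z i else - z i)" for i
  define g :: "complex^3^3" where "g = (\<chi> i j. if i = j then pw (y i) else 0)"
  define h :: "complex^3^3" where "h = (\<chi> i j. if i = j then pw (- y i) else 0)"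
  have inv: "pw (y i) * pw (- y i) = 1" for i
    by (simp flip: pw_simps(1) add: pw_simps(3))
  have "det g = pw (y 1 + y 2 + y 3)"
    by (simp add: det_3 g_def pw_simps)
  also have "y 1 + y 2 + y 3 = 0" using z by (simp add: y_def)
  finally have g: "g \<in> SL3" by (simp add: SL3_def pw_simps)
  have "matrix_inv g = h"
    using inv by (intro matrix_inv_eqI)
      (simp_all add: g_def h_def vec_eq_iff matrix_matrix_mult_def mat_def forall_3 sum_3 mult.commute)
  then have dual: "dual g = h"
    by (simp add: dual_def h_def transpose_def vec_eq_iff)
  have "act g p = subst (\<lambda>v. Cst (pw (diag_wt k1 k2 z v)) * Var v) p" for p
  proof (induction p rule: mpoly_induct)
    case (Var v)
    obtain k i where v: "v = (k, i)" by force
    have col: "L k (column i (\<chi> i j. if i = j then pw (x i) else 0)) = Cst (pw (x i)) * Var (k, i)" for x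
      by (simp add: L_def column_def if_distrib[of Cst] if_distrib[of "\<lambda>x. x * _"] Cst_simps cong: if_cong)
    have "diag_wt k1 k2 z (k, i) = (if isE k then y i else - y i)"
      using adm by (cases k) (auto simp: adm_def isE_def diag_wt_def y_def)
    then show ?case
      by (cases "isE k") (simp_all add: v act_Var slot_mat_def dual, simp_all add: g_def h_def col)
  qed simp_all
  then show ?thesis using g by blast
qed

text \<open>By equivariance \<open>\<psi> x\<close> is an eigenvector with the eigenvalue of
  \<open>x\<close>; a diagonal substitution scales each monomial separately, so every monomial of
  \<open>\<psi> x\<close> has weight \<open>W\<close>.\<close>

lemma weight_of_image:
  assumes adm: "adm k1 l1 k2 l2" and z: "z 1 + z 2 + z 3 = 0"
    and \<psi>: "\<psi> \<in> Hom_G M (harm k1 l1 e f)" and x: "x \<in> M"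
    and wt: "subst (\<lambda>v. Cst (pw (diag_wt k1 k2 z v)) * Var v) x = pscale (pw W) x"
    and m: "m \<in> Poly_Mapping.keys (\<psi> x)"
  shows "(\<Sum>i\<in>UNIV. z i * (int (Poly_Mapping.lookup m (k1, i)) - int (Poly_Mapping.lookup m (l1, i)))) = W"
proof -
  obtain g where g: "g \<in> SL3" "\<And>p. act g p = subst (\<lambda>v. Cst (pw (diag_wt k1 k2 z v)) * Var v) p"
    using torus[OF adm z] by blast
  have "pscale (pw W) (\<psi> x) = subst (\<lambda>v. Cst (pw (diag_wt k1 k2 z v)) * Var v) (\<psi> x)"
    using Hom_GD(3)[OF \<psi> x, of "pw W"] Hom_GD(4)[OF \<psi> g(1) x] unfolding g(2) wt by simp
  then have "Poly_Mapping.lookup (pscale (pw W) (\<psi> x)) m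
      = Poly_Mapping.lookup (subst (\<lambda>v. Cst (pw (diag_wt k1 k2 z v)) * Var v) (\<psi> x)) m"
    by (rule arg_cong)
  then have "pw W * Poly_Mapping.lookup (\<psi> x) m
      = (\<Prod>v\<in>UNIV. pw (diag_wt k1 k2 z v) ^ Poly_Mapping.lookup m v) * Poly_Mapping.lookup (\<psi> x) m"
    unfolding lookup_pscale lookup_diagonal .
  then have "pw W = pw (\<Sum>v\<in>UNIV. diag_wt k1 k2 z v * int (Poly_Mapping.lookup m v))"
    using m by (simp add: in_keys_iff pw_simps(2) pw_prod)
  then have "W = (\<Sum>v\<in>UNIV. diag_wt k1 k2 z v * int (Poly_Mapping.lookup m v))"
    by (rule pw_inject)
  also have "\<dots> = (\<Sum>k\<in>UNIV. (if k = k1 then \<Sum>i\<in>UNIV. z i * int (Poly_Mapping.lookup m (k1, i)) else 0)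
      + (if k = l1 then \<Sum>i\<in>UNIV. - z i * int (Poly_Mapping.lookup m (l1, i)) else 0))"
    unfolding sum_UNIV_var
  proof (intro sum.cong refl)
    fix k
    have "slot_degree k m = dg k1 l1 e f k"
      using Hom_GD(1)[OF \<psi> x] m by (auto simp: harm_def hmg_def)
    then have "Poly_Mapping.lookup m (k, i) = 0" if "k \<noteq> k1" "k \<noteq> l1" for i
      using that by (simp add: slot_degree_def dg_def)
    then show "(\<Sum>i\<in>UNIV. diag_wt k1 k2 z (k, i) * int (Poly_Mapping.lookup m (k, i)))
      = (if k = k1 then \<Sum>i\<in>UNIV. z i * int (Poly_Mapping.lookup m (k1, i)) else 0)
      + (if k = l1 then \<Sum>i\<in>UNIV. - z i * int (Poly_Mapping.lookup m (l1, i)) else 0)"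
      using admD[OF adm] by (cases "k = k1"; cases "k = l1") (auto simp: diag_wt_def)
  qed
  also have "\<dots> = (\<Sum>i\<in>UNIV. z i * (int (Poly_Mapping.lookup m (k1, i)) - int (Poly_Mapping.lookup m (l1, i))))"
    by (simp add: sum.distrib right_diff_distrib sum_subtractf sum_negf)
  finally show ?thesis by simp
qed

section \<open>Weight monomials and the expansion at the standard basis\<close>

definition wmono :: "slot \<Rightarrow> slot \<Rightarrow> slot \<Rightarrow> slot \<Rightarrow> nat \<Rightarrow> nat \<Rightarrow> nat \<Rightarrow> nat \<Rightarrow> nat \<Rightarrow> nat \<Rightarrow> mpoly"
  where "wmono k1 l1 k2 l2 a n n' c m m' = Var (k1, 1) ^ a * (Var (l1, 2) ^ n * Var (l1, 3) ^ n')
    * (Var (k2, 2) ^ c * (Var (l2, 1) ^ m * Var (l2, 3) ^ m'))"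

text \<open>In each tensor factor no index is shared between the two slots, so every mixed second
  derivative in the contraction is 0.\<close>

lemma wmono_in_tensor:
  assumes adm: "adm k1 l1 k2 l2"
  shows "wmono k1 l1 k2 l2 a n n' c m m' \<in> tensor (harm k1 l1 a (n + n')) (harm k1 l1 c (m + m'))"
proof -
  note kl = admD[OF adm]
  have "Var (k1, i) ^ a * (Var (l1, j) ^ n * Var (l1, j') ^ n') \<in> harm k1 l1 a (n + n')"
    if "i \<noteq> j" "i \<noteq> j'" for i j j' a n n'
  proof -
    have pow: "Var (s, i) ^ n \<in> hmg (\<lambda>s'. n * unit_dg s s')" for s i n
      by (intro hmg_power hmg_Var)
    have "Var (k1, i) ^ a * (Var (l1, j) ^ n * Var (l1, j') ^ n') \<in> hmg (dg k1 l1 a (n + n'))"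
      using hmg_mult[OF pow[of k1 i a] hmg_mult[OF pow[of l1 j n] pow[of l1 j' n']]] kl(1)
      by (elim back_subst[of "\<lambda>d. _ \<in> hmg d"]) (auto simp: unit_dg_def dg_def)
    moreover have "pderiv_var (k1, r) (pderiv_var (l1, r) (Var (k1, i) ^ a * (Var (l1, j) ^ n * Var (l1, j') ^ n'))) = 0" for r
      using that kl(1) by (cases "r = i") (auto simp: pderiv_var_power)
    ultimately show ?thesis by (simp add: harm_def contr_def)
  qed
  from tensor_mult_in[OF this[of 1 2 3] this[of 2 1 3], of a n n' c m m'] show ?thesis
    by (simp add: wmono_def second_copy_simps second_copy_Var[OF adm])
qed

lemma wmono_weight:
  assumes adm: "adm k1 l1 k2 l2"
  shows "subst (\<lambda>v. Cst (pw (diag_wt k1 k2 z v)) * Var v) (wmono k1 l1 k2 l2 a n n' c m m')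
    = pscale (pw (z 1 * a - z 2 * n - z 3 * n' + z 2 * c - z 1 * m - z 3 * m')) (wmono k1 l1 k2 l2 a n n' c m m')"
proof -
  have wt: "diag_wt k1 k2 z (k1, i) = z i" "diag_wt k1 k2 z (k2, i) = z i"
    "diag_wt k1 k2 z (l1, i) = - z i" "diag_wt k1 k2 z (l2, i) = - z i" for i
    using adm by (auto simp: adm_def diag_wt_def)
  have "z 1 * a - z 2 * n - z 3 * n' + z 2 * c - z 1 * m - z 3 * m'
    = z 1 * a + (- z 2 * n) + (- z 3 * n') + z 2 * c + (- z 1 * m) + (- z 3 * m')" by simp
  then show ?thesis
    by (simp only: wmono_def subst_simps wt power_mult_distrib Cst_power[symmetric] pw_simps(1,2) Cst_simps(4) pscale_def mult_ac)
qed

lemma prod_UNIV_3: "(\<Prod>i\<in>UNIV. h i) = h 1 * h 2 * h (3 :: 3)" for h :: "3 \<Rightarrow> 'a::comm_monoid_mult"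
  unfolding UNIV_3 by (simp add: ac_simps)

text \<open>Evaluating at \<open>w\<^sub>3 = (p, q, 0)\<close> and \<open>v\<^sub>3 = \<epsilon>\<^sub>3\<close> only sees monomials of one weight, hence a single one.\<close>

lemma ev_image_wmono:
  assumes adm: "adm k1 l1 k2 l2"
    and \<psi>: "\<psi> \<in> Hom_G (tensor (harm k1 l1 a (n + n')) (harm k1 l1 c (m + m'))) (harm k1 l1 e f)"
  obtains K where "\<And>w. w $ 3 = 0 \<Longrightarrow> ev (pt k1 l1 w (axis 3 1)) (\<psi> (wmono k1 l1 k2 l2 a n n' c m m'))
      = K * w $ 1 ^ nat (int a + n' + m' - m - f) * w $ 2 ^ nat (int c + n' + m' - n - f)"
    and "K \<noteq> 0 \<Longrightarrow> int a + n' + m' - m - f \<ge> 0" "K \<noteq> 0 \<Longrightarrow> int c + n' + m' - n - f \<ge> 0"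
    and "K \<noteq> 0 \<Longrightarrow> (int a + n' + m' - m - f) + (int c + n' + m' - n - f) = e"
proof -
  let ?w = "wmono k1 l1 k2 l2 a n n' c m m'"
  let ?y = "\<psi> ?w"
  note kl = admD[OF adm]
  have x: "?w \<in> tensor (harm k1 l1 a (n + n')) (harm k1 l1 c (m + m'))"
    by (rule wmono_in_tensor[OF adm])
  have y: "?y \<in> hmg (dg k1 l1 e f)" using Hom_GD(1)[OF \<psi> x] by (simp add: harm_def)
  \<comment> \<open>Evaluating at \<open>w $ 3 = 0\<close> and \<open>axis 3 1\<close> kills every
    monomial that involves one of these three variables.\<close>
  define good where "good \<mu> \<longleftrightarrow> Poly_Mapping.lookup \<mu> (k1, 3) = 0 \<and> Poly_Mapping.lookup \<mu> (l1, 1) = 0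
    \<and> Poly_Mapping.lookup \<mu> (l1, 2) = 0" for \<mu> :: "var \<Rightarrow>\<^sub>0 nat"
  define S where "S = {\<mu> \<in> Poly_Mapping.keys ?y. good \<mu>}"
  define K where "K = (\<Sum>\<mu>\<in>S. Poly_Mapping.lookup ?y \<mu>)"
  have exps: "int (Poly_Mapping.lookup \<mu> (k1, 1)) = int a + n' + m' - m - f \<and>
      int (Poly_Mapping.lookup \<mu> (k1, 2)) = int c + n' + m' - n - f \<and>
      Poly_Mapping.lookup \<mu> (k1, 1) + Poly_Mapping.lookup \<mu> (k1, 2) = e" if "\<mu> \<in> S" for \<mu>
  proof -
    have \<mu>: "\<mu> \<in> Poly_Mapping.keys ?y" "good \<mu>" using that by (auto simp: S_def)
    have deg: "slot_degree k1 \<mu> = e" "slot_degree l1 \<mu> = f"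
      using y \<mu>(1) kl(1) by (auto simp: hmg_def dg_def)
    \<comment> \<open>A basis of the integer weights of trace zero; with the degree \<open>f\<close>
      at \<open>(l1, 3)\<close> the two weight equations fix the remaining exponents.\<close>
    define z1 z2 :: "3 \<Rightarrow> int" where "z1 i = (if i = 1 then 1 else if i = 2 then 0 else -1)"
      and "z2 i = (if i = 1 then 0 else if i = 2 then 1 else -1)" for i
    have z: "z1 1 = 1" "z1 2 = 0" "z1 3 = -1" "z2 1 = 0" "z2 2 = 1" "z2 3 = -1"
      by (simp_all add: z1_def z2_def)
    have "int (Poly_Mapping.lookup \<mu> (k1, 1)) + Poly_Mapping.lookup \<mu> (l1, 3) = int a + n' - m + m'"
      using weight_of_image[OF adm _ \<psi> x wmono_weight[OF adm] \<mu>(1), of z1] \<mu>(2)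
      by (simp add: z sum_3 good_def)
    moreover have "int (Poly_Mapping.lookup \<mu> (k1, 2)) + Poly_Mapping.lookup \<mu> (l1, 3) = int c + n' - n + m'"
      using weight_of_image[OF adm _ \<psi> x wmono_weight[OF adm] \<mu>(1), of z2] \<mu>(2)
      by (simp add: z sum_3 good_def)
    ultimately show ?thesis
      using deg \<mu>(2) by (simp add: slot_degree_def sum_3 good_def)
  qed
  have "ev (pt k1 l1 w (axis 3 1)) ?y
      = K * w $ 1 ^ nat (int a + n' + m' - m - f) * w $ 2 ^ nat (int c + n' + m' - n - f)" if w: "w $ 3 = 0" for w
  proof -
    let ?v = "pt k1 l1 w (axis 3 1)"
    have vals: "?v (k1, i) = w $ i" "?v (l1, i) = (if i = 3 then 1 else 0)" for i
      using kl(1) by (auto simp: pt_def axis_def)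
    have "(\<Prod>v\<in>UNIV. ?v v ^ Poly_Mapping.lookup \<mu> v)
      = (if good \<mu> then w $ 1 ^ Poly_Mapping.lookup \<mu> (k1, 1) * w $ 2 ^ Poly_Mapping.lookup \<mu> (k1, 2) else 0)"
      if \<mu>: "\<mu> \<in> Poly_Mapping.keys ?y" for \<mu>
    proof -
      have "slot_degree s \<mu> = 0" if "s \<noteq> k1" "s \<noteq> l1" for s
        using y \<mu> that by (auto simp: hmg_def dg_def)
      then have zero: "Poly_Mapping.lookup \<mu> (s, i) = 0" if "s \<noteq> k1" "s \<noteq> l1" for s i
        using that by (simp add: slot_degree_def)
      have "(\<Prod>v\<in>UNIV. ?v v ^ Poly_Mapping.lookup \<mu> v) = (\<Prod>s\<in>UNIV. \<Prod>i\<in>UNIV. ?v (s, i) ^ Poly_Mapping.lookup \<mu> (s, i))"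
        by (simp add: prod.cartesian_product flip: UNIV_Times_UNIV)
      also have "\<dots> = (\<Prod>s\<in>{k1, l1}. \<Prod>i\<in>UNIV. ?v (s, i) ^ Poly_Mapping.lookup \<mu> (s, i))"
        by (rule prod.mono_neutral_right) (auto simp: zero)
      also have "\<dots> = (\<Prod>i\<in>UNIV. w $ i ^ Poly_Mapping.lookup \<mu> (k1, i))
          * (\<Prod>i\<in>UNIV. (if i = 3 then 1 else 0) ^ Poly_Mapping.lookup \<mu> (l1, i))"
        using kl(1) by (simp add: vals)
      finally show ?thesis
        unfolding prod_UNIV_3 using w by (simp add: good_def power_0_left)
    qed
    then have "ev ?v ?y = (\<Sum>\<mu>\<in>Poly_Mapping.keys ?y. if good \<mu> then Poly_Mapping.lookup ?y \<mu>
        * (w $ 1 ^ Poly_Mapping.lookup \<mu> (k1, 1) * w $ 2 ^ Poly_Mapping.lookup \<mu> (k1, 2)) else 0)"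
      unfolding ev_def psub_def hom_id.mono_prod by (intro sum.cong refl) simp
    also have "\<dots> = (\<Sum>\<mu>\<in>S. Poly_Mapping.lookup ?y \<mu>
        * (w $ 1 ^ Poly_Mapping.lookup \<mu> (k1, 1) * w $ 2 ^ Poly_Mapping.lookup \<mu> (k1, 2)))"
      unfolding S_def by (simp add: sum.inter_filter)
    also have "\<dots> = (\<Sum>\<mu>\<in>S. Poly_Mapping.lookup ?y \<mu>
        * (w $ 1 ^ nat (int a + n' + m' - m - f) * w $ 2 ^ nat (int c + n' + m' - n - f)))"
    proof (intro sum.cong refl)
      fix \<mu> assume "\<mu> \<in> S"
      from exps[OF this] have "Poly_Mapping.lookup \<mu> (k1, 1) = nat (int a + n' + m' - m - f)"
        "Poly_Mapping.lookup \<mu> (k1, 2) = nat (int c + n' + m' - n - f)" by linarith+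
      then show "Poly_Mapping.lookup ?y \<mu> * (w $ 1 ^ Poly_Mapping.lookup \<mu> (k1, 1) * w $ 2 ^ Poly_Mapping.lookup \<mu> (k1, 2))
        = Poly_Mapping.lookup ?y \<mu> * (w $ 1 ^ nat (int a + n' + m' - m - f) * w $ 2 ^ nat (int c + n' + m' - n - f))"
        by (simp only:)
    qed
    finally show ?thesis by (simp add: K_def sum_distrib_right mult.assoc)
  qed
  moreover have "\<exists>\<mu>. \<mu> \<in> S" if "K \<noteq> 0"
    using that by (auto simp: K_def intro: ccontr)
  ultimately show ?thesis
    using that[of K] exps by (smt (verit) of_nat_0_le_iff of_nat_add)
qed

definition JJ :: "nat \<Rightarrow> nat \<Rightarrow> nat \<Rightarrow> nat \<Rightarrow> int \<Rightarrow> int \<Rightarrow> int set"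
  where "JJ a b c d s t = {j. 0 \<le> j \<and> j \<le> s \<and> j \<le> b \<and> s - j \<le> d \<and> s + t - j \<le> a \<and> j \<le> int c - t}"

text \<open>The monomial in the six pairings \<open>\<langle>v\<^sub>i, \<xi>\<^sub>j\<rangle>\<close>, for \<open>(v\<^sub>1, v\<^sub>2, v\<^sub>3)\<close> the standard basis.\<close>

definition pmono :: "nat \<Rightarrow> nat \<Rightarrow> nat \<Rightarrow> nat \<Rightarrow> int \<Rightarrow> int \<Rightarrow> int \<Rightarrow> complex^3 \<Rightarrow> complex^3 \<Rightarrow> complex^3 \<Rightarrow> complex"
  where "pmono a b c d s t j w1 w2 w3 = w1 $ 2 ^ nat j * w1 $ 3 ^ nat (b - j) * (w2 $ 1 ^ nat (s - j) * w2 $ 3 ^ nat (d - s + j))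
    * (w3 $ 1 ^ nat (a - s + j - t) * w3 $ 2 ^ nat (c - t - j))"

text \<open>The binomial theorem applied to both covector powers leaves monomials indexed by
  \<open>(n, m)\<close>. A nonzero contribution needs exponents at \<open>w3\<close> that add up to
  \<open>e\<close>; by the formulas for \<open>e\<close> and \<open>f\<close> this says
  \<open>n + m = s\<close>, so \<open>n = j\<close> and \<open>m = s - j\<close>.\<close>

lemma standard_expansion:
  assumes adm: "adm k1 l1 k2 l2"
    and \<psi>: "\<psi> \<in> Hom_G (tensor (harm k1 l1 a b) (harm k1 l1 c d)) (harm k1 l1 e f)"
    and e: "int e = int a + c - s - 2 * t" and f: "int f = int b + d - s + t"
  shows "\<exists>C. \<forall>w1 w2 w3. w1 $ 1 = 0 \<longrightarrow> w2 $ 2 = 0 \<longrightarrow> w3 $ 3 = 0 \<longrightarrow>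
      ev (pt k1 l1 w3 (axis 3 1)) (\<psi> (gen k1 l1 k2 l2 a b c d (axis 1 1) w1 (axis 2 1) w2))
      = (\<Sum>j\<in>JJ a b c d s t. C j * pmono a b c d s t j w1 w2 w3)"
proof -
  define w where "w n m = wmono k1 l1 k2 l2 a n (b - n) c m (d - m)" for n m
  have w: "w n m \<in> tensor (harm k1 l1 a b) (harm k1 l1 c d)" if "n \<le> b" "m \<le> d" for n m
    using wmono_in_tensor[OF adm, of a n "b - n" c m "d - m"] that by (simp add: w_def)
  have "\<exists>K. (\<forall>w3. w3 $ 3 = 0 \<longrightarrow> ev (pt k1 l1 w3 (axis 3 1)) (\<psi> (w n m))
      = K * w3 $ 1 ^ nat (int a + (b - n) + (d - m) - m - f) * w3 $ 2 ^ nat (int c + (b - n) + (d - m) - n - f))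
    \<and> (K \<noteq> 0 \<longrightarrow> int a + (b - n) + (d - m) - m - f \<ge> 0 \<and> int c + (b - n) + (d - m) - n - f \<ge> 0
      \<and> (int a + (b - n) + (d - m) - m - f) + (int c + (b - n) + (d - m) - n - f) = e)"
    if nm: "n \<le> b" "m \<le> d" for n m
  proof -
    have "\<psi> \<in> Hom_G (tensor (harm k1 l1 a (n + (b - n))) (harm k1 l1 c (m + (d - m)))) (harm k1 l1 e f)"
      using \<psi> nm by simp
    from ev_image_wmono[OF adm this] obtain K where
      "\<And>w3. w3 $ 3 = 0 \<Longrightarrow> ev (pt k1 l1 w3 (axis 3 1)) (\<psi> (w n m))
      = K * w3 $ 1 ^ nat (int a + (b - n) + (d - m) - m - f) * w3 $ 2 ^ nat (int c + (b - n) + (d - m) - n - f)"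
      "K \<noteq> 0 \<Longrightarrow> int a + (b - n) + (d - m) - m - f \<ge> 0" "K \<noteq> 0 \<Longrightarrow> int c + (b - n) + (d - m) - n - f \<ge> 0"
      "K \<noteq> 0 \<Longrightarrow> (int a + (b - n) + (d - m) - m - f) + (int c + (b - n) + (d - m) - n - f) = e"
      unfolding w_def by blast
    then show ?thesis by (intro exI[of _ K]) blast
  qed
  then obtain K where K: "\<And>n m w3. n \<le> b \<Longrightarrow> m \<le> d \<Longrightarrow> w3 $ 3 = 0 \<Longrightarrow> ev (pt k1 l1 w3 (axis 3 1)) (\<psi> (w n m))
      = K n m * w3 $ 1 ^ nat (int a + (b - n) + (d - m) - m - f) * w3 $ 2 ^ nat (int c + (b - n) + (d - m) - n - f)"
    and K0: "\<And>n m. n \<le> b \<Longrightarrow> m \<le> d \<Longrightarrow> K n m \<noteq> 0 \<Longrightarrow> int a + (b - n) + (d - m) - m - f \<ge> 0 \<and>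
      int c + (b - n) + (d - m) - n - f \<ge> 0 \<and>
      (int a + (b - n) + (d - m) - m - f) + (int c + (b - n) + (d - m) - n - f) = e"
    by metis
  define C where "C j = of_nat (b choose nat j) * of_nat (d choose nat (s - j)) * K (nat j) (nat (s - j))" for j
  have "ev (pt k1 l1 w3 (axis 3 1)) (\<psi> (gen k1 l1 k2 l2 a b c d (axis 1 1) w1 (axis 2 1) w2))
      = (\<Sum>j\<in>JJ a b c d s t. C j * pmono a b c d s t j w1 w2 w3)"
    if std: "w1 $ 1 = 0" "w2 $ 2 = 0" "w3 $ 3 = 0" for w1 w2 w3
  proof -
    let ?ev = "ev (pt k1 l1 w3 (axis 3 1))"
    let ?P = "\<lambda>(n, m). of_nat (b choose n) * of_nat (d choose m) * (w1 $ 2 ^ n * w1 $ 3 ^ (b - n) * (w2 $ 1 ^ m * w2 $ 3 ^ (d - m)))"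
    let ?I = "{..b} \<times> {..d}"
    have b1: "L l1 w1 ^ b = (\<Sum>n\<le>b. of_nat (b choose n) * (Cst (w1 $ 2) * Var (l1, 2)) ^ n * (Cst (w1 $ 3) * Var (l1, 3)) ^ (b - n))"
      using std(1) by (simp add: L_def sum_3 Cst_simps binomial_ring)
    have b2: "L l2 w2 ^ d = (\<Sum>m\<le>d. of_nat (d choose m) * (Cst (w2 $ 1) * Var (l2, 1)) ^ m * (Cst (w2 $ 3) * Var (l2, 3)) ^ (d - m))"
      using std(2) by (simp add: L_def sum_3 Cst_simps binomial_ring)
    have "gen k1 l1 k2 l2 a b c d (axis 1 1) w1 (axis 2 1) w2
      = (\<Sum>n\<le>b. \<Sum>m\<le>d. pscale (?P (n, m)) (w n m))"
    proof -
      have c1: "Var (k1, 1) ^ a * L l1 w1 ^ b = (\<Sum>n\<le>b. Var (k1, 1) ^ a *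
          (of_nat (b choose n) * (Cst (w1 $ 2) * Var (l1, 2)) ^ n * (Cst (w1 $ 3) * Var (l1, 3)) ^ (b - n)))"
        unfolding b1 by (rule sum_distrib_left)
      have c2: "Var (k2, 2) ^ c * L l2 w2 ^ d = (\<Sum>m\<le>d. Var (k2, 2) ^ c *
          (of_nat (d choose m) * (Cst (w2 $ 1) * Var (l2, 1)) ^ m * (Cst (w2 $ 3) * Var (l2, 3)) ^ (d - m)))"
        unfolding b2 by (rule sum_distrib_left)
      show ?thesis
        unfolding gen_def L_axis c1 c2 sum_product
        by (intro sum.cong refl)
          (simp only: w_def wmono_def pscale_def split_conv Cst_simps Cst_power Cst_of_nat power_mult_distrib mult_ac)
    qed
    also have "\<dots> = (\<Sum>nm\<in>?I. pscale (?P nm) (case nm of (n, m) \<Rightarrow> w n m))"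
      unfolding sum.cartesian_product by (intro sum.cong refl) auto
    finally have eq: "gen k1 l1 k2 l2 a b c d (axis 1 1) w1 (axis 2 1) w2
      = (\<Sum>nm\<in>?I. pscale (?P nm) (case nm of (n, m) \<Rightarrow> w n m))" .
    have "\<psi> (gen k1 l1 k2 l2 a b c d (axis 1 1) w1 (axis 2 1) w2)
      = (\<Sum>nm\<in>?I. pscale (?P nm) (\<psi> (case nm of (n, m) \<Rightarrow> w n m)))"
      unfolding eq by (rule Hom_G_sum[OF \<psi> subspace_tensor]) (use w in auto)
    then have "?ev (\<psi> (gen k1 l1 k2 l2 a b c d (axis 1 1) w1 (axis 2 1) w2))
      = (\<Sum>nm\<in>?I. ?P nm * ?ev (\<psi> (case nm of (n, m) \<Rightarrow> w n m)))"
      by simp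
    also have "\<dots> = (\<Sum>nm\<in>(\<lambda>j. (nat j, nat (s - j))) ` JJ a b c d s t. ?P nm * ?ev (\<psi> (case nm of (n, m) \<Rightarrow> w n m)))"
    proof (rule sum.mono_neutral_right)
      show "(\<lambda>j. (nat j, nat (s - j))) ` JJ a b c d s t \<subseteq> ?I" by (auto simp: JJ_def)
      show "\<forall>nm\<in>?I - (\<lambda>j. (nat j, nat (s - j))) ` JJ a b c d s t. ?P nm * ?ev (\<psi> (case nm of (n, m) \<Rightarrow> w n m)) = 0"
      proof
        fix nm assume nm: "nm \<in> ?I - (\<lambda>j. (nat j, nat (s - j))) ` JJ a b c d s t"
        obtain n m where [simp]: "nm = (n, m)" by force
        have le: "n \<le> b" "m \<le> d" using nm by auto
        have "K n m = 0"
        proof (rule ccontr)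
          assume "K n m \<noteq> 0"
          from K0[OF le this] e f le have "int n \<in> JJ a b c d s t" "m = nat (s - int n)"
            by (auto simp: JJ_def of_nat_diff)
          then show False using nm by (auto intro: rev_image_eqI)
        qed
        then show "?P nm * ?ev (\<psi> (case nm of (n, m) \<Rightarrow> w n m)) = 0" using K[OF le std(3)] by simp
      qed
    qed simp
    also have "\<dots> = (\<Sum>j\<in>JJ a b c d s t. ?P (nat j, nat (s - j)) * ?ev (\<psi> (w (nat j) (nat (s - j)))))"
    proof -
      have "inj_on (\<lambda>j. (nat j, nat (s - j))) (JJ a b c d s t)"
        by (rule inj_onI) (auto simp: JJ_def)
      then show ?thesis by (simp add: sum.reindex)
    qed
    also have "\<dots> = (\<Sum>j\<in>JJ a b c d s t. C j * pmono a b c d s t j w1 w2 w3)"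
    proof (intro sum.cong refl)
      fix j assume j: "j \<in> JJ a b c d s t"
      then have jj: "0 \<le> j" "j \<le> s" "j \<le> b" "s - j \<le> d" by (auto simp: JJ_def)
      then have le: "nat j \<le> b" "nat (s - j) \<le> d" by linarith+
      have exps: "b - nat j = nat (b - j)" "d - nat (s - j) = nat (d - s + j)"
        "nat (int a + (b - nat j) + (d - nat (s - j)) - nat (s - j) - f) = nat (a - s + j - t)"
        "nat (int c + (b - nat j) + (d - nat (s - j)) - nat j - f) = nat (c - t - j)"
        using jj le e f by linarith+
      show "?P (nat j, nat (s - j)) * ?ev (\<psi> (w (nat j) (nat (s - j)))) = C j * pmono a b c d s t j w1 w2 w3"
        unfolding K[OF le std(3)] exps(3,4) unfolding C_def pmono_def split_conv exps(1,2) by (simp only: mult_ac)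
    qed
    finally show ?thesis .
  qed
  then show ?thesis by blast
qed

section \<open>Uniqueness of the projection\<close>

lemma adm_E: "adm E1 X1 E2 X2" and adm_X: "adm X1 E1 X2 E2"
  by (simp_all add: adm_def)

text \<open>
  Composing \<open>\<phi>\<close> with multiplication by \<open>(\<Sum> e\<^sub>i x\<^sub>i)\<^sup>k\<close> gives an equivariant map on
  \<open>V(a,b) = V(a,b) \<otimes> V(0,0)\<close>, for which the index set \<open>J\<close> is empty.
\<close>

lemma Hom_G_qq_power_eq_0:
  assumes \<phi>: "\<phi> \<in> Hom_G (SD (a + k) (b + k)) (V (a + k) (b + k))" and k: "k > 0" and h: "h \<in> V a b"
  shows "\<phi> (qq ^ k * h) = 0"
proof -
  let ?T = "tensor (harm E1 X1 a b) (harm E1 X1 0 0)"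
  have const: "\<exists>c. q = Cst c" if "q \<in> harm E1 X1 0 0" for q
  proof -
    have "dg E1 X1 0 0 = (\<lambda>_. 0)" by (auto simp: dg_def)
    then show ?thesis using that hmg_const by (simp add: harm_def)
  qed
  have T: "?T \<subseteq> hmg (dg E1 X1 a b)"
    unfolding tensor_def
  proof (rule P.span_minimal[OF _ subspace_hmg])
    show "{p * second_copy q |p q. p \<in> harm E1 X1 a b \<and> q \<in> harm E1 X1 0 0} \<subseteq> hmg (dg E1 X1 a b)"
      using const by (fastforce simp: second_copy_simps mult.commute[of _ "Cst _"] hmg_Cst_mult harm_def)
  qed
  then have SD: "qq ^ k * p \<in> SD (a + k) (b + k)" if "p \<in> ?T" for p
    using that hmg_qq_power_mult by (auto simp: SD_eq)
  define \<psi> where "\<psi> = restrict_to ?T (\<lambda>p. \<phi> (qq ^ k * p))"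
  have \<psi>: "\<psi> \<in> Hom_G ?T (harm E1 X1 (a + k) (b + k))"
    unfolding Hom_G_def
  proof (intro CollectI conjI ballI allI impI)
    fix p assume p: "p \<in> ?T"
    show "\<psi> p \<in> harm E1 X1 (a + k) (b + k)"
      using Hom_GD(1)[OF \<phi> SD[OF p]] p by (simp add: \<psi>_def restrict_to_def V_eq)
    show "\<psi> (p + q) = \<psi> p + \<psi> q" if q: "q \<in> ?T" for q
      using Hom_GD(2)[OF \<phi> SD[OF p] SD[OF q]] p q P.subspace_add[OF subspace_tensor p q]
      by (simp add: \<psi>_def restrict_to_def distrib_left)
    show "\<psi> (pscale u p) = pscale u (\<psi> p)" for u
      using Hom_GD(3)[OF \<phi> SD[OF p], of u] p P.subspace_scale[OF subspace_tensor p, of u]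
      by (simp add: \<psi>_def restrict_to_def pscale_def mult.left_commute)
    show "\<psi> (act g p) = act g (\<psi> p)" if g: "g \<in> SL3" for g
      using Hom_GD(4)[OF \<phi> g SD[OF p]] p act_tensor[OF adm_E g p]
      by (simp add: \<psi>_def restrict_to_def act_qq[OF g])
  qed (simp add: \<psi>_def restrict_to_def)
  \<comment> \<open>Matching \<open>a + k\<close> and \<open>b + k\<close> with the degree formulas
    gives \<open>s = - k\<close> and \<open>t = 0\<close>; then \<open>0 \<le> j \<le> s\<close> is
    impossible.\<close>
  have J: "JJ a b 0 0 (- int k) 0 = {}" using k by (auto simp: JJ_def)
  have "\<psi> h = 0"
    using standard_expansion[OF adm_E \<psi>, of "- int k" 0]
    by (intro Hom_G_eq_0_if_standard[OF adm_E \<psi>]) (auto simp: J)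
  moreover have "h \<in> ?T"
  proof -
    have "1 \<in> harm E1 X1 0 0" using powers_harm[of E1 X1 0 0 0 0] by (simp add: ip_simps)
    from tensor_mult_in[OF _ this, of h] h show ?thesis
      using second_copy_simps(6)[of 1] by (simp add: V_eq Cst_simps)
  qed
  ultimately show ?thesis by (simp add: \<psi>_def restrict_to_def)
qed

text \<open>Descending induction on the power of \<open>qq\<close>: \<open>qq ^ k * p\<close>
  differs from \<open>qq ^ k\<close> times a harmonic polynomial by a multiple of
  \<open>qq ^ Suc k\<close>. The harmonic part is killed by assumption for \<open>k = 0\<close> and
  by \<open>Hom_G_qq_power_eq_0\<close> otherwise.\<close>

lemma Hom_G_SD_eq_0:
  assumes \<phi>: "\<phi> \<in> Hom_G (SD e f) (V e f)" and V: "\<And>p. p \<in> V e f \<Longrightarrow> \<phi> p = 0"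
  shows "\<phi> p = 0"
proof -
  have SD: "qq ^ k * p \<in> SD e f" if "p \<in> hmg (dg E1 X1 (e - k) (f - k))" "k \<le> min e f" for k p
    using hmg_qq_power_mult[OF that(1), of k] that(2) by (simp add: SD_eq)
  have "\<phi> (qq ^ k * p) = 0" if "p \<in> hmg (dg E1 X1 (e - k) (f - k))" "k \<le> min e f" for k p
    using that
  proof (induction "min e f - k" arbitrary: k p rule: less_induct)
    case less
    obtain r where r: "pr (e - k) (f - k) p = p + qq * r" "r \<in> hmg (dg E1 X1 (e - k - 1) (f - k - 1))"
      "e - k = 0 \<or> f - k = 0 \<Longrightarrow> r = 0"
      using pr_eq_add_multiple[OF less.prems(1)] by blast
    let ?h = "pr (e - k) (f - k) p"
    have h: "?h \<in> V (e - k) (f - k)" by (rule pr_harm[OF less.prems(1)])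
    have h0: "\<phi> (qq ^ k * ?h) = 0"
    proof (cases "k = 0")
      case False
      then show ?thesis
        using Hom_G_qq_power_eq_0[of \<phi> "e - k" k "f - k", OF _ _ h] \<phi> less.prems(2) by simp
    qed (use h V in simp)
    have "\<phi> (qq ^ k * (qq * r)) = 0 \<and> qq ^ k * (qq * r) \<in> SD e f"
    proof (cases "e - k = 0 \<or> f - k = 0")
      case True
      then show ?thesis
        using r(3) Hom_G_0[OF \<phi>] subspace_hmg P.subspace_0[OF subspace_hmg] by (simp add: SD_eq)
    next
      case False
      then have "Suc k \<le> min e f" by auto
      moreover have "min e f - Suc k < min e f - k" using False by auto
      moreover have "r \<in> hmg (dg E1 X1 (e - Suc k) (f - Suc k))" using r(2) by simp
      ultimately have "\<phi> (qq ^ Suc k * r) = 0" "qq ^ Suc k * r \<in> SD e f" using less.hyps SD by blast+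
      then show ?thesis by (simp add: mult_ac)
    qed
    moreover have "\<phi> (qq ^ k * p + qq ^ k * (qq * r)) = \<phi> (qq ^ k * p) + \<phi> (qq ^ k * (qq * r))"
      using calculation SD[OF less.prems] by (intro Hom_GD(2)[OF \<phi>]) auto
    ultimately show ?case using h0 by (simp add: r(1) distrib_left)
  qed
  from this[of p 0] show ?thesis
    using Hom_GD(5)[OF \<phi>, of p] by (cases "p \<in> SD e f") (auto simp: SD_eq)
qed

text \<open>The difference of two candidates kills V(e,f), hence everything, so the definite
  description denotes the explicit \<open>pr\<close>, extended by 0.\<close>

lemma proj_in_Hom_G: "proj e f \<in> Hom_G (SD e f) (V e f)"
  and proj_eq_pr: "p \<in> SD e f \<Longrightarrow> proj e f p = pr e f p"
proof -
  let ?P = "\<lambda>\<phi>. \<phi> \<in> Hom_G (SD e f) (V e f) \<and> (\<forall>p\<in>V e f. \<phi> p = p)"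
  let ?pr = "restrict_to (SD e f) (pr e f)"
  have sub: "P.subspace (SD e f)" by (simp add: SD_eq subspace_hmg)
  have Hom: "?pr \<in> Hom_G (SD e f) (V e f)"
    unfolding Hom_G_def
  proof (intro CollectI conjI ballI allI impI)
    fix p assume p: "p \<in> SD e f"
    show "?pr p \<in> V e f" using p pr_harm by (simp add: restrict_to_def SD_eq)
    show "?pr (p + q) = ?pr p + ?pr q" if "q \<in> SD e f" for q
      using p that P.subspace_add[OF sub] by (simp add: restrict_to_def pr_add)
    show "?pr (pscale u p) = pscale u (?pr p)" for u
      using p P.subspace_scale[OF sub] by (simp add: restrict_to_def pr_pscale)
    show "?pr (act g p) = act g (?pr p)" if "g \<in> SL3" for g
      using p that hmg_act by (simp add: restrict_to_def pr_act SD_eq)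
  qed (simp add: restrict_to_def)
  moreover have "?pr p = p" if "p \<in> V e f" for p
    using that pr_ident by (simp add: restrict_to_def V_def)
  ultimately have ex: "?P ?pr" by blast
  have "\<phi> = ?pr" if "?P \<phi>" for \<phi>
  proof
    fix p
    have "P.subspace (V e f)" by (simp add: V_eq subspace_harm)
    then have "\<phi> - ?pr \<in> Hom_G (SD e f) (V e f)"
      using that Hom by (intro F.subspace_diff subspace_Hom_G) auto
    from Hom_G_SD_eq_0[OF this, of p] have "(\<phi> - ?pr) p = 0"
      using that ex by simp
    then show "\<phi> p = ?pr p" by simp
  qed
  with ex have eq: "proj e f = ?pr"
    unfolding proj_def by (rule the_equality)
  show "proj e f \<in> Hom_G (SD e f) (V e f)" unfolding eq by (rule Hom)
  show "p \<in> SD e f \<Longrightarrow> proj e f p = pr e f p" unfolding eq by (simp add: restrict_to_def)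
qed

text \<open>\<open>pr\<close> changes a polynomial by a multiple of \<open>qq\<close>, which is 0 at
  flags; values there can thus be computed before projecting.\<close>

lemma ev_proj:
  assumes "p \<in> SD e f" "ip v w = 0"
  shows "ev (pt E1 X1 v w) (proj e f p) = ev (pt E1 X1 v w) p"
proof -
  obtain r where "pr e f p = p + qq * r"
    using pr_eq_add_multiple assms(1) by (metis SD_eq)
  then show ?thesis using assms by (simp add: proj_eq_pr ev_qq)
qed

section \<open>A criterion for bases\<close>

lemma is_basis_reindex:
  assumes "is_basis J' (\<phi> \<circ> h) H" "h ` J' = J"
  shows "is_basis J \<phi> H"
  using assms by (auto simp: is_basis_def image_comp inj_on_imageI)

text \<open>The functionals \<open>E z\<close> turn a linear relation into a polynomial in
  \<open>z\<close> with distinct exponents \<open>nat j\<close>, whose coefficients must vanish.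
  Injectivity comes from applying this to \<open>\<phi> i - \<phi> j = 0\<close>.\<close>

lemma is_basisI:
  assumes J: "finite J" "\<And>j. j \<in> J \<Longrightarrow> 0 \<le> j" and H: "F.subspace H" and \<phi>: "\<And>j. j \<in> J \<Longrightarrow> \<phi> j \<in> H"
    and span: "\<And>\<psi>. \<psi> \<in> H \<Longrightarrow> \<exists>C. \<psi> = (\<Sum>j\<in>J. fscale (C j) (\<phi> j))"
    and E: "\<And>z r. E z (\<Sum>j\<in>J. fscale (r j) (\<phi> j)) = (\<Sum>j\<in>J. r j * (\<kappa> j * z ^ nat j))" "\<And>z. E z 0 = 0"
    and \<kappa>: "\<And>j. j \<in> J \<Longrightarrow> \<kappa> j \<noteq> (0::complex)"
  shows "is_basis J \<phi> H"
proof -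
  have indep: "r j = 0" if sum0: "(\<Sum>j\<in>J. fscale (r j) (\<phi> j)) = 0" and j: "j \<in> J" for r j
  proof -
    define Q where "Q = (\<Sum>j\<in>J. monom (r j * \<kappa> j) (nat j))"
    have "poly Q z = 0" for z
      using E(1)[of z r] E(2)[of z] sum0 by (simp add: Q_def poly_sum poly_monom mult.assoc)
    then have "Q = 0" using poly_all_0_iff_0 by blast
    then have "coeff Q (nat j) = 0" by simp
    moreover have "coeff Q (nat j) = (\<Sum>i\<in>J. if i = j then r i * \<kappa> i else 0)"
      unfolding Q_def coeff_sum
      by (intro sum.cong refl) (use J(2) j in \<open>auto simp: eq_nat_nat_iff\<close>)
    ultimately show ?thesis using J(1) j \<kappa> by simp
  qed
  have inj: "inj_on \<phi> J"
  proof (rule inj_onI, rule ccontr)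
    fix i j assume ij: "i \<in> J" "j \<in> J" "\<phi> i = \<phi> j" "i \<noteq> j"
    define r where "r k = (if k = i then 1 else if k = j then -1 else 0 :: complex)" for k
    have "(\<Sum>k\<in>J. fscale (r k) (\<phi> k)) = (\<Sum>k\<in>{i, j}. fscale (r k) (\<phi> k))"
      using ij J(1) by (intro sum.mono_neutral_right) (auto simp: r_def)
    also have "\<dots> = 0" using ij by (simp add: r_def)
    finally show False using indep[OF _ ij(1), of r] by (simp add: r_def)
  qed
  moreover have "F.independent (\<phi> ` J)"
  proof (rule F.independent_if_scalars_zero)
    fix u x assume "(\<Sum>x\<in>\<phi> ` J. fscale (u x) x) = 0" "x \<in> \<phi> ` J"
    then show "u x = 0" using indep[of "u \<circ> \<phi>"] by (auto simp: sum.reindex[OF inj])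
  qed (use J in simp)
  moreover have "F.span (\<phi> ` J) = H"
  proof
    show "F.span (\<phi> ` J) \<subseteq> H" using \<phi> H by (intro F.span_minimal) auto
    show "H \<subseteq> F.span (\<phi> ` J)"
    proof
      fix \<psi> assume "\<psi> \<in> H"
      then obtain C where "\<psi> = (\<Sum>j\<in>J. fscale (C j) (\<phi> j))" using span by blast
      then show "\<psi> \<in> F.span (\<phi> ` J)"
        by (simp only:) (intro F.span_sum F.span_scale F.span_base imageI)
    qed
  qed
  ultimately show ?thesis by (simp add: is_basis_def)
qed

lemma sum_fscale_apply: "(\<Sum>j\<in>J. fscale (r j) (\<phi> j)) p = (\<Sum>j\<in>J. pscale (r j) (\<phi> j p))"
  by (induction J rule: infinite_finite_induct) (simp_all add: fscale_def)

lemma finite_JJ: "finite (JJ a b c d s t)"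
  by (rule finite_subset[of _ "{0..s}"]) (auto simp: JJ_def)

lemma is_basis_Hom_G:
  assumes adm: "adm k1 l1 k2 l2"
    and e: "int e = int a + c - s - 2 * t" and f: "int f = int b + d - s + t"
    and \<phi>: "\<And>j. j \<in> JJ a b c d s t \<Longrightarrow>
      \<phi> j \<in> Hom_G (tensor (harm k1 l1 a b) (harm k1 l1 c d)) (harm k1 l1 e f)"
    and std: "\<And>j w1 w2 w3. j \<in> JJ a b c d s t \<Longrightarrow> w1 $ 1 = 0 \<Longrightarrow> w2 $ 2 = 0 \<Longrightarrow> w3 $ 3 = 0 \<Longrightarrow>
      ev (pt k1 l1 w3 (axis 3 1)) (\<phi> j (gen k1 l1 k2 l2 a b c d (axis 1 1) w1 (axis 2 1) w2))
      = \<kappa> j * pmono a b c d s t j w1 w2 w3"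
    and \<kappa>: "\<And>j. j \<in> JJ a b c d s t \<Longrightarrow> \<kappa> j \<noteq> 0"
  shows "is_basis (JJ a b c d s t) \<phi> (Hom_G (tensor (harm k1 l1 a b) (harm k1 l1 c d)) (harm k1 l1 e f))"
    (is "is_basis ?J \<phi> ?H")
proof -
  define val where "val \<psi> w1 w2 w3 = ev (pt k1 l1 w3 (axis 3 1)) (\<psi> (gen k1 l1 k2 l2 a b c d (axis 1 1) w1 (axis 2 1) w2))"
    for \<psi> w1 w2 w3
  have val_sum: "val (\<Sum>j\<in>?J. fscale (r j) (\<phi> j)) w1 w2 w3 = (\<Sum>j\<in>?J. r j * (\<kappa> j * pmono a b c d s t j w1 w2 w3))"
    if "w1 $ 1 = 0" "w2 $ 2 = 0" "w3 $ 3 = 0" for r w1 w2 w3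
    using that std by (simp add: val_def sum_fscale_apply)
  have H: "F.subspace ?H" by (intro subspace_Hom_G subspace_harm)
  have span: "\<exists>C. \<psi> = (\<Sum>j\<in>?J. fscale (C j) (\<phi> j))" if \<psi>: "\<psi> \<in> ?H" for \<psi>
  proof -
    obtain C where C: "\<And>w1 w2 w3. w1 $ 1 = 0 \<Longrightarrow> w2 $ 2 = 0 \<Longrightarrow> w3 $ 3 = 0 \<Longrightarrow>
        val \<psi> w1 w2 w3 = (\<Sum>j\<in>?J. C j * pmono a b c d s t j w1 w2 w3)"
      using standard_expansion[OF adm \<psi> e f] unfolding val_def by blast
    \<comment> \<open>Dividing by \<open>\<kappa> j\<close> gives the combination with the same
      standard values as \<open>\<psi>\<close>.\<close>
    define \<Phi> where "\<Phi> = (\<Sum>j\<in>?J. fscale (C j / \<kappa> j) (\<phi> j))"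
    have "\<Phi> \<in> ?H" unfolding \<Phi>_def using \<phi> by (intro F.subspace_sum F.subspace_scale H)
    then have "\<psi> - \<Phi> \<in> ?H" using \<psi> H by (intro F.subspace_diff)
    then have "(\<psi> - \<Phi>) p = 0" for p
    proof (rule Hom_G_eq_0_if_standard[OF adm])
      fix w1 w2 w3 :: "complex^3" assume w: "w1 $ 1 = 0" "w2 $ 2 = 0" "w3 $ 3 = 0"
      have "val \<Phi> w1 w2 w3 = val \<psi> w1 w2 w3"
        unfolding C[OF w] \<Phi>_def val_sum[OF w] using \<kappa> by (intro sum.cong refl) simp
      then show "ev (pt k1 l1 w3 (axis 3 1)) ((\<psi> - \<Phi>) (gen k1 l1 k2 l2 a b c d (axis 1 1) w1 (axis 2 1) w2)) = 0"
        by (simp add: val_def)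
    qed
    then have "\<psi> = \<Phi>" by (simp add: fun_eq_iff)
    then show ?thesis unfolding \<Phi>_def by (intro exI[of _ "\<lambda>j. C j / \<kappa> j"])
  qed
  \<comment> \<open>Every pairing is set to 1 except the one with exponent \<open>j\<close>, which
    is \<open>z\<close>; so \<open>pmono\<close> becomes \<open>z ^ nat j\<close>.\<close>
  define E where "E z \<psi> = val \<psi> (vector [0, z, 1]) (vector [1, 0, 1]) (vector [1, 1, 0])" for z \<psi>
  show ?thesis
  proof (rule is_basisI[where E = E and \<kappa> = \<kappa>])
    show "E z (\<Sum>j\<in>?J. fscale (r j) (\<phi> j)) = (\<Sum>j\<in>?J. r j * (\<kappa> j * z ^ nat j))" for z r
      unfolding E_def by (subst val_sum) (simp_all add: pmono_def)
    show "E z 0 = 0" for z by (simp add: E_def val_def)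
  qed (use finite_JJ \<phi> \<kappa> H span in \<open>auto simp: JJ_def\<close>)
qed

section \<open>The elementary maps on generators\<close>

definition lin :: "(mpoly \<Rightarrow> mpoly) \<Rightarrow> bool"
  where "lin \<Lambda> \<longleftrightarrow> (\<forall>p q. \<Lambda> (p + q) = \<Lambda> p + \<Lambda> q) \<and> (\<forall>c p. \<Lambda> (Cst c * p) = Cst c * \<Lambda> p)"

lemma lin_comp: "lin \<Lambda> \<Longrightarrow> lin \<Lambda>' \<Longrightarrow> lin (\<Lambda> \<circ> \<Lambda>')"
  by (simp add: lin_def)

lemma lin_funpow: "lin \<Lambda> \<Longrightarrow> lin (\<Lambda> ^^ n)"
  by (induction n) (simp_all add: lin_def)

lemma lin_contr: "lin (contr k l)"
  by (simp add: lin_def contr_add contr_Cst_mult)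

lemma lin_rename: "lin (rename \<rho>)"
  by (simp add: lin_def rename_def)

lemma lin_theta: "lin theta" and lin_omega: "lin omega"
  by (simp_all add: lin_def theta_def omega_def pscale_def algebra_simps sum.distrib sum_distrib_left)

text \<open>Falling factorial. For \<open>n > a\<close> one factor is 0, which makes the truncated
  exponents \<open>a - n\<close> in the iterated formulas harmless.\<close>

definition falling :: "nat \<Rightarrow> nat \<Rightarrow> complex"
  where "falling a n = (\<Prod>i<n. of_nat (a - i))"

lemma falling_nonzero: "n \<le> a \<Longrightarrow> falling a n \<noteq> 0"
  by (auto simp: falling_def)

lemma contr_funpow:
  assumes "k \<noteq> l" "\<And>i. pderiv_var (k, i) R = 0" "\<And>i. pderiv_var (l, i) R = 0"
  shows "(contr k l ^^ n) (L k v ^ a * L l w ^ b * R)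
    = Cst (falling a n * falling b n * ip v w ^ n) * (L k v ^ (a - n) * L l w ^ (b - n) * R)"
proof (induction n)
  case (Suc n)
  show ?case
    unfolding funpow.simps comp_apply Suc.IH contr_Cst_mult contr_powers[OF assms]
    by (simp add: falling_def Cst_simps mult_ac)
qed (simp add: falling_def Cst_simps)

lemma det_rows: "det (vector [r1, r2, r3] :: 'a::comm_ring_1^3^3)
    = (\<Sum>\<sigma> | \<sigma> permutes UNIV. of_int (sign \<sigma>) * (r1 $ \<sigma> 1 * (r2 $ \<sigma> 2 * r3 $ \<sigma> 3)))"
  unfolding det_def by (simp add: prod_UNIV_3 mult.assoc)

lemma Cst_of_int: "Cst (of_int n) = of_int n"
  by (simp add: Cst_def)

text \<open>The signed sum is the determinant with rows \<open>v\<close>, \<open>w\<close> and the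
  variables of \<open>X1\<close>; its expansion along the last row is the linear form of
  \<open>crs v w\<close>.\<close>

lemma theta_powers:
  assumes "\<And>i. pderiv_var (E1, i) R = 0" "\<And>i. pderiv_var (E2, i) R = 0"
  shows "theta (L E1 v ^ a * L E2 w ^ c * R)
    = Cst (of_nat a * of_nat c) * (L E1 v ^ (a - 1) * L E2 w ^ (c - 1) * (L X1 (crs v w) * R))"
proof -
  let ?X = "Cst (of_nat a * of_nat c) * (L E1 v ^ (a - 1) * L E2 w ^ (c - 1) * R)"
  have d: "pderiv_var (E1, i) (pderiv_var (E2, j) (L E1 v ^ a * L E2 w ^ c * R))
    = Cst (v $ i) * Cst (w $ j) * ?X" for i j
    using assms by (simp add: pderiv_L_power Cst_simps Cst_of_nat mult_ac)
  have "theta (L E1 v ^ a * L E2 w ^ c * R)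
    = det (vector [\<chi> i. Cst (v $ i), \<chi> i. Cst (w $ i), \<chi> i. Var (X1, i)] :: mpoly^3^3) * ?X"
    unfolding theta_def d det_rows sum_distrib_right
    by (intro sum.cong refl) (simp add: pscale_def Cst_of_int mult_ac)
  also have "det (vector [\<chi> i. Cst (v $ i), \<chi> i. Cst (w $ i), \<chi> i. Var (X1, i)] :: mpoly^3^3) = L X1 (crs v w)"
    by (simp add: det_3 L_def crs_def sum_3 Cst_simps algebra_simps)
  finally show ?thesis by (simp add: mult_ac)
qed

text \<open>Here the row of variables comes first; moving it to the end is a cyclic permutation, so
  no sign appears.\<close>

lemma omega_powers:
  assumes "\<And>i. pderiv_var (X1, i) R = 0" "\<And>i. pderiv_var (X2, i) R = 0"
  shows "omega (L X1 v ^ b * L X2 w ^ d * R)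
    = Cst (of_nat b * of_nat d) * (L X1 v ^ (b - 1) * L X2 w ^ (d - 1) * (L E1 (crs v w) * R))"
proof -
  let ?X = "Cst (of_nat b * of_nat d) * (L X1 v ^ (b - 1) * L X2 w ^ (d - 1) * R)"
  have d: "pderiv_var (X1, i) (pderiv_var (X2, j) (L X1 v ^ b * L X2 w ^ d * R))
    = Cst (v $ i) * Cst (w $ j) * ?X" for i j
    using assms by (simp add: pderiv_L_power Cst_simps Cst_of_nat mult_ac)
  have "omega (L X1 v ^ b * L X2 w ^ d * R)
    = det (vector [\<chi> i. Var (E1, i), \<chi> i. Cst (v $ i), \<chi> i. Cst (w $ i)] :: mpoly^3^3) * ?X"
    unfolding omega_def d det_rows sum_distrib_right
    by (intro sum.cong refl) (simp add: pscale_def Cst_of_int mult_ac)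
  also have "det (vector [\<chi> i. Var (E1, i), \<chi> i. Cst (v $ i), \<chi> i. Cst (w $ i)] :: mpoly^3^3) = L E1 (crs v w)"
    by (simp add: det_3 L_def crs_def sum_3 Cst_simps algebra_simps)
  finally show ?thesis by (simp add: mult_ac)
qed

text \<open>The factor \<open>L X1 (crs v w)\<close> produced at each step is free of the
  differentiated slots and can join \<open>R\<close>.\<close>

lemma theta_funpow:
  assumes "\<And>i. pderiv_var (E1, i) R = 0" "\<And>i. pderiv_var (E2, i) R = 0"
  shows "(theta ^^ n) (L E1 v ^ a * L E2 w ^ c * R)
    = Cst (falling a n * falling c n) * (L E1 v ^ (a - n) * L E2 w ^ (c - n) * (L X1 (crs v w) ^ n * R))"
proof (induction n)
  case (Suc n)
  have "pderiv_var (E1, i) (L X1 (crs v w) ^ n * R) = 0" "pderiv_var (E2, i) (L X1 (crs v w) ^ n * R) = 0" for i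
    using assms by (simp_all add: pderiv_L_power)
  note * = theta_powers[OF this]
  have scale: "theta (Cst u * p) = Cst u * theta p" for u p
    using lin_theta by (simp add: lin_def)
  show ?case
    unfolding funpow.simps comp_apply Suc.IH scale *
    by (simp add: falling_def Cst_simps mult_ac)
qed (simp add: falling_def Cst_simps)

lemma omega_funpow:
  assumes "\<And>i. pderiv_var (X1, i) R = 0" "\<And>i. pderiv_var (X2, i) R = 0"
  shows "(omega ^^ n) (L X1 v ^ b * L X2 w ^ d * R)
    = Cst (falling b n * falling d n) * (L X1 v ^ (b - n) * L X2 w ^ (d - n) * (L E1 (crs v w) ^ n * R))"
proof (induction n)
  case (Suc n)
  have "pderiv_var (X1, i) (L E1 (crs v w) ^ n * R) = 0" "pderiv_var (X2, i) (L E1 (crs v w) ^ n * R) = 0" for i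
    using assms by (simp_all add: pderiv_L_power)
  note * = omega_powers[OF this]
  have scale: "omega (Cst u * p) = Cst u * omega p" for u p
    using lin_omega by (simp add: lin_def)
  show ?case
    unfolding funpow.simps comp_apply Suc.IH scale *
    by (simp add: falling_def Cst_simps mult_ac)
qed (simp add: falling_def Cst_simps)

lemma mult_simps:
  "mult_S (p * q) = mult_S p * mult_S q" "mult_S (p ^ n) = mult_S p ^ n" "mult_S (Cst c) = Cst c"
  "mult_S (L k v) = L (if k = E2 then E1 else k) v"
  "mult_D (p * q) = mult_D p * mult_D q" "mult_D (p ^ n) = mult_D p ^ n" "mult_D (Cst c) = Cst c"
  "mult_D (L k v) = L (if k = X2 then X1 else k) v"
  by (simp_all add: mult_S_def mult_D_def rename_def L_def)

section \<open>The composite maps on products of powers\<close>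

abbreviation genE :: "nat \<Rightarrow> nat \<Rightarrow> nat \<Rightarrow> nat \<Rightarrow> complex^3 \<Rightarrow> complex^3 \<Rightarrow> complex^3 \<Rightarrow> complex^3 \<Rightarrow> mpoly"
  where "genE \<equiv> gen E1 X1 E2 X2"

text \<open>\<open>alpha\<close> pairs the first vector with the second covector,
  \<open>beta\<close> the first covector with the second vector; each leaves the other two powers in
  \<open>R\<close>.\<close>

lemma beta_alpha_gen:
  "(beta ^^ j) ((alpha ^^ n) (genE a b c d v1 w1 v2 w2))
    = Cst (falling a n * falling d n * falling b j * falling c j * ip v1 w2 ^ n * ip w1 v2 ^ j) * genE (a - n) (b - j) (c - j) (d - n) v1 w1 v2 w2"
proof -
  have "genE a b c d v1 w1 v2 w2 = L E1 v1 ^ a * L X2 w2 ^ d * (L X1 w1 ^ b * L E2 v2 ^ c)"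
    by (simp add: gen_def mult_ac)
  then have "(alpha ^^ n) (genE a b c d v1 w1 v2 w2)
    = Cst (falling a n * falling d n * ip v1 w2 ^ n) * (L E1 v1 ^ (a - n) * L X2 w2 ^ (d - n) * (L X1 w1 ^ b * L E2 v2 ^ c))"
    unfolding alpha_eq by (simp only:) (rule contr_funpow, auto simp: pderiv_L_power)
  also have "\<dots> = Cst (falling a n * falling d n * ip v1 w2 ^ n) * (L X1 w1 ^ b * L E2 v2 ^ c * (L E1 v1 ^ (a - n) * L X2 w2 ^ (d - n)))"
    by (simp only: mult_ac)
  finally have "(beta ^^ j) ((alpha ^^ n) (genE a b c d v1 w1 v2 w2)) = Cst (falling a n * falling d n * ip v1 w2 ^ n)
      * (beta ^^ j) (L X1 w1 ^ b * L E2 v2 ^ c * (L E1 v1 ^ (a - n) * L X2 w2 ^ (d - n)))"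
    using lin_funpow[OF lin_contr] by (simp add: beta_eq lin_def)
  also have "(beta ^^ j) (L X1 w1 ^ b * L E2 v2 ^ c * (L E1 v1 ^ (a - n) * L X2 w2 ^ (d - n)))
    = Cst (falling b j * falling c j * ip w1 v2 ^ j) * (L X1 w1 ^ (b - j) * L E2 v2 ^ (c - j) * (L E1 v1 ^ (a - n) * L X2 w2 ^ (d - n)))"
    unfolding beta_eq by (rule contr_funpow) (auto simp: pderiv_L_power)
  finally show ?thesis by (simp add: gen_def Cst_simps mult_ac)
qed

definition theta_map :: "nat \<Rightarrow> nat \<Rightarrow> nat \<Rightarrow> mpoly \<Rightarrow> mpoly"
  where "theta_map \<tau> j n = mult_S \<circ> (theta ^^ \<tau>) \<circ> mult_D \<circ> (beta ^^ j) \<circ> (alpha ^^ n)"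

definition omega_map :: "nat \<Rightarrow> nat \<Rightarrow> nat \<Rightarrow> mpoly \<Rightarrow> mpoly"
  where "omega_map \<tau> j n = mult_D \<circ> (omega ^^ \<tau>) \<circ> mult_S \<circ> (beta ^^ j) \<circ> (alpha ^^ n)"

lemma lin_maps: "lin (theta_map \<tau> j n)" "lin (omega_map \<tau> j n)"
  unfolding theta_map_def omega_map_def mult_S_def mult_D_def alpha_eq beta_eq
  by (intro lin_comp lin_funpow lin_contr lin_rename lin_theta lin_omega)+

lemma theta_map_gen:
  "theta_map \<tau> j n (genE a b c d v1 w1 v2 w2)
    = Cst (falling a n * falling d n * falling b j * falling c j * falling (a - n) \<tau> * falling (c - j) \<tau> * (ip v1 w2 ^ n * ip w1 v2 ^ j))
      * (L E1 v1 ^ (a - n - \<tau>) * L E1 v2 ^ (c - j - \<tau>) * (L X1 w1 ^ (b - j) * L X1 w2 ^ (d - n) * L X1 (crs v1 v2) ^ \<tau>))"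
proof -
  let ?k = "falling a n * falling d n * falling b j * falling c j * ip v1 w2 ^ n * ip w1 v2 ^ j"
  have "mult_D ((beta ^^ j) ((alpha ^^ n) (genE a b c d v1 w1 v2 w2)))
    = Cst ?k * (L E1 v1 ^ (a - n) * L E2 v2 ^ (c - j) * (L X1 w1 ^ (b - j) * L X1 w2 ^ (d - n)))"
    unfolding beta_alpha_gen unfolding gen_def mult_simps by (simp add: mult_ac)
  then have "(theta ^^ \<tau>) (mult_D ((beta ^^ j) ((alpha ^^ n) (genE a b c d v1 w1 v2 w2))))
    = Cst ?k * (theta ^^ \<tau>) (L E1 v1 ^ (a - n) * L E2 v2 ^ (c - j) * (L X1 w1 ^ (b - j) * L X1 w2 ^ (d - n)))"
    using lin_funpow[OF lin_theta] by (simp add: lin_def)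
  also have "(theta ^^ \<tau>) (L E1 v1 ^ (a - n) * L E2 v2 ^ (c - j) * (L X1 w1 ^ (b - j) * L X1 w2 ^ (d - n)))
    = Cst (falling (a - n) \<tau> * falling (c - j) \<tau>) * (L E1 v1 ^ (a - n - \<tau>) * L E2 v2 ^ (c - j - \<tau>)
      * (L X1 (crs v1 v2) ^ \<tau> * (L X1 w1 ^ (b - j) * L X1 w2 ^ (d - n))))"
    by (rule theta_funpow) (auto simp: pderiv_L_power)
  finally show ?thesis
    by (simp add: theta_map_def mult_simps Cst_simps mult_ac)
qed

lemma omega_map_gen:
  "omega_map \<tau> j n (genE a b c d v1 w1 v2 w2)
    = Cst (falling a n * falling d n * falling b j * falling c j * falling (b - j) \<tau> * falling (d - n) \<tau> * (ip v1 w2 ^ n * ip w1 v2 ^ j))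
      * (L X1 w1 ^ (b - j - \<tau>) * L X1 w2 ^ (d - n - \<tau>) * (L E1 v1 ^ (a - n) * L E1 v2 ^ (c - j) * L E1 (crs w1 w2) ^ \<tau>))"
proof -
  let ?k = "falling a n * falling d n * falling b j * falling c j * ip v1 w2 ^ n * ip w1 v2 ^ j"
  have "mult_S ((beta ^^ j) ((alpha ^^ n) (genE a b c d v1 w1 v2 w2)))
    = Cst ?k * (L X1 w1 ^ (b - j) * L X2 w2 ^ (d - n) * (L E1 v1 ^ (a - n) * L E1 v2 ^ (c - j)))"
    unfolding beta_alpha_gen unfolding gen_def mult_simps by (simp add: mult_ac)
  then have "(omega ^^ \<tau>) (mult_S ((beta ^^ j) ((alpha ^^ n) (genE a b c d v1 w1 v2 w2))))
    = Cst ?k * (omega ^^ \<tau>) (L X1 w1 ^ (b - j) * L X2 w2 ^ (d - n) * (L E1 v1 ^ (a - n) * L E1 v2 ^ (c - j)))"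
    using lin_funpow[OF lin_omega] by (simp add: lin_def)
  also have "(omega ^^ \<tau>) (L X1 w1 ^ (b - j) * L X2 w2 ^ (d - n) * (L E1 v1 ^ (a - n) * L E1 v2 ^ (c - j)))
    = Cst (falling (b - j) \<tau> * falling (d - n) \<tau>) * (L X1 w1 ^ (b - j - \<tau>) * L X2 w2 ^ (d - n - \<tau>)
      * (L E1 (crs w1 w2) ^ \<tau> * (L E1 v1 ^ (a - n) * L E1 v2 ^ (c - j))))"
    by (rule omega_funpow) (auto simp: pderiv_L_power)
  finally show ?thesis
    by (simp add: omega_map_def mult_simps Cst_simps mult_ac)
qed

text \<open>Degrees and equivariance are checked on products of powers and extended by linearity;
  they ensure that \<open>proj\<close> is applied inside \<open>SD e f\<close>, where it is linear
  and equivariant.\<close>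

lemma restrict_proj_in_Hom_G:
  assumes lin: "lin \<Lambda>"
    and SD: "\<And>v1 w1 v2 w2. \<Lambda> (genE a b c d v1 w1 v2 w2) \<in> SD e f"
    and eqv: "\<And>g v1 w1 v2 w2. g \<in> SL3 \<Longrightarrow> \<Lambda> (genE a b c d (g *v v1) (dual g *v w1) (g *v v2) (dual g *v w2))
      = act g (\<Lambda> (genE a b c d v1 w1 v2 w2))"
  shows "restrict_to (tensor (V a b) (V c d)) (proj e f \<circ> \<Lambda>) \<in> Hom_G (tensor (V a b) (V c d)) (V e f)"
proof -
  let ?T = "tensor (V a b) (V c d)"
  have span: "?T \<subseteq> P.span {genE a b c d v1 w1 v2 w2 | v1 w1 v2 w2. ip v1 w1 = 0 \<and> ip v2 w2 = 0 \<and> crs v1 v2 \<noteq> 0}"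
    unfolding V_eq by (rule tensor_span[OF adm_E])
  have sub: "P.subspace (SD e f)" by (simp add: SD_eq subspace_hmg)
  have add: "\<Lambda> (p + q) = \<Lambda> p + \<Lambda> q" and scale: "\<Lambda> (pscale u p) = pscale u (\<Lambda> p)" for p q u
    using lin by (auto simp: lin_def pscale_def)
  have zero: "\<Lambda> 0 = 0" using scale[of 0 0] by simp
  have main: "\<Lambda> p \<in> SD e f \<and> (\<forall>g\<in>SL3. \<Lambda> (act g p) = act g (\<Lambda> p))" if "p \<in> ?T" for p
    using subsetD[OF span that]
  proof (induction rule: P.span_induct_alt)
    case base
    then show ?case using P.subspace_0[OF sub] by (simp add: zero)
  next
    case (step u x y)
    then have "\<Lambda> x \<in> SD e f \<and> (\<forall>g\<in>SL3. \<Lambda> (act g x) = act g (\<Lambda> x))"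
      using SD eqv by (auto simp: act_gen[OF adm_E] slot_mat_def isE_def)
    then show ?case
      using step P.subspace_add[OF sub] P.subspace_scale[OF sub] by (simp add: add scale)
  qed
  have T: "P.subspace ?T" by (rule subspace_tensor)
  have act: "act g p \<in> ?T" if "g \<in> SL3" "p \<in> ?T" for g p
    using act_tensor[OF adm_E that(1)] that(2) by (simp add: V_eq)
  show ?thesis
    unfolding Hom_G_def
  proof (intro CollectI conjI ballI allI impI)
    fix p assume p: "p \<in> ?T"
    note pr = proj_in_Hom_G[of e f]
    let ?\<phi> = "restrict_to ?T (proj e f \<circ> \<Lambda>)"
    show "?\<phi> p \<in> V e f" using p main[OF p] Hom_GD(1)[OF pr] by (simp add: restrict_to_def)
    show "?\<phi> (p + q) = ?\<phi> p + ?\<phi> q" if q: "q \<in> ?T" for q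
      using p q main[OF p] main[OF q] Hom_GD(2)[OF pr] P.subspace_add[OF T p q] by (simp add: restrict_to_def add)
    show "?\<phi> (pscale u p) = pscale u (?\<phi> p)" for u
      using p main[OF p] Hom_GD(3)[OF pr] P.subspace_scale[OF T p] by (simp add: restrict_to_def scale)
    show "?\<phi> (act g p) = act g (?\<phi> p)" if g: "g \<in> SL3" for g
      using p main[OF p] Hom_GD(4)[OF pr g] act[OF g p] g by (simp add: restrict_to_def)
  qed (simp add: restrict_to_def)
qed

lemma hmg_form_product:
  "L E1 v ^ a1 * L E1 v' ^ a2 * (L X1 w ^ b1 * L X1 w' ^ b2 * L X1 z ^ b3) \<in> hmg (dg E1 X1 (a1 + a2) (b1 + b2 + b3))"
  "L X1 w ^ b1 * L X1 w' ^ b2 * (L E1 v ^ a1 * L E1 v' ^ a2 * L E1 z ^ a3) \<in> hmg (dg E1 X1 (a1 + a2 + a3) (b1 + b2))"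
proof -
  show "L E1 v ^ a1 * L E1 v' ^ a2 * (L X1 w ^ b1 * L X1 w' ^ b2 * L X1 z ^ b3) \<in> hmg (dg E1 X1 (a1 + a2) (b1 + b2 + b3))"
    using hmg_mult[OF hmg_mult[OF hmg_L_power[of E1 v a1] hmg_L_power[of E1 v' a2]]
      hmg_mult[OF hmg_mult[OF hmg_L_power[of X1 w b1] hmg_L_power[of X1 w' b2]] hmg_L_power[of X1 z b3]]]
    by (elim back_subst[of "\<lambda>d. _ \<in> hmg d"]) (auto simp: unit_dg_def dg_def)
  show "L X1 w ^ b1 * L X1 w' ^ b2 * (L E1 v ^ a1 * L E1 v' ^ a2 * L E1 z ^ a3) \<in> hmg (dg E1 X1 (a1 + a2 + a3) (b1 + b2))"
    using hmg_mult[OF hmg_mult[OF hmg_L_power[of X1 w b1] hmg_L_power[of X1 w' b2]]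
      hmg_mult[OF hmg_mult[OF hmg_L_power[of E1 v a1] hmg_L_power[of E1 v' a2]] hmg_L_power[of E1 z a3]]]
    by (elim back_subst[of "\<lambda>d. _ \<in> hmg d"]) (auto simp: unit_dg_def dg_def)
qed

lemma theta_map_SD:
  assumes "a - n - \<tau> + (c - j - \<tau>) = e" "b - j + (d - n) + \<tau> = f"
  shows "theta_map \<tau> j n (genE a b c d v1 w1 v2 w2) \<in> SD e f"
  unfolding theta_map_gen SD_eq using hmg_form_product(1) assms by (intro hmg_Cst_mult) metis

lemma omega_map_SD:
  assumes "a - n + (c - j) + \<tau> = e" "b - j - \<tau> + (d - n - \<tau>) = f"
  shows "omega_map \<tau> j n (genE a b c d v1 w1 v2 w2) \<in> SD e f"
  unfolding omega_map_gen SD_eq using hmg_form_product(2) assms by (intro hmg_Cst_mult) metis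

lemma act_L': "act g (L E1 v) = L E1 (g *v v)" "act g (L X1 v) = L X1 (dual g *v v)"
  by (simp_all add: act_L slot_mat_def isE_def)

lemma theta_map_Hom_G:
  assumes "a - n - \<tau> + (c - j - \<tau>) = e" "b - j + (d - n) + \<tau> = f"
  shows "restrict_to (tensor (V a b) (V c d)) (proj e f \<circ> theta_map \<tau> j n) \<in> Hom_G (tensor (V a b) (V c d)) (V e f)"
proof (rule restrict_proj_in_Hom_G[OF lin_maps(1) theta_map_SD[OF assms]])
  fix g v1 w1 v2 w2 assume g: "g \<in> SL3"
  show "theta_map \<tau> j n (genE a b c d (g *v v1) (dual g *v w1) (g *v v2) (dual g *v w2))
    = act g (theta_map \<tau> j n (genE a b c d v1 w1 v2 w2))"
    by (simp add: theta_map_gen act_L' ip_dual[OF g] crs_dual[OF g])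
qed

lemma omega_map_Hom_G:
  assumes "a - n + (c - j) + \<tau> = e" "b - j - \<tau> + (d - n - \<tau>) = f"
  shows "restrict_to (tensor (V a b) (V c d)) (proj e f \<circ> omega_map \<tau> j n) \<in> Hom_G (tensor (V a b) (V c d)) (V e f)"
proof (rule restrict_proj_in_Hom_G[OF lin_maps(2) omega_map_SD[OF assms]])
  fix g v1 w1 v2 w2 assume g: "g \<in> SL3"
  show "omega_map \<tau> j n (genE a b c d (g *v v1) (dual g *v w1) (g *v v2) (dual g *v w2))
    = act g (omega_map \<tau> j n (genE a b c d v1 w1 v2 w2))"
    \<comment> \<open>\<open>omega\<close> forms the cross product of two covectors, which
      transforms by the dual of \<open>dual g\<close>, that is, by \<open>g\<close>.\<close>
    using crs_dual[OF dual_SL3(1)[OF g]] unfolding dual_SL3(2)[OF g]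
    by (simp add: omega_map_gen act_L' ip_dual[OF g])
qed

lemma crs_axis: "crs (axis 1 1) (axis 2 1) = axis 3 1"
  by (simp add: crs_def vec_eq_iff forall_3 axis_def)

text \<open>At the standard basis \<open>crs v1 v2\<close> is \<open>axis 3 1\<close>, so the factor
  produced by \<open>theta\<close> evaluates to 1 and a scalar multiple of one monomial in the
  pairings is left.\<close>

lemma theta_map_std:
  assumes deg: "a - n - \<tau> + (c - j - \<tau>) = e" "b - j + (d - n) + \<tau> = f"
    and w: "w1 $ 1 = 0" "w2 $ 2 = 0" "w3 $ 3 = 0"
  shows "ev (pt E1 X1 w3 (axis 3 1)) (restrict_to (tensor (V a b) (V c d)) (proj e f \<circ> theta_map \<tau> j n)
      (genE a b c d (axis 1 1) w1 (axis 2 1) w2))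
    = falling a n * falling d n * falling b j * falling c j * falling (a - n) \<tau> * falling (c - j) \<tau>
      * (w1 $ 2 ^ j * w1 $ 3 ^ (b - j) * (w2 $ 1 ^ n * w2 $ 3 ^ (d - n)) * (w3 $ 1 ^ (a - n - \<tau>) * w3 $ 2 ^ (c - j - \<tau>)))"
proof -
  have "genE a b c d (axis 1 1) w1 (axis 2 1) w2 \<in> tensor (V a b) (V c d)"
    unfolding V_eq using w by (intro gen_in_tensor[OF adm_E]) (simp_all add: ip_axis)
  moreover have "ip w3 (axis 3 1) = 0" using w by (simp add: ip_axis)
  ultimately have "ev (pt E1 X1 w3 (axis 3 1)) (restrict_to (tensor (V a b) (V c d)) (proj e f \<circ> theta_map \<tau> j n)
      (genE a b c d (axis 1 1) w1 (axis 2 1) w2))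
    = ev (pt E1 X1 w3 (axis 3 1)) (theta_map \<tau> j n (genE a b c d (axis 1 1) w1 (axis 2 1) w2))"
    using theta_map_SD[OF deg] by (simp add: restrict_to_def ev_proj)
  then show ?thesis
    by (simp add: theta_map_gen ev_L_pt ip_axis crs_axis axis_nth mult_ac)
qed

text \<open>The standard basis now consists of covectors, so the exponent at \<open>w1 $ 2\<close>
  is that of \<open>alpha\<close> instead of \<open>beta\<close>.\<close>

lemma omega_map_std:
  assumes deg: "a - n + (c - j) + \<tau> = e" "b - j - \<tau> + (d - n - \<tau>) = f"
    and w: "w1 $ 1 = 0" "w2 $ 2 = 0" "w3 $ 3 = 0"
  shows "ev (pt E1 X1 (axis 3 1) w3) (restrict_to (tensor (V a b) (V c d)) (proj e f \<circ> omega_map \<tau> j n)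
      (genE a b c d w1 (axis 1 1) w2 (axis 2 1)))
    = falling a n * falling d n * falling b j * falling c j * falling (b - j) \<tau> * falling (d - n) \<tau>
      * (w1 $ 2 ^ n * w1 $ 3 ^ (a - n) * (w2 $ 1 ^ j * w2 $ 3 ^ (c - j)) * (w3 $ 1 ^ (b - j - \<tau>) * w3 $ 2 ^ (d - n - \<tau>)))"
proof -
  have "genE a b c d w1 (axis 1 1) w2 (axis 2 1) \<in> tensor (V a b) (V c d)"
    unfolding V_eq using w by (intro gen_in_tensor[OF adm_E]) (simp_all add: ip_axis)
  moreover have "ip (axis 3 1) w3 = 0" using w by (simp add: ip_axis)
  ultimately have "ev (pt E1 X1 (axis 3 1) w3) (restrict_to (tensor (V a b) (V c d)) (proj e f \<circ> omega_map \<tau> j n)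
      (genE a b c d w1 (axis 1 1) w2 (axis 2 1)))
    = ev (pt E1 X1 (axis 3 1) w3) (omega_map \<tau> j n (genE a b c d w1 (axis 1 1) w2 (axis 2 1)))"
    using omega_map_SD[OF deg] by (simp add: restrict_to_def ev_proj)
  then show ?thesis
    by (simp add: omega_map_gen ev_L_pt ip_axis crs_axis axis_nth mult_ac)
qed

section \<open>The central character\<close>

lemma cube_root_of_unity: "\<exists>\<zeta>::complex. \<zeta> ^ 3 = 1 \<and> (\<forall>m n. \<zeta> ^ m = \<zeta> ^ n \<longrightarrow> m mod 3 = n mod 3)"
proof -
  define \<zeta> where "\<zeta> = Complex (- 1 / 2) (sqrt 3 / 2)"
  have sq: "\<zeta> ^ 2 = Complex (- 1 / 2) (- sqrt 3 / 2)"
    by (simp add: \<zeta>_def power2_eq_square complex_eq_iff)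
  have cube: "\<zeta> ^ 3 = 1"
    unfolding power3_eq_cube by (simp add: \<zeta>_def complex_eq_iff)
  have red: "\<zeta> ^ m = \<zeta> ^ (m mod 3)" for m
    using div_mult_mod_eq[of m 3] by (metis power_add power_mult power_one mult_1 mult.commute cube)
  have "\<zeta> \<noteq> 1" "\<zeta> ^ 2 \<noteq> 1" "\<zeta> ^ 2 \<noteq> \<zeta>"
    unfolding sq by (simp_all add: \<zeta>_def complex_eq_iff)
  then have "i = j" if "\<zeta> ^ i = \<zeta> ^ j" "i < 3" "j < 3" for i j
    using that by (auto simp: less_Suc_eq numeral_3_eq_3 numeral_2_eq_2)
  then have "\<forall>m n. \<zeta> ^ m = \<zeta> ^ n \<longrightarrow> m mod 3 = n mod 3"
    using red by (metis mod_less_divisor zero_less_numeral)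
  then show ?thesis using cube by blast
qed

text \<open>The scalar matrix of a primitive cube root of unity \<open>\<zeta>\<close> lies in
  \<open>SL3\<close> and acts by \<open>\<zeta>\<close> on vectors and by \<open>\<zeta> ^ 2\<close>
  on covectors. An embedding of V(e,f) forces its scalars on both modules to agree.\<close>

lemma occurs_in_congruence:
  assumes "occurs_in (V e f) (tensor (V a b) (V c d))"
  shows "(e + 2 * f) mod 3 = (a + 2 * b + c + 2 * d) mod 3"
proof -
  obtain W W' \<phi> where W: "G_submodule W" "G_submodule W'" "tensor (V a b) (V c d) = {p + q | p q. p \<in> W \<and> q \<in> W'}"
    and \<phi>: "\<phi> \<in> Hom_G (V e f) W" "bij_betw \<phi> (V e f) W"
    using assms by (auto simp: occurs_in_def G_isomorphic_def)
  have W_sub: "W \<subseteq> tensor (V a b) (V c d)"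
  proof
    fix p assume "p \<in> W"
    moreover have "0 \<in> W'" using W(2) P.subspace_0 by (auto simp: G_submodule_def)
    ultimately have "\<exists>p' q. p = p' + q \<and> p' \<in> W \<and> q \<in> W'" by (intro exI[of _ p] exI[of _ 0]) simp
    then show "p \<in> tensor (V a b) (V c d)" unfolding W(3) by blast
  qed
  obtain \<zeta> :: complex where \<zeta>: "\<zeta> ^ 3 = 1" "\<And>m n. \<zeta> ^ m = \<zeta> ^ n \<Longrightarrow> m mod 3 = n mod 3"
    using cube_root_of_unity by blast
  define g :: "complex^3^3" where "g = (\<chi> i j. if i = j then \<zeta> else 0)"
  define h :: "complex^3^3" where "h = (\<chi> i j. if i = j then \<zeta> ^ 2 else 0)"
  have \<zeta>3: "\<zeta> * \<zeta> ^ 2 = 1" "\<zeta> ^ 2 * \<zeta> = 1" "\<zeta> * \<zeta> * \<zeta> = 1"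
    using \<zeta>(1) by (simp_all add: power2_eq_square power3_eq_cube mult_ac)
  have g: "g \<in> SL3"
    by (simp add: SL3_def g_def det_3 \<zeta>3)
  have "matrix_inv g = h"
    by (intro matrix_inv_eqI)
      (simp_all add: g_def h_def vec_eq_iff matrix_matrix_mult_def mat_def forall_3 sum_3 \<zeta>3)
  then have "dual g = h"
    by (simp add: dual_def h_def transpose_def vec_eq_iff)
  have scalar: "g *v v = \<zeta> *s v" "h *v v = \<zeta> ^ 2 *s v" for v
    by (simp_all add: g_def h_def vec_eq_iff forall_3 matrix_vector_mult_def sum_3)
  have actE: "act g (L k v) = Cst \<zeta> * L k v" if "isE k" for k v
    using that by (simp add: act_L slot_mat_def scalar L_scale)
  have actX: "act g (L k v) = Cst (\<zeta> ^ 2) * L k v" if "\<not> isE k" for k v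
    using that \<open>dual g = h\<close> by (simp add: act_L slot_mat_def scalar L_scale)
  define N where "N = a + 2 * b + c + 2 * d"
  have actT: "act g p = pscale (\<zeta> ^ N) p" if "p \<in> tensor (V a b) (V c d)" for p
    using subsetD[OF tensor_span[OF adm_E] that[unfolded V_eq]]
  proof (induction rule: P.span_induct_alt)
    case (step u x y)
    then obtain v1 w1 v2 w2 where x: "x = genE a b c d v1 w1 v2 w2" by blast
    have "Cst (\<zeta> ^ N) = Cst \<zeta> ^ a * (Cst (\<zeta> ^ 2) ^ b * (Cst \<zeta> ^ c * Cst (\<zeta> ^ 2) ^ d))"
      by (simp only: N_def power_add Cst_simps Cst_power power_mult[symmetric] mult_ac)
    then have "act g x = pscale (\<zeta> ^ N) x"
      by (simp add: x gen_def actE actX isE_def pscale_def power_mult_distrib mult_ac)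
    with step show ?case by (simp add: pscale_def distrib_left mult.left_commute)
  qed simp
  \<comment> \<open>A nonzero element of V(e,f): the two axes form a flag, and the value of
    \<open>p\<close> at the same pair is 1.\<close>
  define p where "p = L E1 (axis 1 1) ^ e * L X1 (axis 2 1) ^ f"
  have p: "p \<in> V e f"
    unfolding p_def V_eq by (rule powers_harm, simp, subst ip_axis, simp add: axis_def)
  have "ev (pt E1 X1 (axis 1 1) (axis 2 1)) p = 1"
    by (simp add: p_def ev_L_pt ip_axis axis_nth)
  then have "p \<noteq> 0" by auto
  have V: "P.subspace (V e f)" by (simp add: V_eq subspace_harm)
  then have "\<phi> p \<noteq> 0"
    using \<open>p \<noteq> 0\<close> p \<phi>(2) Hom_G_0[OF \<phi>(1) V] P.subspace_0[OF V] by (metis bij_betw_imp_inj_on inj_onD)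
  define M where "M = e + 2 * f"
  have cM: "Cst (\<zeta> ^ M) = Cst \<zeta> ^ e * Cst (\<zeta> ^ 2) ^ f"
    by (simp only: M_def power_add Cst_simps Cst_power power_mult[symmetric] mult_ac)
  have "act g p = pscale (\<zeta> ^ M) p"
    by (simp add: p_def actE actX isE_def pscale_def power_mult_distrib cM mult_ac)
  then have "pscale (\<zeta> ^ M) (\<phi> p) = act g (\<phi> p)"
    using Hom_GD(3)[OF \<phi>(1) p, of "\<zeta> ^ M"] Hom_GD(4)[OF \<phi>(1) g p] by simp
  also have "\<dots> = pscale (\<zeta> ^ N) (\<phi> p)"
    by (rule actT[OF subsetD[OF W_sub Hom_GD(1)[OF \<phi>(1) p]]])
  finally have "\<zeta> ^ M = \<zeta> ^ N"
    using \<open>\<phi> p \<noteq> 0\<close> by simp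
  from \<zeta>(2)[OF this] show ?thesis by (simp only: N_def M_def)
qed

section \<open>Bases of equivariant maps\<close>

text \<open>Membership in \<open>JJ\<close> bounds the order of each differentiation by the degree
  it lowers, so no exponent is truncated and all falling factorials are nonzero.\<close>

lemma theta_basis:
  assumes e: "int e = int a + c - s - 2 * t" and f: "int f = int b + d - s + t" and t: "t \<ge> 0"
  shows "is_basis (JJ a b c d s t)
    (\<lambda>j. restrict_to (tensor (V a b) (V c d)) (proj e f \<circ> theta_map (nat t) (nat j) (nat (s - j))))
    (Hom_G (tensor (V a b) (V c d)) (V e f))"
proof -
  have deg: "a - nat (s - j) - nat t + (c - nat j - nat t) = e" "b - nat j + (d - nat (s - j)) + nat t = f"
    "nat (s - j) \<le> a" "nat (s - j) \<le> d" "nat j \<le> b" "nat j \<le> c" "nat t \<le> a - nat (s - j)" "nat t \<le> c - nat j"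
    if "j \<in> JJ a b c d s t" for j
    using that e f t by (auto simp: JJ_def)
  show ?thesis
  proof (rule is_basis_Hom_G[OF adm_E e f, unfolded V_eq[symmetric]])
    fix j assume j: "j \<in> JJ a b c d s t"
    note d = deg[OF j]
    show "restrict_to (tensor (V a b) (V c d)) (proj e f \<circ> theta_map (nat t) (nat j) (nat (s - j)))
        \<in> Hom_G (tensor (V a b) (V c d)) (V e f)"
      by (rule theta_map_Hom_G[OF d(1,2)])
    let ?\<kappa> = "\<lambda>j. falling a (nat (s - j)) * falling d (nat (s - j)) * falling b (nat j) * falling c (nat j)
      * falling (a - nat (s - j)) (nat t) * falling (c - nat j) (nat t)"
    show "?\<kappa> j \<noteq> 0" using d by (simp add: falling_nonzero)
    have exps: "nat (b - j) = b - nat j" "nat (d - s + j) = d - nat (s - j)"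
      "nat (a - s + j - t) = a - nat (s - j) - nat t" "nat (c - t - j) = c - nat j - nat t"
      using j t by (auto simp: JJ_def)
    fix w1 w2 w3 :: "complex^3" assume w: "w1 $ 1 = 0" "w2 $ 2 = 0" "w3 $ 3 = 0"
    show "ev (pt E1 X1 w3 (axis 3 1)) (restrict_to (tensor (V a b) (V c d))
        (proj e f \<circ> theta_map (nat t) (nat j) (nat (s - j))) (genE a b c d (axis 1 1) w1 (axis 2 1) w2))
      = ?\<kappa> j * pmono a b c d s t j w1 w2 w3"
      unfolding theta_map_std[OF d(1,2) w] pmono_def exps by (rule refl)
  qed
qed

text \<open>In the dual labelling \<open>(a, b, c, d)\<close> becomes \<open>(b, a, d, c)\<close>,
  \<open>s\<close> becomes \<open>s + t\<close> and \<open>t\<close> becomes \<open>- t\<close>. The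
  index is then the exponent of \<open>alpha\<close>, and \<open>beta\<close> carries
  \<open>s + t - j\<close>.\<close>

lemma omega_basis:
  assumes e: "int e = int a + c - s - 2 * t" and f: "int f = int b + d - s + t" and t: "t \<le> 0"
  shows "is_basis (JJ b a d c (s + t) (- t))
    (\<lambda>j. restrict_to (tensor (V a b) (V c d)) (proj e f \<circ> omega_map (nat (- t)) (nat (s + t - j)) (nat j)))
    (Hom_G (tensor (V a b) (V c d)) (V e f))"
proof -
  have deg: "a - nat j + (c - nat (s + t - j)) + nat (- t) = e" "b - nat (s + t - j) - nat (- t) + (d - nat j - nat (- t)) = f"
    "nat j \<le> a" "nat j \<le> d" "nat (s + t - j) \<le> b" "nat (s + t - j) \<le> c"
    "nat (- t) \<le> b - nat (s + t - j)" "nat (- t) \<le> d - nat j"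
    if "j \<in> JJ b a d c (s + t) (- t)" for j
    using that e f t by (auto simp: JJ_def)
  have f': "int f = int b + d - (s + t) - 2 * (- t)" and e': "int e = int a + c - (s + t) + (- t)"
    using e f by auto
  show ?thesis
  proof (rule is_basis_Hom_G[OF adm_X f' e', unfolded V_eq'[symmetric]])
    fix j assume j: "j \<in> JJ b a d c (s + t) (- t)"
    note d = deg[OF j]
    show "restrict_to (tensor (V a b) (V c d)) (proj e f \<circ> omega_map (nat (- t)) (nat (s + t - j)) (nat j))
        \<in> Hom_G (tensor (V a b) (V c d)) (V e f)"
      by (rule omega_map_Hom_G[OF d(1,2)])
    let ?\<kappa> = "\<lambda>j. falling a (nat j) * falling d (nat j) * falling b (nat (s + t - j)) * falling c (nat (s + t - j))
      * falling (b - nat (s + t - j)) (nat (- t)) * falling (d - nat j) (nat (- t))"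
    show "?\<kappa> j \<noteq> 0" using d by (simp add: falling_nonzero)
    have exps: "nat (a - j) = a - nat j" "nat (c - (s + t) + j) = c - nat (s + t - j)"
      "nat (b - (s + t) + j - (- t)) = b - nat (s + t - j) - nat (- t)" "nat (d - (- t) - j) = d - nat j - nat (- t)"
      using j t by (auto simp: JJ_def)
    fix w1 w2 w3 :: "complex^3" assume w: "w1 $ 1 = 0" "w2 $ 2 = 0" "w3 $ 3 = 0"
    have gen: "gen X1 E1 X2 E2 b a d c (axis 1 1) w1 (axis 2 1) w2 = genE a b c d w1 (axis 1 1) w2 (axis 2 1)"
      by (simp add: gen_def mult_ac)
    have pt: "pt X1 E1 w3 (axis 3 1) = pt E1 X1 (axis 3 1) w3"
      by (rule pt_commute) simp
    show "ev (pt X1 E1 w3 (axis 3 1)) (restrict_to (tensor (V a b) (V c d))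
        (proj e f \<circ> omega_map (nat (- t)) (nat (s + t - j)) (nat j)) (gen X1 E1 X2 E2 b a d c (axis 1 1) w1 (axis 2 1) w2))
      = ?\<kappa> j * pmono b a d c (s + t) (- t) j w1 w2 w3"
      unfolding gen pt omega_map_std[OF d(1,2) w] pmono_def exps by (rule refl)
  qed
qed

theorem theorem3p1:
  fixes a b c d e f :: nat and s t :: int and J :: "int set"
  assumes occurs: "occurs_in (V e f) (tensor (V a b) (V c d))"
    and s: "s = ((int a + int c - int e) + 2 * (int b + int d - int f)) div 3"
    and t: "t = ((int a + int c - int e) - (int b + int d - int f)) div 3"
    and J: "J = {j. 0 \<le> j \<and> j \<le> s + t \<and> s + t \<le> int c + int d \<and>
                    0 \<le> s - j \<and> s - j \<le> int d \<and>
                    s + t - j \<le> int a \<and>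
                    j \<le> int b \<and>
                    j \<le> int b + t \<and>
                    j \<le> int c - t \<and>
                    j \<le> int c}"
  shows "3 * s = (int a + int c - int e) + 2 * (int b + int d - int f) \<and>
    3 * t = (int a + int c - int e) - (int b + int d - int f) \<and>
    (t \<ge> 0 \<longrightarrow>
      is_basis J
        (\<lambda>j. restrict_to (tensor (V a b) (V c d))
               (proj e f \<circ> mult_S \<circ> (theta ^^ nat t) \<circ> mult_D
                 \<circ> (beta ^^ nat j) \<circ> (alpha ^^ nat (s - j))))
        (Hom_G (tensor (V a b) (V c d)) (V e f))) \<and>
    (t \<le> 0 \<longrightarrow>
      is_basis J
        (\<lambda>j. restrict_to (tensor (V a b) (V c d))
               (proj e f \<circ> mult_D \<circ> (omega ^^ nat (- t)) \<circ> mult_S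
                 \<circ> (beta ^^ nat j) \<circ> (alpha ^^ nat (s + t - j))))
        (Hom_G (tensor (V a b) (V c d)) (V e f)))"
proof -
  have "(e + 2 * f) mod 3 = (a + 2 * b + c + 2 * d) mod 3"
    by (rule occurs_in_congruence[OF occurs])
  then have "int (a + 2 * b + c + 2 * d) mod 3 = int (e + 2 * f) mod 3"
    by (metis of_nat_mod of_nat_numeral)
  then have "3 dvd int (a + 2 * b + c + 2 * d) - int (e + 2 * f)"
    by (simp only: mod_eq_dvd_iff)
  then have dvd: "3 dvd (int a + int c - int e) + 2 * (int b + int d - int f)"
    by (simp add: algebra_simps)
  \<comment> \<open>The numerators of \<open>s\<close> and \<open>t\<close> differ by
    \<open>3 * (b + d - f)\<close>.\<close>
  then have "3 dvd (int a + int c - int e) + 2 * (int b + int d - int f) - 3 * (int b + int d - int f)"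
    by (rule dvd_diff) simp
  then have "3 dvd (int a + int c - int e) - (int b + int d - int f)"
    by (simp add: algebra_simps)
  with dvd have s3: "3 * s = (int a + int c - int e) + 2 * (int b + int d - int f)"
    and t3: "3 * t = (int a + int c - int e) - (int b + int d - int f)"
    unfolding s t by (simp_all only: dvd_mult_div_cancel)
  have e: "int e = int a + c - s - 2 * t" and f: "int f = int b + d - s + t"
    using s3 t3 by auto
  have theta: "is_basis J
        (\<lambda>j. restrict_to (tensor (V a b) (V c d))
               (proj e f \<circ> mult_S \<circ> (theta ^^ nat t) \<circ> mult_D
                 \<circ> (beta ^^ nat j) \<circ> (alpha ^^ nat (s - j))))
        (Hom_G (tensor (V a b) (V c d)) (V e f))" if "t \<ge> 0"
  proof -
    \<comment> \<open>With \<open>t \<ge> 0\<close> the six inequalities of \<open>JJ\<close> imply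
      the others in \<open>J\<close>.\<close>
    have "J = JJ a b c d s t" unfolding J JJ_def using that by auto
    then show ?thesis
      using theta_basis[OF e f that] by (simp add: theta_map_def comp_assoc)
  qed
  have omega: "is_basis J
        (\<lambda>j. restrict_to (tensor (V a b) (V c d))
               (proj e f \<circ> mult_D \<circ> (omega ^^ nat (- t)) \<circ> mult_S
                 \<circ> (beta ^^ nat j) \<circ> (alpha ^^ nat (s + t - j))))
        (Hom_G (tensor (V a b) (V c d)) (V e f))" if "t \<le> 0"
  \<comment> \<open>The dual labelling is indexed by the exponent of \<open>alpha\<close>, the
    theorem by that of \<open>beta\<close>; the two add up to \<open>s + t\<close>.\<close>
  proof (rule is_basis_reindex[where h = "\<lambda>j. s + t - j"])
    show "is_basis (JJ b a d c (s + t) (- t)) ((\<lambda>j. restrict_to (tensor (V a b) (V c d))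
               (proj e f \<circ> mult_D \<circ> (omega ^^ nat (- t)) \<circ> mult_S
                 \<circ> (beta ^^ nat j) \<circ> (alpha ^^ nat (s + t - j)))) \<circ> (\<lambda>j. s + t - j))
        (Hom_G (tensor (V a b) (V c d)) (V e f))"
      using omega_basis[OF e f that] by (simp add: omega_map_def comp_def)
    have iff: "j \<in> J \<longleftrightarrow> s + t - j \<in> JJ b a d c (s + t) (- t)" for j
      unfolding J JJ_def using that by auto
    show "(\<lambda>j. s + t - j) ` JJ b a d c (s + t) (- t) = J"
    proof
      show "(\<lambda>j. s + t - j) ` JJ b a d c (s + t) (- t) \<subseteq> J" by (auto simp: iff)
      show "J \<subseteq> (\<lambda>j. s + t - j) ` JJ b a d c (s + t) (- t)"
      proof
        fix j assume "j \<in> J"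
        then show "j \<in> (\<lambda>j. s + t - j) ` JJ b a d c (s + t) (- t)"
          by (intro image_eqI[of _ _ "s + t - j"]) (simp_all add: iff)
      qed
    qed
  qed
  show ?thesis by (intro conjI impI s3 t3 theta omega)
qed

end
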